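(* Let $\mathbb{E}$ be any Gumm category. Then any internal groupoid $X_{\bullet}$ in $\mathbb{E}$ is abelian. Accordingly, for every object $X$, the fiber $Grd_X\mathbb{E}$ of the fibration $(\;)_0: Grd\mathbb{E}\to\mathbb{E}$ is a naturally Mal'tsev category. Furthermore, this fiber $Grd_X\mathbb{E}$ is such that any base-change functor with respect to its fibration of points is fully faithful.
   Context: All categories are finitely complete. A Gumm category is a finitely complete category satisfying the Shifting Lemma: for any equivalence relations $R,S,T$ on an object $X$ with $R\cap S\subset T$ and any generalized elements $x,y,x',y'$ of $X$ with $xSy$, $x'Sy'$, $xRx'$, $yRy'$, if $xTx'$ then $yTy'$. $Grd\mathbb{E}$ is the category of internal groupoids and internal functors in $\mathbb{E}$; $(\;)_0$ sends a groupoid $X_\bullet$ to its object of objects $X_0$; the fiber $Grd_X\mathbb{E}$ consists of the groupoids with object of objects $X$ and the functors which are the identity on objects. For an internal groupoid $X_\bullet$ with domain and codomain maps $d_0,d_1:X_1\to X_0$, the object $(d_0,d_1):X_1\to X_0\times X_0$ of the slice category $\mathbb{E}/(X_0\times X_0)$ carries the associative Mal'tsev operation $\chi(\alpha,\beta,\gamma)=\alpha.\beta^{-1}.\gamma$ on triples of parallel arrows; the groupoid is abelian when this operation is autonomous, i.e. associative and commutative ($\chi(\alpha,\beta,\gamma)=\chi(\gamma,\beta,\alpha)$). A naturally Mal'tsev category is one in which every object $A$ is endowed with a Mal'tsev operation $p_A:A\times A\times A\to A$ ($p(x,y,y)=x=p(y,y,x)$), natural in $A$. For a category $\mathbb{C}$,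 $Pt_Y\mathbb{C}$ is the category of split epimorphisms with codomain $Y$ and given section (morphisms: maps over $Y$ commuting with sections); the fibration of points sends a split epimorphism to its codomain, and the base-change functor along $h:Y'\to Y$ is $h^*:Pt_Y\mathbb{C}\to Pt_{Y'}\mathbb{C}$ given by pulling back along $h$. *)

theory Defs
  imports Main
begin

text \<open>
  A category is given by its hom-sets. Hom-sets of different pairs of objects need not be
  disjoint, so notions depending on the domain or codomain of an arrow take these objects
  as arguments.
\<close>

record ('o, 'a) cat =
  Obj :: "'o set"
  Hom :: "'o \<Rightarrow> 'o \<Rightarrow> 'a set"
  Idn :: "'o \<Rightarrow> 'a"
  Comp :: "'a \<Rightarrow> 'a \<Rightarrow> 'a" (infixr "\<cdot>\<index>" 70)

locale category =
  fixes C :: "('o, 'a) cat" (structure)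
  assumes hom_obj: "f \<in> Hom C A B \<Longrightarrow> A \<in> Obj C \<and> B \<in> Obj C"
    and idn_hom: "A \<in> Obj C \<Longrightarrow> Idn C A \<in> Hom C A A"
    and comp_hom: "\<lbrakk>f \<in> Hom C A B; g \<in> Hom C B D\<rbrakk> \<Longrightarrow> g \<cdot> f \<in> Hom C A D"
    and idn_left: "f \<in> Hom C A B \<Longrightarrow> Idn C B \<cdot> f = f"
    and idn_right: "f \<in> Hom C A B \<Longrightarrow> f \<cdot> Idn C A = f"
    and comp_assoc: "\<lbrakk>f \<in> Hom C A B; g \<in> Hom C B D; h \<in> Hom C D E\<rbrakk>
      \<Longrightarrow> (h \<cdot> g) \<cdot> f = h \<cdot> (g \<cdot> f)"


subsection \<open>Finite limits\<close>

definition is_terminal :: "('o, 'a) cat \<Rightarrow> 'o \<Rightarrow> bool" where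
  "is_terminal C T \<longleftrightarrow> T \<in> Obj C \<and> (\<forall>A \<in> Obj C. \<exists>!f. f \<in> Hom C A T)"

definition is_product :: "('o, 'a) cat \<Rightarrow> 'o \<Rightarrow> 'o \<Rightarrow> 'o \<Rightarrow> 'a \<Rightarrow> 'a \<Rightarrow> bool" where
  "is_product C A B P p q \<longleftrightarrow>
     p \<in> Hom C P A \<and> q \<in> Hom C P B \<and>
     (\<forall>W a b. a \<in> Hom C W A \<longrightarrow> b \<in> Hom C W B \<longrightarrow>
        (\<exists>!u. u \<in> Hom C W P \<and> p \<cdot>\<^bsub>C\<^esub> u = a \<and> q \<cdot>\<^bsub>C\<^esub> u = b))"

text \<open>Pullback of \<open>f : A \<rightarrow> Z\<close> and \<open>g : B \<rightarrow> Z\<close>.\<close>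

definition is_pullback ::
  "('o, 'a) cat \<Rightarrow> 'o \<Rightarrow> 'o \<Rightarrow> 'o \<Rightarrow> 'a \<Rightarrow> 'a \<Rightarrow> 'o \<Rightarrow> 'a \<Rightarrow> 'a \<Rightarrow> bool" where
  "is_pullback C A B Z f g P p q \<longleftrightarrow>
     f \<in> Hom C A Z \<and> g \<in> Hom C B Z \<and>
     p \<in> Hom C P A \<and> q \<in> Hom C P B \<and> f \<cdot>\<^bsub>C\<^esub> p = g \<cdot>\<^bsub>C\<^esub> q \<and>
     (\<forall>W a b. a \<in> Hom C W A \<longrightarrow> b \<in> Hom C W B \<longrightarrow> f \<cdot>\<^bsub>C\<^esub> a = g \<cdot>\<^bsub>C\<^esub> b \<longrightarrow>
        (\<exists>!u. u \<in> Hom C W P \<and> p \<cdot>\<^bsub>C\<^esub> u = a \<and> q \<cdot>\<^bsub>C\<^esub> u = b))"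

definition finitely_complete :: "('o, 'a) cat \<Rightarrow> bool" where
  "finitely_complete C \<longleftrightarrow>
     category C \<and> (\<exists>T. is_terminal C T) \<and>
     (\<forall>A B Z f g. f \<in> Hom C A Z \<longrightarrow> g \<in> Hom C B Z \<longrightarrow>
        (\<exists>P p q. is_pullback C A B Z f g P p q))"

text \<open>Chosen products and pullbacks; they are meaningful whenever the limit exists.\<close>

definition prod_cone :: "('o, 'a) cat \<Rightarrow> 'o \<Rightarrow> 'o \<Rightarrow> 'o \<times> 'a \<times> 'a" where
  "prod_cone C A B = (SOME (P, p, q). is_product C A B P p q)"

definition prod_ob :: "('o, 'a) cat \<Rightarrow> 'o \<Rightarrow> 'o \<Rightarrow> 'o" where
  "prod_ob C A B = fst (prod_cone C A B)"

definition prod_fst :: "('o, 'a) cat \<Rightarrow> 'o \<Rightarrow> 'o \<Rightarrow> 'a" where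
  "prod_fst C A B = fst (snd (prod_cone C A B))"

definition prod_snd :: "('o, 'a) cat \<Rightarrow> 'o \<Rightarrow> 'o \<Rightarrow> 'a" where
  "prod_snd C A B = snd (snd (prod_cone C A B))"

definition prod_pair :: "('o, 'a) cat \<Rightarrow> 'o \<Rightarrow> 'o \<Rightarrow> 'o \<Rightarrow> 'a \<Rightarrow> 'a \<Rightarrow> 'a" where
  "prod_pair C A B W a b = (THE u. u \<in> Hom C W (prod_ob C A B) \<and>
     prod_fst C A B \<cdot>\<^bsub>C\<^esub> u = a \<and> prod_snd C A B \<cdot>\<^bsub>C\<^esub> u = b)"

definition pb_cone :: "('o, 'a) cat \<Rightarrow> 'o \<Rightarrow> 'o \<Rightarrow> 'o \<Rightarrow> 'a \<Rightarrow> 'a \<Rightarrow> 'o \<times> 'a \<times> 'a" where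
  "pb_cone C A B Z f g = (SOME (P, p, q). is_pullback C A B Z f g P p q)"

definition pb_ob :: "('o, 'a) cat \<Rightarrow> 'o \<Rightarrow> 'o \<Rightarrow> 'o \<Rightarrow> 'a \<Rightarrow> 'a \<Rightarrow> 'o" where
  "pb_ob C A B Z f g = fst (pb_cone C A B Z f g)"

definition pb_fst :: "('o, 'a) cat \<Rightarrow> 'o \<Rightarrow> 'o \<Rightarrow> 'o \<Rightarrow> 'a \<Rightarrow> 'a \<Rightarrow> 'a" where
  "pb_fst C A B Z f g = fst (snd (pb_cone C A B Z f g))"

definition pb_snd :: "('o, 'a) cat \<Rightarrow> 'o \<Rightarrow> 'o \<Rightarrow> 'o \<Rightarrow> 'a \<Rightarrow> 'a \<Rightarrow> 'a" where
  "pb_snd C A B Z f g = snd (snd (pb_cone C A B Z f g))"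

definition pb_pair ::
  "('o, 'a) cat \<Rightarrow> 'o \<Rightarrow> 'o \<Rightarrow> 'o \<Rightarrow> 'a \<Rightarrow> 'a \<Rightarrow> 'o \<Rightarrow> 'a \<Rightarrow> 'a \<Rightarrow> 'a" where
  "pb_pair C A B Z f g W a b = (THE u. u \<in> Hom C W (pb_ob C A B Z f g) \<and>
     pb_fst C A B Z f g \<cdot>\<^bsub>C\<^esub> u = a \<and> pb_snd C A B Z f g \<cdot>\<^bsub>C\<^esub> u = b)"


subsection \<open>Functors, fibers, slices\<close>

record ('o, 'a, 'p, 'b) ftor =
  FObj :: "'o \<Rightarrow> 'p"
  FArr :: "'o \<Rightarrow> 'o \<Rightarrow> 'a \<Rightarrow> 'b"

definition is_functor ::
  "('o, 'a) cat \<Rightarrow> ('p, 'b) cat \<Rightarrow> ('o, 'a, 'p, 'b) ftor \<Rightarrow> bool" where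
  "is_functor C D F \<longleftrightarrow>
     category C \<and> category D \<and>
     (\<forall>A \<in> Obj C. FObj F A \<in> Obj D \<and> FArr F A A (Idn C A) = Idn D (FObj F A)) \<and>
     (\<forall>A B f. f \<in> Hom C A B \<longrightarrow> FArr F A B f \<in> Hom D (FObj F A) (FObj F B)) \<and>
     (\<forall>A B K f g. f \<in> Hom C A B \<longrightarrow> g \<in> Hom C B K \<longrightarrow>
        FArr F A K (g \<cdot>\<^bsub>C\<^esub> f) = FArr F B K g \<cdot>\<^bsub>D\<^esub> FArr F A B f)"

definition fully_faithful ::
  "('o, 'a) cat \<Rightarrow> ('p, 'b) cat \<Rightarrow> ('o, 'a, 'p, 'b) ftor \<Rightarrow> bool" where
  "fully_faithful C D F \<longleftrightarrow>
     is_functor C D F \<and>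
     (\<forall>A \<in> Obj C. \<forall>B \<in> Obj C.
        bij_betw (FArr F A B) (Hom C A B) (Hom D (FObj F A) (FObj F B)))"

definition fiber ::
  "('o, 'a) cat \<Rightarrow> ('p, 'b) cat \<Rightarrow> ('o, 'a, 'p, 'b) ftor \<Rightarrow> 'p \<Rightarrow> ('o, 'a) cat" where
  "fiber C D F X = \<lparr>
     Obj = {A \<in> Obj C. FObj F A = X},
     Hom = (\<lambda>A B. {f \<in> Hom C A B. FObj F A = X \<and> FObj F B = X \<and> FArr F A B f = Idn D X}),
     Idn = Idn C,
     Comp = Comp C \<rparr>"

definition slice :: "('o, 'a) cat \<Rightarrow> 'o \<Rightarrow> ('o \<times> 'a, 'a) cat" where
  "slice C Z = \<lparr>
     Obj = {(A, a). a \<in> Hom C A Z},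
     Hom = (\<lambda>(A, a) (B, b). {f \<in> Hom C A B. a \<in> Hom C A Z \<and> b \<in> Hom C B Z \<and> b \<cdot>\<^bsub>C\<^esub> f = a}),
     Idn = (\<lambda>(A, a). Idn C A),
     Comp = Comp C \<rparr>"


subsection \<open>Mal'tsev operations\<close>

definition cube :: "('o, 'a) cat \<Rightarrow> 'o \<Rightarrow> 'o" where
  "cube C A = prod_ob C (prod_ob C A A) A"

definition cube_pr1 :: "('o, 'a) cat \<Rightarrow> 'o \<Rightarrow> 'a" where
  "cube_pr1 C A = prod_fst C A A \<cdot>\<^bsub>C\<^esub> prod_fst C (prod_ob C A A) A"

definition cube_pr2 :: "('o, 'a) cat \<Rightarrow> 'o \<Rightarrow> 'a" where
  "cube_pr2 C A = prod_snd C A A \<cdot>\<^bsub>C\<^esub> prod_fst C (prod_ob C A A) A"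

definition cube_pr3 :: "('o, 'a) cat \<Rightarrow> 'o \<Rightarrow> 'a" where
  "cube_pr3 C A = prod_snd C (prod_ob C A A) A"

definition triple :: "('o, 'a) cat \<Rightarrow> 'o \<Rightarrow> 'o \<Rightarrow> 'a \<Rightarrow> 'a \<Rightarrow> 'a \<Rightarrow> 'a" where
  "triple C A W x y z = prod_pair C (prod_ob C A A) A W (prod_pair C A A W x y) z"

text \<open>
  The value of an internal ternary operation \<open>p : A \<times> A \<times> A \<rightarrow> A\<close> on generalized elements
  \<open>x, y, z : W \<rightarrow> A\<close>.
\<close>

definition app3 :: "('o, 'a) cat \<Rightarrow> 'o \<Rightarrow> 'a \<Rightarrow> 'o \<Rightarrow> 'a \<Rightarrow> 'a \<Rightarrow> 'a \<Rightarrow> 'a" where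
  "app3 C A p W x y z = p \<cdot>\<^bsub>C\<^esub> triple C A W x y z"

definition maltsev_op :: "('o, 'a) cat \<Rightarrow> 'o \<Rightarrow> 'a \<Rightarrow> bool" where
  "maltsev_op C A p \<longleftrightarrow>
     p \<in> Hom C (cube C A) A \<and>
     (\<forall>W. \<forall>x \<in> Hom C W A. \<forall>y \<in> Hom C W A.
        app3 C A p W x y y = x \<and> app3 C A p W y y x = x)"

definition associative_op :: "('o, 'a) cat \<Rightarrow> 'o \<Rightarrow> 'a \<Rightarrow> bool" where
  "associative_op C A p \<longleftrightarrow>
     (\<forall>W. \<forall>x \<in> Hom C W A. \<forall>y \<in> Hom C W A. \<forall>z \<in> Hom C W A. \<forall>u \<in> Hom C W A. \<forall>v \<in> Hom C W A.
        app3 C A p W (app3 C A p W x y z) u v = app3 C A p W x y (app3 C A p W z u v))"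

definition commutative_op :: "('o, 'a) cat \<Rightarrow> 'o \<Rightarrow> 'a \<Rightarrow> bool" where
  "commutative_op C A p \<longleftrightarrow>
     (\<forall>W. \<forall>x \<in> Hom C W A. \<forall>y \<in> Hom C W A. \<forall>z \<in> Hom C W A.
        app3 C A p W x y z = app3 C A p W z y x)"

definition autonomous_op :: "('o, 'a) cat \<Rightarrow> 'o \<Rightarrow> 'a \<Rightarrow> bool" where
  "autonomous_op C A p \<longleftrightarrow>
     maltsev_op C A p \<and> associative_op C A p \<and> commutative_op C A p"

definition naturally_maltsev :: "('o, 'a) cat \<Rightarrow> bool" where
  "naturally_maltsev C \<longleftrightarrow>
     finitely_complete C \<and>
     (\<exists>p. (\<forall>A \<in> Obj C. maltsev_op C A (p A)) \<and>
          (\<forall>A B f. f \<in> Hom C A B \<longrightarrow>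
             f \<cdot>\<^bsub>C\<^esub> p A =
             p B \<cdot>\<^bsub>C\<^esub> triple C B (cube C A)
               (f \<cdot>\<^bsub>C\<^esub> cube_pr1 C A) (f \<cdot>\<^bsub>C\<^esub> cube_pr2 C A) (f \<cdot>\<^bsub>C\<^esub> cube_pr3 C A)))"


subsection \<open>Gumm categories\<close>

text \<open>A relation on \<open>X\<close>, given by two arrows \<open>R \<rightarrow> X\<close>; it acts on generalized elements \<open>W \<rightarrow> X\<close>.\<close>

record ('o, 'a) irel =
  RObj :: 'o
  r0 :: 'a
  r1 :: 'a

definition related :: "('o, 'a) cat \<Rightarrow> ('o, 'a) irel \<Rightarrow> 'o \<Rightarrow> 'a \<Rightarrow> 'a \<Rightarrow> bool" where
  "related C R W x y \<longleftrightarrow>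
     (\<exists>u \<in> Hom C W (RObj R). r0 R \<cdot>\<^bsub>C\<^esub> u = x \<and> r1 R \<cdot>\<^bsub>C\<^esub> u = y)"

definition equivalence_relation :: "('o, 'a) cat \<Rightarrow> 'o \<Rightarrow> ('o, 'a) irel \<Rightarrow> bool" where
  "equivalence_relation C X R \<longleftrightarrow>
     r0 R \<in> Hom C (RObj R) X \<and> r1 R \<in> Hom C (RObj R) X \<and>
     (\<forall>W. \<forall>u \<in> Hom C W (RObj R). \<forall>v \<in> Hom C W (RObj R).
        r0 R \<cdot>\<^bsub>C\<^esub> u = r0 R \<cdot>\<^bsub>C\<^esub> v \<longrightarrow> r1 R \<cdot>\<^bsub>C\<^esub> u = r1 R \<cdot>\<^bsub>C\<^esub> v \<longrightarrow> u = v) \<and>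
     (\<forall>W. \<forall>x \<in> Hom C W X. related C R W x x) \<and>
     (\<forall>W x y. related C R W x y \<longrightarrow> related C R W y x) \<and>
     (\<forall>W x y z. related C R W x y \<longrightarrow> related C R W y z \<longrightarrow> related C R W x z)"

definition inter_included ::
  "('o, 'a) cat \<Rightarrow> ('o, 'a) irel \<Rightarrow> ('o, 'a) irel \<Rightarrow> ('o, 'a) irel \<Rightarrow> bool" where
  "inter_included C R S T \<longleftrightarrow>
     (\<forall>W x y. related C R W x y \<and> related C S W x y \<longrightarrow> related C T W x y)"

definition shifting_lemma :: "('o, 'a) cat \<Rightarrow> bool" where
  "shifting_lemma C \<longleftrightarrow>
     (\<forall>X R S T. X \<in> Obj C \<longrightarrow>
        equivalence_relation C X R \<longrightarrow> equivalence_relation C X S \<longrightarrow>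
        equivalence_relation C X T \<longrightarrow> inter_included C R S T \<longrightarrow>
        (\<forall>W. \<forall>x \<in> Hom C W X. \<forall>y \<in> Hom C W X. \<forall>x' \<in> Hom C W X. \<forall>y' \<in> Hom C W X.
           related C S W x y \<longrightarrow> related C S W x' y' \<longrightarrow>
           related C R W x x' \<longrightarrow> related C R W y y' \<longrightarrow>
           related C T W x x' \<longrightarrow> related C T W y y'))"

definition gumm_category :: "('o, 'a) cat \<Rightarrow> bool" where
  "gumm_category C \<longleftrightarrow> finitely_complete C \<and> shifting_lemma C"


subsection \<open>Internal groupoids\<close>

record ('o, 'a) igrpd =
  G0 :: 'o
  G1 :: 'o
  d0 :: 'a
  d1 :: 'a
  s0 :: 'a
  mul :: 'a
  ginv :: 'a

text \<open>
  The object of composable pairs is the pullback of \<open>d0\<close> and \<open>d1\<close>: its elements are the pairs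
  \<open>(\<beta>, \<alpha>)\<close> with \<open>d0 \<beta> = d1 \<alpha>\<close>, which the composition \<open>mul\<close> sends to \<open>\<beta>.\<alpha>\<close> (first \<open>\<alpha>\<close>,
  then \<open>\<beta>\<close>).
\<close>

definition composables :: "('o, 'a) cat \<Rightarrow> ('o, 'a) igrpd \<Rightarrow> 'o" where
  "composables C G = pb_ob C (G1 G) (G1 G) (G0 G) (d0 G) (d1 G)"

definition gcomp :: "('o, 'a) cat \<Rightarrow> ('o, 'a) igrpd \<Rightarrow> 'o \<Rightarrow> 'a \<Rightarrow> 'a \<Rightarrow> 'a" where
  "gcomp C G W b a = mul G \<cdot>\<^bsub>C\<^esub> pb_pair C (G1 G) (G1 G) (G0 G) (d0 G) (d1 G) W b a"

definition internal_groupoid :: "('o, 'a) cat \<Rightarrow> ('o, 'a) igrpd \<Rightarrow> bool" where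
  "internal_groupoid C G \<longleftrightarrow>
     d0 G \<in> Hom C (G1 G) (G0 G) \<and> d1 G \<in> Hom C (G1 G) (G0 G) \<and>
     s0 G \<in> Hom C (G0 G) (G1 G) \<and>
     mul G \<in> Hom C (composables C G) (G1 G) \<and>
     ginv G \<in> Hom C (G1 G) (G1 G) \<and>
     d0 G \<cdot>\<^bsub>C\<^esub> s0 G = Idn C (G0 G) \<and> d1 G \<cdot>\<^bsub>C\<^esub> s0 G = Idn C (G0 G) \<and>
     d0 G \<cdot>\<^bsub>C\<^esub> ginv G = d1 G \<and> d1 G \<cdot>\<^bsub>C\<^esub> ginv G = d0 G \<and>
     (\<forall>W. \<forall>a \<in> Hom C W (G1 G). \<forall>b \<in> Hom C W (G1 G).
        d0 G \<cdot>\<^bsub>C\<^esub> b = d1 G \<cdot>\<^bsub>C\<^esub> a \<longrightarrow>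
        d0 G \<cdot>\<^bsub>C\<^esub> gcomp C G W b a = d0 G \<cdot>\<^bsub>C\<^esub> a \<and>
        d1 G \<cdot>\<^bsub>C\<^esub> gcomp C G W b a = d1 G \<cdot>\<^bsub>C\<^esub> b) \<and>
     (\<forall>W. \<forall>a \<in> Hom C W (G1 G). \<forall>b \<in> Hom C W (G1 G). \<forall>c \<in> Hom C W (G1 G).
        d0 G \<cdot>\<^bsub>C\<^esub> b = d1 G \<cdot>\<^bsub>C\<^esub> a \<longrightarrow> d0 G \<cdot>\<^bsub>C\<^esub> c = d1 G \<cdot>\<^bsub>C\<^esub> b \<longrightarrow>
        gcomp C G W (gcomp C G W c b) a = gcomp C G W c (gcomp C G W b a)) \<and>
     (\<forall>W. \<forall>a \<in> Hom C W (G1 G).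
        gcomp C G W a (s0 G \<cdot>\<^bsub>C\<^esub> (d0 G \<cdot>\<^bsub>C\<^esub> a)) = a \<and>
        gcomp C G W (s0 G \<cdot>\<^bsub>C\<^esub> (d1 G \<cdot>\<^bsub>C\<^esub> a)) a = a \<and>
        gcomp C G W (ginv G \<cdot>\<^bsub>C\<^esub> a) a = s0 G \<cdot>\<^bsub>C\<^esub> (d0 G \<cdot>\<^bsub>C\<^esub> a) \<and>
        gcomp C G W a (ginv G \<cdot>\<^bsub>C\<^esub> a) = s0 G \<cdot>\<^bsub>C\<^esub> (d1 G \<cdot>\<^bsub>C\<^esub> a))"

definition internal_functor ::
  "('o, 'a) cat \<Rightarrow> ('o, 'a) igrpd \<Rightarrow> ('o, 'a) igrpd \<Rightarrow> 'a \<times> 'a \<Rightarrow> bool" where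
  "internal_functor C G H F \<longleftrightarrow>
     fst F \<in> Hom C (G0 G) (G0 H) \<and> snd F \<in> Hom C (G1 G) (G1 H) \<and>
     d0 H \<cdot>\<^bsub>C\<^esub> snd F = fst F \<cdot>\<^bsub>C\<^esub> d0 G \<and>
     d1 H \<cdot>\<^bsub>C\<^esub> snd F = fst F \<cdot>\<^bsub>C\<^esub> d1 G \<and>
     snd F \<cdot>\<^bsub>C\<^esub> s0 G = s0 H \<cdot>\<^bsub>C\<^esub> fst F \<and>
     (\<forall>W. \<forall>a \<in> Hom C W (G1 G). \<forall>b \<in> Hom C W (G1 G).
        d0 G \<cdot>\<^bsub>C\<^esub> b = d1 G \<cdot>\<^bsub>C\<^esub> a \<longrightarrow>
        snd F \<cdot>\<^bsub>C\<^esub> gcomp C G W b a = gcomp C H W (snd F \<cdot>\<^bsub>C\<^esub> b) (snd F \<cdot>\<^bsub>C\<^esub> a))"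

definition Grd :: "('o, 'a) cat \<Rightarrow> (('o, 'a) igrpd, 'a \<times> 'a) cat" where
  "Grd C = \<lparr>
     Obj = {G. internal_groupoid C G},
     Hom = (\<lambda>G H. {F. internal_groupoid C G \<and> internal_groupoid C H \<and> internal_functor C G H F}),
     Idn = (\<lambda>G. (Idn C (G0 G), Idn C (G1 G))),
     Comp = (\<lambda>K F. (fst K \<cdot>\<^bsub>C\<^esub> fst F, snd K \<cdot>\<^bsub>C\<^esub> snd F)) \<rparr>"

definition ob_functor :: "(('o, 'a) igrpd, 'a \<times> 'a, 'o, 'a) ftor" where
  "ob_functor = \<lparr> FObj = G0, FArr = (\<lambda>G H. fst) \<rparr>"

definition Grd_fiber :: "('o, 'a) cat \<Rightarrow> 'o \<Rightarrow> (('o, 'a) igrpd, 'a \<times> 'a) cat" where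
  "Grd_fiber C X = fiber (Grd C) C ob_functor X"

text \<open>
  The object \<open>(d0, d1) : G1 \<rightarrow> G0 \<times> G0\<close> of the slice category; its powers there are the objects
  of families of parallel arrows.
\<close>

definition arrow_slice :: "('o, 'a) cat \<Rightarrow> ('o, 'a) igrpd \<Rightarrow> ('o \<times> 'a, 'a) cat" where
  "arrow_slice C G = slice C (prod_ob C (G0 G) (G0 G))"

definition arrow_ob :: "('o, 'a) cat \<Rightarrow> ('o, 'a) igrpd \<Rightarrow> 'o \<times> 'a" where
  "arrow_ob C G = (G1 G, prod_pair C (G0 G) (G0 G) (G1 G) (d0 G) (d1 G))"

text \<open>
  The operation \<open>\<alpha>.\<beta>\<inverse>.\<gamma>\<close>, evaluated at the universal triple of parallel arrows, i.e. at
  the three projections of the cube in the slice category.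
\<close>

definition chi :: "('o, 'a) cat \<Rightarrow> ('o, 'a) igrpd \<Rightarrow> 'a" where
  "chi C G =
     (let S = arrow_slice C G; A = arrow_ob C G; W = fst (cube S A) in
      gcomp C G W (cube_pr1 S A) (gcomp C G W (ginv G \<cdot>\<^bsub>C\<^esub> cube_pr2 S A) (cube_pr3 S A)))"

definition abelian_groupoid :: "('o, 'a) cat \<Rightarrow> ('o, 'a) igrpd \<Rightarrow> bool" where
  "abelian_groupoid C G \<longleftrightarrow>
     internal_groupoid C G \<and> autonomous_op (arrow_slice C G) (arrow_ob C G) (chi C G)"


subsection \<open>The fibration of points\<close>

record ('o, 'a) point =
  PTot :: 'o
  proj :: 'a
  sect :: 'a

definition is_point :: "('o, 'a) cat \<Rightarrow> 'o \<Rightarrow> ('o, 'a) point \<Rightarrow> bool" where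
  "is_point C Y P \<longleftrightarrow>
     proj P \<in> Hom C (PTot P) Y \<and> sect P \<in> Hom C Y (PTot P) \<and>
     proj P \<cdot>\<^bsub>C\<^esub> sect P = Idn C Y"

definition Pt :: "('o, 'a) cat \<Rightarrow> 'o \<Rightarrow> (('o, 'a) point, 'a) cat" where
  "Pt C Y = \<lparr>
     Obj = {P. is_point C Y P},
     Hom = (\<lambda>P Q. {f \<in> Hom C (PTot P) (PTot Q). is_point C Y P \<and> is_point C Y Q \<and>
              proj Q \<cdot>\<^bsub>C\<^esub> f = proj P \<and> f \<cdot>\<^bsub>C\<^esub> sect P = sect Q}),
     Idn = (\<lambda>P. Idn C (PTot P)),
     Comp = Comp C \<rparr>"

text \<open>Base change along \<open>h : Y' \<rightarrow> Y\<close>.\<close>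

definition base_change ::
  "('o, 'a) cat \<Rightarrow> 'o \<Rightarrow> 'o \<Rightarrow> 'a \<Rightarrow> (('o, 'a) point, 'a, ('o, 'a) point, 'a) ftor" where
  "base_change C Y' Y h = \<lparr>
     FObj = (\<lambda>P. \<lparr>
       PTot = pb_ob C Y' (PTot P) Y h (proj P),
       proj = pb_fst C Y' (PTot P) Y h (proj P),
       sect = pb_pair C Y' (PTot P) Y h (proj P) Y' (Idn C Y') (sect P \<cdot>\<^bsub>C\<^esub> h) \<rparr>),
     FArr = (\<lambda>P Q f.
       pb_pair C Y' (PTot Q) Y h (proj Q) (pb_ob C Y' (PTot P) Y h (proj P))
         (pb_fst C Y' (PTot P) Y h (proj P))
         (f \<cdot>\<^bsub>C\<^esub> pb_snd C Y' (PTot P) Y h (proj P))) \<rparr>"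

end

theory Submission
  imports Defs
begin

text \<open>
  Everything is computed on generalized elements, where an internal groupoid becomes a family of
  ordinary groupoids. Applied to the kernels of \<open>\<gamma>.\<beta>\<inverse>.\<alpha>\<close>, \<open>(\<beta>, \<gamma>)\<close> and \<open>\<alpha>.\<beta>\<inverse>.\<gamma>\<close> on the object of
  parallel triples, the Shifting Lemma gives the commutativity of \<open>\<chi>\<close>. Then \<open>\<chi>\<close>, applied pointwise,
  is a natural Mal'tsev operation on the hom-sets of the fiber.

  For the base change along \<open>h : Y' \<rightarrow> Y\<close>, let \<open>P\<close> and \<open>Q\<close> be points over \<open>Y\<close>. An arrow \<open>\<alpha>\<close> of \<open>P\<close>
  over \<open>\<beta>\<close> is \<open>k.s(\<beta>)\<close> with \<open>k\<close> a loop over an identity, and every such loop lives in the pullback of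
  \<open>P\<close> along \<open>h\<close>, because \<open>h\<close> is the identity on objects. So a map \<open>u\<close> between the pullbacks determines
  \<open>\<theta>(k)\<close> in \<open>Q\<close>, and \<open>\<alpha> \<mapsto> \<theta>(k).s'(\<beta>)\<close> is the only possible preimage of \<open>u\<close>. It preserves
  composition if and only if \<open>\<theta>\<close> commutes with conjugation by the arrows of \<open>Y\<close>. This holds trivially
  for \<open>k = 1\<close>, and the Shifting Lemma transports it to all \<open>k\<close>.
\<close>

section \<open>Products and pullbacks\<close>

text \<open>The Shifting Lemma speaks of internal equivalence relations, whereas the identities to
  be proved concern expressions at a varying stage. An expression becomes usable once it is natural
  in the stage: its value at a universal element is then an arrow, and the kernel pair of this arrow
  is a relation. This is why facts about change of stage surround both rectangles. The inclusion
  condition is easy in both cases: translations in a groupoid are injective, and a pair (k, \<beta>)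
  is determined by its components. The vertices are degenerate enough for the Mal'tsev identities or
  the unit laws to evaluate the known sides. Conjugation enters because a composite of k.s(\<beta>)
  and k'.s(\<beta>') has to be brought back to the form loop times value of the section, which moves
  s(\<beta>) past k'. Chosen limits are arbitrary, so those of the fiber cannot be computed by
  unfolding; and as hom-sets may overlap, every operation on elements carries its stage.\<close>

locale prodcat = category C for C :: "('o, 'a) cat" (structure) +
  assumes product_ex: "\<lbrakk>A \<in> Obj C; B \<in> Obj C\<rbrakk> \<Longrightarrow> \<exists>P p q. is_product C A B P p q"
begin

lemma prod_is_product:
  assumes "A \<in> Obj C" "B \<in> Obj C"
  shows "is_product C A B (prod_ob C A B) (prod_fst C A B) (prod_snd C A B)"
proof -
  obtain P p q where "is_product C A B P p q"
    using product_ex[OF assms] by blast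
  then have "\<exists>c. case c of (P, p, q) \<Rightarrow> is_product C A B P p q"
    by auto
  from someI_ex[OF this] have "case prod_cone C A B of (P, p, q) \<Rightarrow> is_product C A B P p q"
    unfolding prod_cone_def .
  then show ?thesis
    by (simp add: prod_ob_def prod_fst_def prod_snd_def split_beta)
qed

lemma prod_fst_hom: "\<lbrakk>A \<in> Obj C; B \<in> Obj C\<rbrakk> \<Longrightarrow> prod_fst C A B \<in> Hom C (prod_ob C A B) A"
  and prod_snd_hom: "\<lbrakk>A \<in> Obj C; B \<in> Obj C\<rbrakk> \<Longrightarrow> prod_snd C A B \<in> Hom C (prod_ob C A B) B"
  using prod_is_product unfolding is_product_def by blast+

lemma prod_obj: "\<lbrakk>A \<in> Obj C; B \<in> Obj C\<rbrakk> \<Longrightarrow> prod_ob C A B \<in> Obj C"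
  using prod_fst_hom hom_obj by blast

lemma prod_pair_props:
  assumes "a \<in> Hom C W A" "b \<in> Hom C W B"
  shows "prod_pair C A B W a b \<in> Hom C W (prod_ob C A B)
    \<and> prod_fst C A B \<cdot> prod_pair C A B W a b = a \<and> prod_snd C A B \<cdot> prod_pair C A B W a b = b"
proof -
  have "is_product C A B (prod_ob C A B) (prod_fst C A B) (prod_snd C A B)"
    using assms hom_obj prod_is_product by blast
  then have "\<exists>!u. u \<in> Hom C W (prod_ob C A B) \<and> prod_fst C A B \<cdot> u = a \<and> prod_snd C A B \<cdot> u = b"
    using assms unfolding is_product_def by blast
  from theI'[OF this] show ?thesis unfolding prod_pair_def .
qed

lemma prod_pair_hom:
    "\<lbrakk>a \<in> Hom C W A; b \<in> Hom C W B\<rbrakk> \<Longrightarrow> prod_pair C A B W a b \<in> Hom C W (prod_ob C A B)"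
  and prod_fst_pair:
    "\<lbrakk>a \<in> Hom C W A; b \<in> Hom C W B\<rbrakk> \<Longrightarrow> prod_fst C A B \<cdot> prod_pair C A B W a b = a"
  and prod_snd_pair:
    "\<lbrakk>a \<in> Hom C W A; b \<in> Hom C W B\<rbrakk> \<Longrightarrow> prod_snd C A B \<cdot> prod_pair C A B W a b = b"
  using prod_pair_props by blast+

lemma prod_ext:
  assumes "A \<in> Obj C" "B \<in> Obj C" "u \<in> Hom C W (prod_ob C A B)" "v \<in> Hom C W (prod_ob C A B)"
    and "prod_fst C A B \<cdot> u = prod_fst C A B \<cdot> v" "prod_snd C A B \<cdot> u = prod_snd C A B \<cdot> v"
  shows "u = v"
proof -
  have "prod_fst C A B \<cdot> u \<in> Hom C W A" "prod_snd C A B \<cdot> u \<in> Hom C W B"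
    using assms comp_hom prod_fst_hom prod_snd_hom by blast+
  then show ?thesis
    using prod_is_product[OF assms(1,2)] assms(3-6) unfolding is_product_def by metis
qed

lemma prod_pair_comp:
  assumes "a \<in> Hom C W A" "b \<in> Hom C W B" "w \<in> Hom C V W"
  shows "prod_pair C A B W a b \<cdot> w = prod_pair C A B V (a \<cdot> w) (b \<cdot> w)"
proof -
  have AB: "A \<in> Obj C" "B \<in> Obj C"
    using assms hom_obj by blast+
  have aw: "a \<cdot> w \<in> Hom C V A" "b \<cdot> w \<in> Hom C V B"
    using assms comp_hom by blast+
  note u = prod_pair_hom[OF assms(1,2)]
  show ?thesis
    by (rule prod_ext[OF AB])
      (use comp_assoc[OF assms(3) u prod_fst_hom[OF AB]] comp_assoc[OF assms(3) u prod_snd_hom[OF AB]]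
      prod_pair_props[OF assms(1,2)] prod_pair_props[OF aw] comp_hom[OF assms(3) u] in auto)
qed

lemma cube_pr1_hom: "A \<in> Obj C \<Longrightarrow> cube_pr1 C A \<in> Hom C (cube C A) A"
  and cube_pr2_hom: "A \<in> Obj C \<Longrightarrow> cube_pr2 C A \<in> Hom C (cube C A) A"
  and cube_pr3_hom: "A \<in> Obj C \<Longrightarrow> cube_pr3 C A \<in> Hom C (cube C A) A"
  unfolding cube_def cube_pr1_def cube_pr2_def cube_pr3_def
  by (blast intro: comp_hom prod_fst_hom prod_snd_hom prod_obj)+

lemma triple_hom:
  "\<lbrakk>x \<in> Hom C W A; y \<in> Hom C W A; z \<in> Hom C W A\<rbrakk> \<Longrightarrow> triple C A W x y z \<in> Hom C W (cube C A)"
  unfolding triple_def cube_def by (blast intro: prod_pair_hom)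

lemma cube_pr_triple:
  assumes "x \<in> Hom C W A" "y \<in> Hom C W A" "z \<in> Hom C W A"
  shows "cube_pr1 C A \<cdot> triple C A W x y z = x"
    and "cube_pr2 C A \<cdot> triple C A W x y z = y"
    and "cube_pr3 C A \<cdot> triple C A W x y z = z"
proof -
  have A: "A \<in> Obj C" "prod_ob C A A \<in> Obj C"
    using assms hom_obj prod_obj by blast+
  note t = triple_hom[OF assms, unfolded cube_def]
    and f = prod_fst_hom[OF A(2,1)]
    and xy = prod_pair_hom[OF assms(1,2)]
  have f_triple: "prod_fst C (prod_ob C A A) A \<cdot> triple C A W x y z = prod_pair C A A W x y"
    unfolding triple_def by (rule prod_fst_pair[OF xy assms(3)])
  show "cube_pr1 C A \<cdot> triple C A W x y z = x"
    unfolding cube_pr1_def comp_assoc[OF t f prod_fst_hom[OF A(1) A(1)]] f_triple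
    by (rule prod_fst_pair[OF assms(1,2)])
  show "cube_pr2 C A \<cdot> triple C A W x y z = y"
    unfolding cube_pr2_def comp_assoc[OF t f prod_snd_hom[OF A(1) A(1)]] f_triple
    by (rule prod_snd_pair[OF assms(1,2)])
  show "cube_pr3 C A \<cdot> triple C A W x y z = z"
    unfolding cube_pr3_def triple_def by (rule prod_snd_pair[OF xy assms(3)])
qed

end

section \<open>Finitely complete categories and their chosen pullbacks\<close>

locale fincat = category C for C :: "('o, 'a) cat" (structure) +
  assumes terminal_ex: "\<exists>T. is_terminal C T"
    and pullback_ex: "\<lbrakk>f \<in> Hom C A Z; g \<in> Hom C B Z\<rbrakk> \<Longrightarrow> \<exists>P p q. is_pullback C A B Z f g P p q"

lemma fincat_iff: "fincat C \<longleftrightarrow> finitely_complete C"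
  unfolding fincat_def fincat_axioms_def finitely_complete_def by blast

sublocale fincat \<subseteq> prodcat
proof unfold_locales
  fix A B
  assume AB: "A \<in> Obj C" "B \<in> Obj C"
  obtain T where T: "is_terminal C T"
    using terminal_ex by blast
  then obtain f g where fg: "f \<in> Hom C A T" "g \<in> Hom C B T"
    using AB unfolding is_terminal_def by blast
  then obtain P p q where P: "is_pullback C A B T f g P p q"
    using pullback_ex by blast
  \<comment> \<open>Any two arrows into a terminal object agree, so the pullback over
    \<open>T\<close> imposes no condition on the pair.\<close>
  have "f \<cdot> a = g \<cdot> b" if "a \<in> Hom C W A" "b \<in> Hom C W B" for W a b
  proof -
    have "f \<cdot> a \<in> Hom C W T" "g \<cdot> b \<in> Hom C W T" "W \<in> Obj C"
      using that fg comp_hom hom_obj by blast+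
    then show ?thesis
      using T unfolding is_terminal_def by blast
  qed
  then have "is_product C A B P p q"
    using P unfolding is_pullback_def is_product_def by blast
  then show "\<exists>P p q. is_product C A B P p q"
    by blast
qed

context fincat
begin

lemma pb_is_pullback:
  assumes "f \<in> Hom C A Z" "g \<in> Hom C B Z"
  shows "is_pullback C A B Z f g (pb_ob C A B Z f g) (pb_fst C A B Z f g) (pb_snd C A B Z f g)"
proof -
  obtain P p q where "is_pullback C A B Z f g P p q"
    using pullback_ex[OF assms] by blast
  then have "\<exists>c. case c of (P, p, q) \<Rightarrow> is_pullback C A B Z f g P p q"
    by auto
  from someI_ex[OF this] have "case pb_cone C A B Z f g of (P, p, q) \<Rightarrow> is_pullback C A B Z f g P p q"
    unfolding pb_cone_def .
  then show ?thesis
    by (simp add: pb_ob_def pb_fst_def pb_snd_def split_beta)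
qed

lemma pb_fst_hom:
    "\<lbrakk>f \<in> Hom C A Z; g \<in> Hom C B Z\<rbrakk> \<Longrightarrow> pb_fst C A B Z f g \<in> Hom C (pb_ob C A B Z f g) A"
  and pb_snd_hom:
    "\<lbrakk>f \<in> Hom C A Z; g \<in> Hom C B Z\<rbrakk> \<Longrightarrow> pb_snd C A B Z f g \<in> Hom C (pb_ob C A B Z f g) B"
  and pb_square:
    "\<lbrakk>f \<in> Hom C A Z; g \<in> Hom C B Z\<rbrakk> \<Longrightarrow> f \<cdot> pb_fst C A B Z f g = g \<cdot> pb_snd C A B Z f g"
  using pb_is_pullback unfolding is_pullback_def by blast+

lemma pb_pair_props:
  assumes "f \<in> Hom C A Z" "g \<in> Hom C B Z" "a \<in> Hom C W A" "b \<in> Hom C W B" "f \<cdot> a = g \<cdot> b"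
  shows "pb_pair C A B Z f g W a b \<in> Hom C W (pb_ob C A B Z f g)
    \<and> pb_fst C A B Z f g \<cdot> pb_pair C A B Z f g W a b = a
    \<and> pb_snd C A B Z f g \<cdot> pb_pair C A B Z f g W a b = b"
proof -
  have "\<exists>!u. u \<in> Hom C W (pb_ob C A B Z f g)
      \<and> pb_fst C A B Z f g \<cdot> u = a \<and> pb_snd C A B Z f g \<cdot> u = b"
    using pb_is_pullback[OF assms(1,2)] assms unfolding is_pullback_def by blast
  from theI'[OF this] show ?thesis unfolding pb_pair_def .
qed

lemma pb_pair_hom:
  "\<lbrakk>f \<in> Hom C A Z; g \<in> Hom C B Z; a \<in> Hom C W A; b \<in> Hom C W B; f \<cdot> a = g \<cdot> b\<rbrakk>
   \<Longrightarrow> pb_pair C A B Z f g W a b \<in> Hom C W (pb_ob C A B Z f g)"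
  using pb_pair_props by blast

lemma pb_ext:
  assumes "f \<in> Hom C A Z" "g \<in> Hom C B Z"
    and "u \<in> Hom C W (pb_ob C A B Z f g)" "v \<in> Hom C W (pb_ob C A B Z f g)"
    and "pb_fst C A B Z f g \<cdot> u = pb_fst C A B Z f g \<cdot> v"
    and "pb_snd C A B Z f g \<cdot> u = pb_snd C A B Z f g \<cdot> v"
  shows "u = v"
proof -
  note h = pb_fst_hom[OF assms(1,2)] pb_snd_hom[OF assms(1,2)]
  have "pb_fst C A B Z f g \<cdot> u \<in> Hom C W A" "pb_snd C A B Z f g \<cdot> u \<in> Hom C W B"
    using assms(3) h comp_hom by blast+
  moreover have "f \<cdot> (pb_fst C A B Z f g \<cdot> u) = g \<cdot> (pb_snd C A B Z f g \<cdot> u)"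
    using comp_assoc[OF assms(3) h(1) assms(1)] comp_assoc[OF assms(3) h(2) assms(2)]
      pb_square[OF assms(1,2)] by simp
  ultimately have "\<exists>!u'. u' \<in> Hom C W (pb_ob C A B Z f g)
      \<and> pb_fst C A B Z f g \<cdot> u' = pb_fst C A B Z f g \<cdot> u
      \<and> pb_snd C A B Z f g \<cdot> u' = pb_snd C A B Z f g \<cdot> u"
    using pb_is_pullback[OF assms(1,2)] unfolding is_pullback_def by blast
  then show ?thesis
    using assms(3-6) by metis
qed

lemma pb_pair_comp:
  assumes "f \<in> Hom C A Z" "g \<in> Hom C B Z" "a \<in> Hom C W A" "b \<in> Hom C W B" "f \<cdot> a = g \<cdot> b"
    and "w \<in> Hom C V W"
  shows "pb_pair C A B Z f g W a b \<cdot> w = pb_pair C A B Z f g V (a \<cdot> w) (b \<cdot> w)"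
proof -
  note h = pb_fst_hom[OF assms(1,2)] pb_snd_hom[OF assms(1,2)]
    and u = pb_pair_hom[OF assms(1-5)]
  have aw: "a \<cdot> w \<in> Hom C V A" "b \<cdot> w \<in> Hom C V B"
    using assms comp_hom by blast+
  have sq: "f \<cdot> (a \<cdot> w) = g \<cdot> (b \<cdot> w)"
    using comp_assoc[OF assms(6,3,1)] comp_assoc[OF assms(6,4,2)] assms(5) by simp
  show ?thesis
    by (rule pb_ext[OF assms(1,2)])
      (use comp_assoc[OF assms(6) u h(1)] comp_assoc[OF assms(6) u h(2)]
      pb_pair_props[OF assms(1-5)] pb_pair_props[OF assms(1,2) aw sq] comp_hom[OF assms(6) u] in auto)
qed

end

text \<open>
  By Yoneda, a Mal'tsev operation natural in the object is the same as a ternary operation on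
  hom-sets which is natural in both variables.
\<close>

lemma naturally_maltsevI:
  fixes C :: "('o, 'a) cat" (structure)
  assumes "finitely_complete C"
    and op_hom: "\<And>W A x y z. \<lbrakk>x \<in> Hom C W A; y \<in> Hom C W A; z \<in> Hom C W A\<rbrakk>
      \<Longrightarrow> m W A x y z \<in> Hom C W A"
    and op_left: "\<And>W A x y. \<lbrakk>x \<in> Hom C W A; y \<in> Hom C W A\<rbrakk> \<Longrightarrow> m W A x y y = x"
    and op_right: "\<And>W A x y. \<lbrakk>x \<in> Hom C W A; y \<in> Hom C W A\<rbrakk> \<Longrightarrow> m W A y y x = x"
    and op_pre: "\<And>V W A x y z w. \<lbrakk>x \<in> Hom C W A; y \<in> Hom C W A; z \<in> Hom C W A; w \<in> Hom C V W\<rbrakk>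
      \<Longrightarrow> m W A x y z \<cdot> w = m V A (x \<cdot> w) (y \<cdot> w) (z \<cdot> w)"
    and op_post: "\<And>W A B x y z f. \<lbrakk>x \<in> Hom C W A; y \<in> Hom C W A; z \<in> Hom C W A; f \<in> Hom C A B\<rbrakk>
      \<Longrightarrow> f \<cdot> m W A x y z = m W B (f \<cdot> x) (f \<cdot> y) (f \<cdot> z)"
  shows "naturally_maltsev C"
proof -
  interpret fincat C
    using assms(1) by (simp add: fincat_iff)
  let ?p = "\<lambda>A. m (cube C A) A (cube_pr1 C A) (cube_pr2 C A) (cube_pr3 C A)"
  note pr_hom = cube_pr1_hom cube_pr2_hom cube_pr3_hom
  \<comment> \<open>Naturality in the stage recovers \<open>m\<close> on every triple from its value
    \<open>?p A\<close> at the three projections.\<close>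
  have p_triple: "?p A \<cdot> triple C A W x y z = m W A x y z"
    if "x \<in> Hom C W A" "y \<in> Hom C W A" "z \<in> Hom C W A" for A W x y z
  proof -
    have "A \<in> Obj C"
      using that hom_obj by blast
    from op_pre[OF pr_hom[OF this] triple_hom[OF that]] show ?thesis
      using cube_pr_triple[OF that] by simp
  qed
  have "maltsev_op C A (?p A)" if A: "A \<in> Obj C" for A
    unfolding maltsev_op_def app3_def
    using op_hom[OF pr_hom[OF A]] by (simp add: p_triple op_left op_right)
  moreover have "f \<cdot> ?p A = ?p B \<cdot> triple C B (cube C A)
      (f \<cdot> cube_pr1 C A) (f \<cdot> cube_pr2 C A) (f \<cdot> cube_pr3 C A)" if f: "f \<in> Hom C A B" for A B f
  proof -
    have A: "A \<in> Obj C"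
      using f hom_obj by blast
    show ?thesis
      using op_post[OF pr_hom[OF A] f]
        p_triple[OF comp_hom[OF cube_pr1_hom[OF A] f] comp_hom[OF cube_pr2_hom[OF A] f]
          comp_hom[OF cube_pr3_hom[OF A] f]]
      by simp
  qed
  ultimately show ?thesis
    using assms(1) unfolding naturally_maltsev_def by (intro conjI exI[of _ ?p]) auto
qed

section \<open>Points and slices\<close>

lemma (in category) Pt_category: "category (Pt C Y)"
proof
  fix P Q R T f g k
  assume f: "f \<in> Hom (Pt C Y) P Q"
  then have f': "f \<in> Hom C (PTot P) (PTot Q)" "is_point C Y P" "is_point C Y Q"
      "proj Q \<cdot> f = proj P" "f \<cdot> sect P = sect Q"
    by (auto simp: Pt_def)
  show "P \<in> Obj (Pt C Y) \<and> Q \<in> Obj (Pt C Y)"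
    using f' by (simp add: Pt_def)
  show "Idn (Pt C Y) Q \<cdot>\<^bsub>Pt C Y\<^esub> f = f" "f \<cdot>\<^bsub>Pt C Y\<^esub> Idn (Pt C Y) P = f"
    using f' by (simp_all add: Pt_def idn_left idn_right)
  assume g: "g \<in> Hom (Pt C Y) Q R"
  then have g': "g \<in> Hom C (PTot Q) (PTot R)" "is_point C Y R"
      "proj R \<cdot> g = proj Q" "g \<cdot> sect Q = sect R"
    by (auto simp: Pt_def)
  have "proj R \<cdot> (g \<cdot> f) = proj P"
    using comp_assoc[OF f'(1) g'(1), of "proj R"] f' g' by (auto simp: is_point_def)
  moreover have "(g \<cdot> f) \<cdot> sect P = sect R"
    using comp_assoc[OF _ f'(1) g'(1), of "sect P"] f' g' by (auto simp: is_point_def)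
  ultimately show "g \<cdot>\<^bsub>Pt C Y\<^esub> f \<in> Hom (Pt C Y) P R"
    using f' g' comp_hom[OF f'(1) g'(1)] by (simp add: Pt_def)
  assume "k \<in> Hom (Pt C Y) R T"
  then have "k \<in> Hom C (PTot R) (PTot T)"
    by (auto simp: Pt_def)
  then show "(k \<cdot>\<^bsub>Pt C Y\<^esub> g) \<cdot>\<^bsub>Pt C Y\<^esub> f = k \<cdot>\<^bsub>Pt C Y\<^esub> (g \<cdot>\<^bsub>Pt C Y\<^esub> f)"
    using comp_assoc[OF f'(1) g'(1)] by (simp add: Pt_def)
next
  fix P
  assume "P \<in> Obj (Pt C Y)"
  then have P: "proj P \<in> Hom C (PTot P) Y" "sect P \<in> Hom C Y (PTot P)" "is_point C Y P"
    by (auto simp: Pt_def is_point_def)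
  then show "Idn (Pt C Y) P \<in> Hom (Pt C Y) P P"
    using hom_obj[OF P(1)] idn_hom idn_left[OF P(2)] idn_right[OF P(1)] by (simp add: Pt_def)
qed

context fincat
begin

context
  fixes Y' Y h
  assumes h: "h \<in> Hom C Y' Y"
begin

private abbreviation (input) "B \<equiv> base_change C Y' Y h"
private abbreviation (input) "Bfst P \<equiv> pb_fst C Y' (PTot P) Y h (proj P)"
private abbreviation (input) "Bsnd P \<equiv> pb_snd C Y' (PTot P) Y h (proj P)"

lemma base_change_PTot: "PTot (FObj B P) = pb_ob C Y' (PTot P) Y h (proj P)"
  and base_change_proj: "proj (FObj B P) = Bfst P"
  by (simp_all add: base_change_def)

lemma base_change_point:
  assumes P: "is_point C Y P"
  shows "is_point C Y' (FObj B P)"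
    and "Bfst P \<in> Hom C (PTot (FObj B P)) Y'"
    and "Bsnd P \<in> Hom C (PTot (FObj B P)) (PTot P)"
    and "h \<cdot> Bfst P = proj P \<cdot> Bsnd P"
    and "sect (FObj B P) \<in> Hom C Y' (PTot (FObj B P))"
    and "Bfst P \<cdot> sect (FObj B P) = Idn C Y'"
    and "Bsnd P \<cdot> sect (FObj B P) = sect P \<cdot> h"
proof -
  have Y': "Y' \<in> Obj C"
    using h hom_obj by blast
  have pr: "proj P \<in> Hom C (PTot P) Y" "sect P \<in> Hom C Y (PTot P)" "proj P \<cdot> sect P = Idn C Y"
    using P by (auto simp: is_point_def)
  show pq: "Bfst P \<in> Hom C (PTot (FObj B P)) Y'" "Bsnd P \<in> Hom C (PTot (FObj B P)) (PTot P)"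
      "h \<cdot> Bfst P = proj P \<cdot> Bsnd P"
    unfolding base_change_PTot using pb_fst_hom pb_snd_hom pb_square h pr by blast+
  have "h \<cdot> Idn C Y' = proj P \<cdot> (sect P \<cdot> h)"
    using comp_assoc[OF h pr(2,1)] pr(3) idn_left[OF h] idn_right[OF h] by simp
  from pb_pair_props[OF h pr(1) idn_hom[OF Y'] comp_hom[OF h pr(2)] this]
  show "sect (FObj B P) \<in> Hom C Y' (PTot (FObj B P))" "Bfst P \<cdot> sect (FObj B P) = Idn C Y'"
      "Bsnd P \<cdot> sect (FObj B P) = sect P \<cdot> h"
    by (simp_all add: base_change_def)
  then show "is_point C Y' (FObj B P)"
    using pq by (simp add: is_point_def base_change_def)
qed

lemma base_change_ext:
  assumes "is_point C Y Q" "u \<in> Hom C W (PTot (FObj B Q))" "v \<in> Hom C W (PTot (FObj B Q))"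
    "Bfst Q \<cdot> u = Bfst Q \<cdot> v" "Bsnd Q \<cdot> u = Bsnd Q \<cdot> v"
  shows "u = v"
  using pb_ext[OF h _ assms(2-5)[unfolded base_change_PTot]] assms(1) by (simp add: is_point_def)

lemma base_change_arrow:
  assumes f: "f \<in> Hom (Pt C Y) P Q"
  shows "FArr B P Q f \<in> Hom C (PTot (FObj B P)) (PTot (FObj B Q))"
    and "Bfst Q \<cdot> FArr B P Q f = Bfst P"
    and "Bsnd Q \<cdot> FArr B P Q f = f \<cdot> Bsnd P"
proof -
  have f': "f \<in> Hom C (PTot P) (PTot Q)" "is_point C Y P" "is_point C Y Q" "proj Q \<cdot> f = proj P"
    using f by (auto simp: Pt_def)
  have pr: "proj Q \<in> Hom C (PTot Q) Y"
    using f' by (simp add: is_point_def)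
  note P = base_change_point[OF f'(2)]
  have "h \<cdot> Bfst P = proj Q \<cdot> (f \<cdot> Bsnd P)"
    using comp_assoc[OF P(3) f'(1) pr] f'(4) P(4) by simp
  from pb_pair_props[OF h pr P(2) comp_hom[OF P(3) f'(1)] this]
  show "FArr B P Q f \<in> Hom C (PTot (FObj B P)) (PTot (FObj B Q))"
      "Bfst Q \<cdot> FArr B P Q f = Bfst P" "Bsnd Q \<cdot> FArr B P Q f = f \<cdot> Bsnd P"
    by (simp_all add: base_change_def)
qed

text \<open>Arrows into a chosen pullback are determined by their two projections, so compatibility
  with sections, identities and composites splits into two short computations each.\<close>

lemma base_change_functor: "is_functor (Pt C Y) (Pt C Y') B"
  unfolding is_functor_def
proof (intro conjI allI ballI impI Pt_category)
  fix P
  assume "P \<in> Obj (Pt C Y)"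
  then have P: "is_point C Y P"
    by (simp add: Pt_def)
  then show "FObj B P \<in> Obj (Pt C Y')"
    using base_change_point(1) by (simp add: Pt_def)
  have i: "Idn C (PTot P) \<in> Hom (Pt C Y) P P"
    using category.idn_hom[OF Pt_category] P by (simp add: Pt_def)
  have O: "PTot (FObj B P) \<in> Obj C"
    using base_change_point(2)[OF P] hom_obj by blast
  show "FArr B P P (Idn (Pt C Y) P) = Idn (Pt C Y') (FObj B P)"
    using base_change_arrow[OF i] idn_hom[OF O] idn_left[OF base_change_point(3)[OF P]]
      idn_right[OF base_change_point(2)[OF P]] idn_right[OF base_change_point(3)[OF P]]
    by (simp add: Pt_def base_change_proj base_change_ext[OF P])
next
  fix P Q f
  assume f: "f \<in> Hom (Pt C Y) P Q"
  then have f': "f \<in> Hom C (PTot P) (PTot Q)" "is_point C Y P" "is_point C Y Q" "f \<cdot> sect P = sect Q"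
    by (auto simp: Pt_def)
  note a = base_change_arrow[OF f] and sP = base_change_point(5)[OF f'(2)]
  have sc: "sect P \<in> Hom C Y (PTot P)"
    using f'(2) by (simp add: is_point_def)
  have "FArr B P Q f \<cdot> sect (FObj B P) = sect (FObj B Q)"
  proof (rule base_change_ext[OF f'(3) comp_hom[OF sP a(1)] base_change_point(5)[OF f'(3)]])
    show "Bfst Q \<cdot> (FArr B P Q f \<cdot> sect (FObj B P)) = Bfst Q \<cdot> sect (FObj B Q)"
      using comp_assoc[OF sP a(1) base_change_point(2)[OF f'(3)]] a base_change_point(6) f' by simp
    show "Bsnd Q \<cdot> (FArr B P Q f \<cdot> sect (FObj B P)) = Bsnd Q \<cdot> sect (FObj B Q)"
      using comp_assoc[OF sP a(1) base_change_point(3)[OF f'(3)]]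
        comp_assoc[OF sP base_change_point(3)[OF f'(2)] f'(1)]
        comp_assoc[OF h sc f'(1)] a base_change_point(7) f' by simp
  qed
  then show "FArr B P Q f \<in> Hom (Pt C Y') (FObj B P) (FObj B Q)"
    using a base_change_point(1) f' by (simp add: Pt_def base_change_proj)
next
  fix P Q R f g
  assume f: "f \<in> Hom (Pt C Y) P Q" and g: "g \<in> Hom (Pt C Y) Q R"
  then have f': "f \<in> Hom C (PTot P) (PTot Q)" "is_point C Y P" "is_point C Y Q"
    and g': "g \<in> Hom C (PTot Q) (PTot R)" "is_point C Y R"
    by (auto simp: Pt_def)
  have gf: "g \<cdot> f \<in> Hom (Pt C Y) P R"
    using category.comp_hom[OF Pt_category f g] by (simp add: Pt_def)
  note a = base_change_arrow[OF f] and b = base_change_arrow[OF g] and c = base_change_arrow[OF gf]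
  have "FArr B P R (g \<cdot> f) = FArr B Q R g \<cdot> FArr B P Q f"
  proof (rule base_change_ext[OF g'(2) c(1) comp_hom[OF a(1) b(1)]])
    show "Bfst R \<cdot> FArr B P R (g \<cdot> f) = Bfst R \<cdot> (FArr B Q R g \<cdot> FArr B P Q f)"
      using comp_assoc[OF a(1) b(1) base_change_point(2)[OF g'(2)]] a b c by simp
    show "Bsnd R \<cdot> FArr B P R (g \<cdot> f) = Bsnd R \<cdot> (FArr B Q R g \<cdot> FArr B P Q f)"
      using comp_assoc[OF a(1) b(1) base_change_point(3)[OF g'(2)]]
        comp_assoc[OF a(1) base_change_point(3)[OF f'(3)] g'(1)]
        comp_assoc[OF base_change_point(3)[OF f'(2)] f'(1) g'(1)] a b c by simp
  qed
  then show "FArr B P R (g \<cdot>\<^bsub>Pt C Y\<^esub> f) = FArr B Q R g \<cdot>\<^bsub>Pt C Y'\<^esub> FArr B P Q f"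
    by (simp add: Pt_def)
qed

end

end

section \<open>Slice categories\<close>

lemma slice_simps [simp]:
  "(A, a) \<in> Obj (slice C Z) \<longleftrightarrow> a \<in> Hom C A Z"
  "f \<in> Hom (slice C Z) (A, a) (B, b) \<longleftrightarrow>
     f \<in> Hom C A B \<and> a \<in> Hom C A Z \<and> b \<in> Hom C B Z \<and> b \<cdot>\<^bsub>C\<^esub> f = a"
  "Comp (slice C Z) = Comp C"
  "Idn (slice C Z) (A, a) = Idn C A"
  by (simp_all add: slice_def)

lemma (in category) slice_category: "category (slice C Z)"
proof
  fix A B D T :: "'o \<times> 'a" and f g k
  assume f: "f \<in> Hom (slice C Z) A B"
  obtain A1 a B1 b D1 d where AB: "A = (A1, a)" "B = (B1, b)" "D = (D1, d)"
    by (metis prod.exhaust)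
  have f': "f \<in> Hom C A1 B1" "a \<in> Hom C A1 Z" "b \<in> Hom C B1 Z" "b \<cdot> f = a"
    using f by (auto simp: AB)
  show "A \<in> Obj (slice C Z) \<and> B \<in> Obj (slice C Z)"
    using f' by (simp add: AB)
  show "Idn (slice C Z) B \<cdot>\<^bsub>slice C Z\<^esub> f = f" "f \<cdot>\<^bsub>slice C Z\<^esub> Idn (slice C Z) A = f"
    using f' by (simp_all add: AB idn_left idn_right)
  assume g: "g \<in> Hom (slice C Z) B D"
  then have g': "g \<in> Hom C B1 D1" "d \<in> Hom C D1 Z" "d \<cdot> g = b"
    by (auto simp: AB)
  show "g \<cdot>\<^bsub>slice C Z\<^esub> f \<in> Hom (slice C Z) A D"
    using f' g' comp_assoc[OF f'(1) g'(1,2)] by (simp add: AB comp_hom)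
  assume "k \<in> Hom (slice C Z) D T"
  then have "k \<in> Hom C D1 (fst T)"
    by (cases T) (auto simp: AB)
  then show "(k \<cdot>\<^bsub>slice C Z\<^esub> g) \<cdot>\<^bsub>slice C Z\<^esub> f = k \<cdot>\<^bsub>slice C Z\<^esub> (g \<cdot>\<^bsub>slice C Z\<^esub> f)"
    using comp_assoc[OF f'(1) g'(1)] by simp
next
  fix A
  assume "A \<in> Obj (slice C Z)"
  then show "Idn (slice C Z) A \<in> Hom (slice C Z) A A"
    using hom_obj idn_hom idn_right by (cases A) auto
qed

text \<open>A pullback over \<open>Z\<close>, with the diagonal of its square as structure map, is a
  product in the slice. Binary products are what \<open>cube\<close> is built from.\<close>

lemma (in fincat) slice_prodcat: "prodcat (slice C Z)"
proof -
  interpret S: category "slice C Z"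
    by (rule slice_category)
  show ?thesis
  proof
    fix A B
    assume "A \<in> Obj (slice C Z)" "B \<in> Obj (slice C Z)"
    then obtain A1 a B1 b where AB: "A = (A1, a)" "B = (B1, b)"
      and a: "a \<in> Hom C A1 Z" and b: "b \<in> Hom C B1 Z"
      by (metis prod.exhaust slice_simps(1))
    obtain P p q where P: "is_pullback C A1 B1 Z a b P p q"
      using pullback_ex[OF a b] by blast
    then have pq: "p \<in> Hom C P A1" "q \<in> Hom C P B1" "a \<cdot> p = b \<cdot> q"
      by (auto simp: is_pullback_def)
    have "is_product (slice C Z) A B (P, a \<cdot> p) p q"
      unfolding is_product_def
    proof (intro conjI allI impI)
      show "p \<in> Hom (slice C Z) (P, a \<cdot> p) A" "q \<in> Hom (slice C Z) (P, a \<cdot> p) B"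
        using a b pq comp_hom[OF pq(1) a] by (auto simp: AB)
    next
      fix W' u v
      assume uv: "u \<in> Hom (slice C Z) W' A" "v \<in> Hom (slice C Z) W' B"
      obtain W w where W: "W' = (W, w)"
        by (cases W')
      have uv': "u \<in> Hom C W A1" "v \<in> Hom C W B1" "a \<cdot> u = w" "b \<cdot> v = w" "w \<in> Hom C W Z"
        using uv by (simp_all add: AB W)
      from uv'(3,4) have "a \<cdot> u = b \<cdot> v"
        by simp
      with P uv'(1,2) have "\<exists>!t. t \<in> Hom C W P \<and> p \<cdot> t = u \<and> q \<cdot> t = v"
        by (simp add: is_pullback_def)
      moreover have "(a \<cdot> p) \<cdot> t = w" if "t \<in> Hom C W P" "p \<cdot> t = u" for t
        using comp_assoc[OF that(1) pq(1) a] that(2) uv'(3) by simp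
      ultimately have "\<exists>!t. t \<in> Hom C W P \<and> (a \<cdot> p) \<cdot> t = w \<and> p \<cdot> t = u \<and> q \<cdot> t = v"
        by metis
      then show "\<exists>!t. t \<in> Hom (slice C Z) W' (P, a \<cdot> p)
          \<and> p \<cdot>\<^bsub>slice C Z\<^esub> t = u \<and> q \<cdot>\<^bsub>slice C Z\<^esub> t = v"
        using uv'(5) comp_hom[OF pq(1) a] by (simp add: W)
    qed
    then show "\<exists>P p q. is_product (slice C Z) A B P p q"
      by blast
  qed
qed

section \<open>Groupoids of generalized elements\<close>

text \<open>An ordinary groupoid; \<open>m b a\<close> means first \<open>a\<close>, then
  \<open>b\<close>. The laws are oriented as rewrite rules: composites are reassociated to the
  right, units and inverses are cancelled, so equations between words are mostly left to
  simplification.\<close>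

locale elem_groupoid =
  fixes Ar :: "'a set" and Ob :: "'b set" and s t :: "'a \<Rightarrow> 'b" and e :: "'b \<Rightarrow> 'a"
    and m :: "'a \<Rightarrow> 'a \<Rightarrow> 'a" and i :: "'a \<Rightarrow> 'a"
  assumes s_ob [simp]: "a \<in> Ar \<Longrightarrow> s a \<in> Ob"
    and t_ob [simp]: "a \<in> Ar \<Longrightarrow> t a \<in> Ob"
    and e_ar [simp]: "x \<in> Ob \<Longrightarrow> e x \<in> Ar"
    and s_e [simp]: "x \<in> Ob \<Longrightarrow> s (e x) = x"
    and t_e [simp]: "x \<in> Ob \<Longrightarrow> t (e x) = x"
    and m_ar [simp]: "\<lbrakk>a \<in> Ar; b \<in> Ar; s b = t a\<rbrakk> \<Longrightarrow> m b a \<in> Ar"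
    and s_m [simp]: "\<lbrakk>a \<in> Ar; b \<in> Ar; s b = t a\<rbrakk> \<Longrightarrow> s (m b a) = s a"
    and t_m [simp]: "\<lbrakk>a \<in> Ar; b \<in> Ar; s b = t a\<rbrakk> \<Longrightarrow> t (m b a) = t b"
    and m_assoc [simp]: "\<lbrakk>a \<in> Ar; b \<in> Ar; c \<in> Ar; s b = t a; s c = t b\<rbrakk>
      \<Longrightarrow> m (m c b) a = m c (m b a)"
    and m_e [simp]: "a \<in> Ar \<Longrightarrow> m a (e (s a)) = a"
    and e_m [simp]: "a \<in> Ar \<Longrightarrow> m (e (t a)) a = a"
    and i_ar [simp]: "a \<in> Ar \<Longrightarrow> i a \<in> Ar"
    and s_i [simp]: "a \<in> Ar \<Longrightarrow> s (i a) = t a"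
    and t_i [simp]: "a \<in> Ar \<Longrightarrow> t (i a) = s a"
    and i_m [simp]: "a \<in> Ar \<Longrightarrow> m (i a) a = e (s a)"
    and m_i [simp]: "a \<in> Ar \<Longrightarrow> m a (i a) = e (t a)"
begin

text \<open>The matching condition of the unit laws becomes an equation to be proved, since
  simplification may bring the two objects to different shapes before they can be matched.\<close>

lemma m_e' [simp]: "\<lbrakk>a \<in> Ar; x = s a\<rbrakk> \<Longrightarrow> m a (e x) = a"
  and e_m' [simp]: "\<lbrakk>a \<in> Ar; x = t a\<rbrakk> \<Longrightarrow> m (e x) a = a"
  by simp_all

text \<open>After reassociation an arrow meets its inverse at the head of a longer word, where
  \<open>i_m\<close> and \<open>m_i\<close> do not match.\<close>

lemma i_m_cancel [simp]: "\<lbrakk>a \<in> Ar; b \<in> Ar; t b = s a\<rbrakk> \<Longrightarrow> m (i a) (m a b) = b"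
  using m_assoc[of b a "i a"] by simp

lemma m_i_cancel [simp]: "\<lbrakk>a \<in> Ar; b \<in> Ar; t b = t a\<rbrakk> \<Longrightarrow> m a (m (i a) b) = b"
  using m_assoc[of b "i a" a] by simp

lemma m_left_cancel:
  assumes "a \<in> Ar" "b \<in> Ar" "c \<in> Ar" "t b = s a" "t c = s a" "m a b = m a c"
  shows "b = c"
  using i_m_cancel[OF assms(1,2,4)] i_m_cancel[OF assms(1,3,5)] assms(6) by metis

lemma m_right_cancel:
  assumes "a \<in> Ar" "b \<in> Ar" "c \<in> Ar" "s b = t a" "s c = t a" "m b a = m c a"
  shows "b = c"
proof -
  have "m (m b a) (i a) = b" "m (m c a) (i a) = c"
    using assms(1-5) by simp_all
  then show ?thesis
    using assms(6) by metis
qed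

lemma i_unique:
  assumes "a \<in> Ar" "b \<in> Ar" "s b = t a" "m b a = e (s a)"
  shows "b = i a"
  using m_right_cancel[of a b "i a"] assms by simp

text \<open>Cancel \<open>a\<close> in a.a = a.1. This yields preservation of units from
  preservation of composition.\<close>

lemma idem_is_unit:
  assumes "a \<in> Ar" "s a = t a" "m a a = a"
  shows "a = e (s a)"
  by (rule m_left_cancel[of a]) (use assms in auto)

lemma i_m_distrib [simp]:
  assumes "a \<in> Ar" "b \<in> Ar" "s b = t a"
  shows "i (m b a) = m (i a) (i b)"
  using assms by (intro i_unique[symmetric]) simp_all

lemma i_e [simp]: "x \<in> Ob \<Longrightarrow> i (e x) = e x"
  by (rule i_unique[symmetric]) simp_all

definition chi3 :: "'a \<Rightarrow> 'a \<Rightarrow> 'a \<Rightarrow> 'a" where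
  "chi3 x y z = m x (m (i y) z)"

definition parallel :: "'a \<Rightarrow> 'a \<Rightarrow> bool" where
  "parallel x y \<longleftrightarrow> x \<in> Ar \<and> y \<in> Ar \<and> s x = s y \<and> t x = t y"

lemma chi3_parallel: "\<lbrakk>parallel x y; parallel y z\<rbrakk> \<Longrightarrow> parallel (chi3 x y z) x"
  by (simp add: parallel_def chi3_def)

lemma chi3_left: "parallel x y \<Longrightarrow> chi3 x y y = x"
  by (simp add: parallel_def chi3_def)

lemma chi3_right: "parallel x y \<Longrightarrow> chi3 y y x = x"
  by (simp add: parallel_def chi3_def)

lemma chi3_assoc:
  "\<lbrakk>parallel x y; parallel y z; parallel z u; parallel u v\<rbrakk>
   \<Longrightarrow> chi3 (chi3 x y z) u v = chi3 x y (chi3 z u v)"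
  by (simp add: parallel_def chi3_def)

text \<open>Left translation by z.y\<inverse> is injective. This provides the inclusion of relations
  that the Shifting Lemma asks for.\<close>

lemma chi3_inj:
  assumes "parallel x y" "parallel y z" "parallel x' y" "chi3 z y x = chi3 z y x'"
  shows "x = x'"
proof -
  have p: "x \<in> Ar" "x' \<in> Ar" "y \<in> Ar" "z \<in> Ar" "s z = s y" "t z = t y"
      "s x = s y" "t x = t y" "s x' = s y" "t x' = t y"
    using assms(1-3) by (simp_all add: parallel_def)
  have "m (i y) x = m (i y) x'"
    by (rule m_left_cancel[of z]) (use p assms(4) in \<open>simp_all add: chi3_def\<close>)
  then show ?thesis
    by (rule m_left_cancel[of "i y", rotated -1]) (use p in simp_all)
qed

text \<open>
  Between composites, \<open>\<alpha>\<^sub>1.\<beta>\<^sub>1\<inverse>\<close> and \<open>\<beta>\<^sub>2\<inverse>.\<gamma>\<^sub>2\<close> are loops at the same object, so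
  commutativity lets them be interchanged.
\<close>

lemma chi3_m:
  assumes comm: "\<And>x y z. \<lbrakk>parallel x y; parallel y z\<rbrakk> \<Longrightarrow> chi3 x y z = chi3 z y x"
    and 1: "parallel x y" "parallel y z" and 2: "parallel x' y'" "parallel y' z'" and "s x' = t x"
  shows "chi3 (m x' x) (m y' y) (m z' z) = m (chi3 x' y' z') (chi3 x y z)"
proof -
  let ?k = "m x (i y)" and ?l = "m (i y') z'"
  have k: "?k \<in> Ar" "s ?k = t x" "t ?k = t x" "?l \<in> Ar" "s ?l = t x" "t ?l = t x"
    using 1 2 \<open>s x' = t x\<close> by (simp_all add: parallel_def)
  \<comment> \<open>With a unit as middle argument, \<open>chi3\<close> is the composite of the two
    outer loops, so its commutativity makes them commute.\<close>
  have "m ?k ?l = m ?l ?k"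
    using comm[of ?k "e (t x)" ?l] k 1 by (simp add: parallel_def chi3_def)
  then have "m x (m (i y) (m (i y') (m z' z))) = m (m ?l ?k) z"
    using k 1 2 \<open>s x' = t x\<close> by (simp add: parallel_def flip: m_assoc)
  then show ?thesis
    using k 1 2 \<open>s x' = t x\<close> by (simp add: parallel_def chi3_def)
qed

end

text \<open>The laws are equations, and \<open>p\<close>, \<open>q\<close> are jointly injective and
  compatible with all operations, so the laws are inherited from the two given groupoids. The
  intended instance consists of the pairs forming a pullback.\<close>

lemma elem_groupoid_subdirect:
  assumes 1: "elem_groupoid Ar1 Ob s1 t1 e1 m1 i1" and 2: "elem_groupoid Ar2 Ob s2 t2 e2 m2 i2"
    and ar: "\<And>a. a \<in> Ar \<Longrightarrow> p a \<in> Ar1 \<and> q a \<in> Ar2"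
    and ext: "\<And>a b. \<lbrakk>a \<in> Ar; b \<in> Ar; p a = p b; q a = q b\<rbrakk> \<Longrightarrow> a = b"
    and s: "\<And>a. a \<in> Ar \<Longrightarrow> s1 (p a) = s a \<and> s2 (q a) = s a"
    and t: "\<And>a. a \<in> Ar \<Longrightarrow> t1 (p a) = t a \<and> t2 (q a) = t a"
    and e: "\<And>x. x \<in> Ob \<Longrightarrow> e x \<in> Ar \<and> p (e x) = e1 x \<and> q (e x) = e2 x"
    and m: "\<And>a b. \<lbrakk>a \<in> Ar; b \<in> Ar; s b = t a\<rbrakk>
      \<Longrightarrow> m b a \<in> Ar \<and> p (m b a) = m1 (p b) (p a) \<and> q (m b a) = m2 (q b) (q a)"
    and i: "\<And>a. a \<in> Ar \<Longrightarrow> i a \<in> Ar \<and> p (i a) = i1 (p a) \<and> q (i a) = i2 (q a)"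
  shows "elem_groupoid Ar Ob s t e m i"
proof -
  interpret G1: elem_groupoid Ar1 Ob s1 t1 e1 m1 i1 by fact
  interpret G2: elem_groupoid Ar2 Ob s2 t2 e2 m2 i2 by fact
  \<comment> \<open>All sources and targets are expressed through the first projection, a common
    normal form for the conditions of composability.\<close>
  have s': "s a = s1 (p a)" "s2 (q a) = s1 (p a)"
    and t': "t a = t1 (p a)" "t2 (q a) = t1 (p a)" if "a \<in> Ar" for a
    using s[OF that] t[OF that] by simp_all
  have m': "m b a \<in> Ar" "p (m b a) = m1 (p b) (p a)" "q (m b a) = m2 (q b) (q a)"
    if "a \<in> Ar" "b \<in> Ar" "s1 (p b) = t1 (p a)" for a b
    using m[OF that(1,2)] that by (simp_all add: s' t')
  show ?thesis
    by unfold_locales (auto intro!: ext simp: ar e m' i s' t')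
qed

section \<open>Internal groupoids at a stage, and maps between them\<close>

context fincat
begin

lemma groupoid_hom:
  assumes "internal_groupoid C G"
  shows "d0 G \<in> Hom C (G1 G) (G0 G)" "d1 G \<in> Hom C (G1 G) (G0 G)" "s0 G \<in> Hom C (G0 G) (G1 G)"
    "ginv G \<in> Hom C (G1 G) (G1 G)"
  using assms unfolding internal_groupoid_def by blast+

lemma gcomp_hom:
  assumes "internal_groupoid C G" "a \<in> Hom C W (G1 G)" "b \<in> Hom C W (G1 G)" "d0 G \<cdot> b = d1 G \<cdot> a"
  shows "gcomp C G W b a \<in> Hom C W (G1 G)"
proof -
  have "mul G \<in> Hom C (composables C G) (G1 G)"
    using assms(1) unfolding internal_groupoid_def by blast
  then show ?thesis
    using pb_pair_hom[OF groupoid_hom(1,2)[OF assms(1)] assms(3,2,4)] comp_hom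
    unfolding gcomp_def composables_def by blast
qed

text \<open>Naturality in the stage: \<open>mul G\<close> is a fixed arrow and pairing commutes with
  precomposition.\<close>

lemma gcomp_comp:
  assumes "internal_groupoid C G" "a \<in> Hom C W (G1 G)" "b \<in> Hom C W (G1 G)" "d0 G \<cdot> b = d1 G \<cdot> a"
    and "w \<in> Hom C V W"
  shows "gcomp C G W b a \<cdot> w = gcomp C G V (b \<cdot> w) (a \<cdot> w)"
proof -
  have "mul G \<in> Hom C (composables C G) (G1 G)"
    using assms(1) unfolding internal_groupoid_def by blast
  then show ?thesis
    using comp_assoc[OF assms(5) pb_pair_hom[OF groupoid_hom(1,2)[OF assms(1)] assms(3,2,4)]]
      pb_pair_comp[OF groupoid_hom(1,2)[OF assms(1)] assms(3,2,4,5)]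
    unfolding gcomp_def composables_def by simp
qed

lemma elem_groupoid:
  assumes G: "internal_groupoid C G"
  shows "elem_groupoid (Hom C W (G1 G)) (Hom C W (G0 G)) (\<lambda>a. d0 G \<cdot> a) (\<lambda>a. d1 G \<cdot> a)
    (\<lambda>x. s0 G \<cdot> x) (gcomp C G W) (\<lambda>a. ginv G \<cdot> a)"
proof -
  note h = groupoid_hom[OF G] and u = G[unfolded internal_groupoid_def]
  have eqs: "d0 G \<cdot> s0 G = Idn C (G0 G)" "d1 G \<cdot> s0 G = Idn C (G0 G)"
      "d0 G \<cdot> ginv G = d1 G" "d1 G \<cdot> ginv G = d0 G"
    using u by blast+
  show ?thesis
  proof
    fix x
    assume x: "x \<in> Hom C W (G0 G)"
    show "s0 G \<cdot> x \<in> Hom C W (G1 G)" "d0 G \<cdot> (s0 G \<cdot> x) = x" "d1 G \<cdot> (s0 G \<cdot> x) = x"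
      using comp_hom[OF x h(3)] comp_assoc[OF x h(3,1)] comp_assoc[OF x h(3,2)]
      by (simp_all add: eqs idn_left[OF x])
  next
    fix a
    assume a: "a \<in> Hom C W (G1 G)"
    show "d0 G \<cdot> a \<in> Hom C W (G0 G)" "d1 G \<cdot> a \<in> Hom C W (G0 G)" "ginv G \<cdot> a \<in> Hom C W (G1 G)"
      using comp_hom[OF a] h by blast+
    show "d0 G \<cdot> (ginv G \<cdot> a) = d1 G \<cdot> a" "d1 G \<cdot> (ginv G \<cdot> a) = d0 G \<cdot> a"
      using comp_assoc[OF a h(4,1)] comp_assoc[OF a h(4,2)] by (simp_all add: eqs)
    show "gcomp C G W a (s0 G \<cdot> (d0 G \<cdot> a)) = a" "gcomp C G W (s0 G \<cdot> (d1 G \<cdot> a)) a = a"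
      "gcomp C G W (ginv G \<cdot> a) a = s0 G \<cdot> (d0 G \<cdot> a)"
      "gcomp C G W a (ginv G \<cdot> a) = s0 G \<cdot> (d1 G \<cdot> a)"
      using u a by blast+
  next
    fix a b
    assume ab: "a \<in> Hom C W (G1 G)" "b \<in> Hom C W (G1 G)" "d0 G \<cdot> b = d1 G \<cdot> a"
    show "gcomp C G W b a \<in> Hom C W (G1 G)"
      using gcomp_hom[OF G ab] .
    show "d0 G \<cdot> gcomp C G W b a = d0 G \<cdot> a" "d1 G \<cdot> gcomp C G W b a = d1 G \<cdot> b"
      using u ab by blast+
    fix c
    assume "c \<in> Hom C W (G1 G)" "d0 G \<cdot> c = d1 G \<cdot> b"
    then show "gcomp C G W (gcomp C G W c b) a = gcomp C G W c (gcomp C G W b a)"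
      using u ab by blast
  qed
qed

text \<open>
  The converse, by Yoneda: the composition is \<open>M\<close> at the universal pair of composable arrows.
\<close>

lemma internal_groupoidI:
  assumes h: "d \<in> Hom C A1 A0" "c \<in> Hom C A1 A0" "s \<in> Hom C A0 A1" "j \<in> Hom C A1 A1"
    and elem: "\<And>W. elem_groupoid (Hom C W A1) (Hom C W A0) (\<lambda>a. d \<cdot> a) (\<lambda>a. c \<cdot> a)
      (\<lambda>x. s \<cdot> x) (M W) (\<lambda>a. j \<cdot> a)"
    and nat: "\<And>V W a b w. \<lbrakk>a \<in> Hom C W A1; b \<in> Hom C W A1; d \<cdot> b = c \<cdot> a; w \<in> Hom C V W\<rbrakk>
      \<Longrightarrow> M W b a \<cdot> w = M V (b \<cdot> w) (a \<cdot> w)"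
  obtains G where "internal_groupoid C G" "G0 G = A0" "G1 G = A1" "d0 G = d" "d1 G = c"
    "\<And>W a b. \<lbrakk>a \<in> Hom C W A1; b \<in> Hom C W A1; d \<cdot> b = c \<cdot> a\<rbrakk> \<Longrightarrow> gcomp C G W b a = M W b a"
proof -
  let ?P = "pb_ob C A1 A1 A0 d c"
  let ?G = "\<lparr>G0 = A0, G1 = A1, d0 = d, d1 = c, s0 = s,
    mul = M ?P (pb_fst C A1 A1 A0 d c) (pb_snd C A1 A1 A0 d c), ginv = j\<rparr>"
  note pq = pb_fst_hom[OF h(1,2)] pb_snd_hom[OF h(1,2)] pb_square[OF h(1,2)]
  have obj: "A0 \<in> Obj C" "A1 \<in> Obj C"
    using h hom_obj by blast+
  \<comment> \<open>The universal composable pair, precomposed with the pairing of \<open>b\<close>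
    and \<open>a\<close>, gives back \<open>b\<close> and \<open>a\<close>; so \<open>nat\<close>
    identifies the new composition with \<open>M\<close>.\<close>
  have gcomp: "gcomp C ?G W b a = M W b a"
    if "a \<in> Hom C W A1" "b \<in> Hom C W A1" "d \<cdot> b = c \<cdot> a" for W a b
    using nat[OF pq(2,1,3) pb_pair_hom[OF h(1,2) that(2,1,3)]] pb_pair_props[OF h(1,2) that(2,1,3)]
    by (simp add: gcomp_def)
  \<comment> \<open>Equations between structure maps are the elementwise laws at an identity arrow,
    the universal element.\<close>
  have "d \<cdot> s = Idn C A0" "c \<cdot> s = Idn C A0" "d \<cdot> j = c" "c \<cdot> j = d"
    using elem_groupoid.s_e[OF elem idn_hom[OF obj(1)]] elem_groupoid.t_e[OF elem idn_hom[OF obj(1)]]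
      elem_groupoid.s_i[OF elem idn_hom[OF obj(2)]] elem_groupoid.t_i[OF elem idn_hom[OF obj(2)]]
    by (simp_all add: idn_right[OF h(1)] idn_right[OF h(2)] idn_right[OF h(3)] idn_right[OF h(4)])
  moreover have "M ?P (pb_fst C A1 A1 A0 d c) (pb_snd C A1 A1 A0 d c) \<in> Hom C ?P A1"
    using elem_groupoid.m_ar[OF elem pq(2,1,3)] .
  moreover have "(\<forall>a \<in> Hom C W A1. \<forall>b \<in> Hom C W A1. d \<cdot> b = c \<cdot> a \<longrightarrow>
        d \<cdot> gcomp C ?G W b a = d \<cdot> a \<and> c \<cdot> gcomp C ?G W b a = c \<cdot> b)"
      "(\<forall>a \<in> Hom C W A1. \<forall>b \<in> Hom C W A1. \<forall>k \<in> Hom C W A1. d \<cdot> b = c \<cdot> a \<longrightarrow> d \<cdot> k = c \<cdot> b \<longrightarrow>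
        gcomp C ?G W (gcomp C ?G W k b) a = gcomp C ?G W k (gcomp C ?G W b a))"
      "(\<forall>a \<in> Hom C W A1. gcomp C ?G W a (s \<cdot> (d \<cdot> a)) = a \<and> gcomp C ?G W (s \<cdot> (c \<cdot> a)) a = a
        \<and> gcomp C ?G W (j \<cdot> a) a = s \<cdot> (d \<cdot> a) \<and> gcomp C ?G W a (j \<cdot> a) = s \<cdot> (c \<cdot> a))" for W
  proof -
    interpret W: elem_groupoid "Hom C W A1" "Hom C W A0" "\<lambda>a. d \<cdot> a" "\<lambda>a. c \<cdot> a"
      "\<lambda>x. s \<cdot> x" "M W" "\<lambda>a. j \<cdot> a" by (rule elem)
    show "(\<forall>a \<in> Hom C W A1. \<forall>b \<in> Hom C W A1. d \<cdot> b = c \<cdot> a \<longrightarrow>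
        d \<cdot> gcomp C ?G W b a = d \<cdot> a \<and> c \<cdot> gcomp C ?G W b a = c \<cdot> b)"
      by (simp add: gcomp)
    show "(\<forall>a \<in> Hom C W A1. \<forall>b \<in> Hom C W A1. \<forall>k \<in> Hom C W A1. d \<cdot> b = c \<cdot> a \<longrightarrow> d \<cdot> k = c \<cdot> b \<longrightarrow>
        gcomp C ?G W (gcomp C ?G W k b) a = gcomp C ?G W k (gcomp C ?G W b a))"
      by (simp add: gcomp)
    show "(\<forall>a \<in> Hom C W A1. gcomp C ?G W a (s \<cdot> (d \<cdot> a)) = a \<and> gcomp C ?G W (s \<cdot> (c \<cdot> a)) a = a
        \<and> gcomp C ?G W (j \<cdot> a) a = s \<cdot> (d \<cdot> a) \<and> gcomp C ?G W a (j \<cdot> a) = s \<cdot> (c \<cdot> a))"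
      by (simp add: gcomp)
  qed
  ultimately have "internal_groupoid C ?G"
    unfolding internal_groupoid_def composables_def using h by simp
  then show thesis
    using that[of ?G] gcomp by simp
qed

text \<open>The arrow part of an internal functor over the identity of a common object of objects.
  Compatibility with units and inverses is derived in \<open>arrow_map_unit\<close> and
  \<open>arrow_map_inv\<close>.\<close>

definition arrow_map :: "('o, 'a) igrpd \<Rightarrow> ('o, 'a) igrpd \<Rightarrow> 'a \<Rightarrow> bool" where
  "arrow_map G H f \<longleftrightarrow> f \<in> Hom C (G1 G) (G1 H) \<and> d0 H \<cdot> f = d0 G \<and> d1 H \<cdot> f = d1 G \<and>
     (\<forall>W. \<forall>a \<in> Hom C W (G1 G). \<forall>b \<in> Hom C W (G1 G). d0 G \<cdot> b = d1 G \<cdot> a \<longrightarrow>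
        f \<cdot> gcomp C G W b a = gcomp C H W (f \<cdot> b) (f \<cdot> a))"

lemma arrow_map_elem:
  assumes f: "arrow_map G H f" and G: "internal_groupoid C G" and H: "internal_groupoid C H"
  shows "a \<in> Hom C W (G1 G) \<Longrightarrow> f \<cdot> a \<in> Hom C W (G1 H)"
    and "a \<in> Hom C W (G1 G) \<Longrightarrow> d0 H \<cdot> (f \<cdot> a) = d0 G \<cdot> a"
    and "a \<in> Hom C W (G1 G) \<Longrightarrow> d1 H \<cdot> (f \<cdot> a) = d1 G \<cdot> a"
    and "\<lbrakk>a \<in> Hom C W (G1 G); b \<in> Hom C W (G1 G); d0 G \<cdot> b = d1 G \<cdot> a\<rbrakk>
      \<Longrightarrow> f \<cdot> gcomp C G W b a = gcomp C H W (f \<cdot> b) (f \<cdot> a)"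
  using f comp_hom comp_assoc[of _ _ _ f _ "d0 H"] comp_assoc[of _ _ _ f _ "d1 H"]
    groupoid_hom(1,2)[OF H] unfolding arrow_map_def by metis+

text \<open>The image of a unit is an idempotent loop, and in a groupoid such a loop is a
  unit.\<close>

lemma arrow_map_unit:
  assumes f: "arrow_map G H f" and G: "internal_groupoid C G" and H: "internal_groupoid C H"
    and "G0 G = G0 H" and x: "x \<in> Hom C W (G0 G)"
  shows "f \<cdot> (s0 G \<cdot> x) = s0 H \<cdot> x"
proof -
  interpret A: elem_groupoid "Hom C W (G1 G)" "Hom C W (G0 G)" "\<lambda>a. d0 G \<cdot> a" "\<lambda>a. d1 G \<cdot> a"
    "\<lambda>x. s0 G \<cdot> x" "gcomp C G W" "\<lambda>a. ginv G \<cdot> a" by (rule elem_groupoid[OF G])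
  interpret B: elem_groupoid "Hom C W (G1 H)" "Hom C W (G0 H)" "\<lambda>a. d0 H \<cdot> a" "\<lambda>a. d1 H \<cdot> a"
    "\<lambda>x. s0 H \<cdot> x" "gcomp C H W" "\<lambda>a. ginv H \<cdot> a" by (rule elem_groupoid[OF H])
  note f_elem = arrow_map_elem[OF f G H, where W = W]
  have "f \<cdot> (s0 G \<cdot> x) = s0 H \<cdot> (d0 H \<cdot> (f \<cdot> (s0 G \<cdot> x)))"
    by (rule B.idem_is_unit) (use x in \<open>simp_all add: f_elem flip: f_elem(4)\<close>)
  then show ?thesis
    using x by (simp add: f_elem)
qed

text \<open>The image of the inverse is a left inverse of the image, and left inverses are
  unique.\<close>

lemma arrow_map_inv:
  assumes f: "arrow_map G H f" and G: "internal_groupoid C G" and H: "internal_groupoid C H"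
    and "G0 G = G0 H" and a: "a \<in> Hom C W (G1 G)"
  shows "f \<cdot> (ginv G \<cdot> a) = ginv H \<cdot> (f \<cdot> a)"
proof -
  interpret A: elem_groupoid "Hom C W (G1 G)" "Hom C W (G0 G)" "\<lambda>a. d0 G \<cdot> a" "\<lambda>a. d1 G \<cdot> a"
    "\<lambda>x. s0 G \<cdot> x" "gcomp C G W" "\<lambda>a. ginv G \<cdot> a" by (rule elem_groupoid[OF G])
  interpret B: elem_groupoid "Hom C W (G1 H)" "Hom C W (G0 H)" "\<lambda>a. d0 H \<cdot> a" "\<lambda>a. d1 H \<cdot> a"
    "\<lambda>x. s0 H \<cdot> x" "gcomp C H W" "\<lambda>a. ginv H \<cdot> a" by (rule elem_groupoid[OF H])
  note f_elem = arrow_map_elem[OF f G H, where W = W] and f_unit = arrow_map_unit[OF f G H assms(4), where W = W]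
  show ?thesis
    by (rule B.i_unique) (use a in \<open>simp_all add: f_elem f_unit flip: f_elem(4)\<close>)
qed

end

section \<open>The Shifting Lemma and commutativity\<close>

context fincat
begin

text \<open>The kernel pair of \<open>f\<close>. It turns the relations of the Shifting Lemma into
  equations between values of arrows.\<close>

lemma kernel_relation:
  assumes f: "f \<in> Hom C X A"
  obtains R where "equivalence_relation C X R"
    "\<And>W x y. related C R W x y \<longleftrightarrow> x \<in> Hom C W X \<and> y \<in> Hom C W X \<and> f \<cdot> x = f \<cdot> y"
proof -
  define R where "R = \<lparr>RObj = pb_ob C X X A f f, r0 = pb_fst C X X A f f, r1 = pb_snd C X X A f f\<rparr>"
  note pq = pb_fst_hom[OF f f] pb_snd_hom[OF f f] pb_square[OF f f]
  have rel: "related C R W x y \<longleftrightarrow> x \<in> Hom C W X \<and> y \<in> Hom C W X \<and> f \<cdot> x = f \<cdot> y" for W x y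
  proof
    assume "related C R W x y"
    then obtain u where u: "u \<in> Hom C W (pb_ob C X X A f f)"
        "x = pb_fst C X X A f f \<cdot> u" "y = pb_snd C X X A f f \<cdot> u"
      by (auto simp: related_def R_def)
    then show "x \<in> Hom C W X \<and> y \<in> Hom C W X \<and> f \<cdot> x = f \<cdot> y"
      using comp_hom[OF u(1)] pq comp_assoc[OF u(1) pq(1) f] comp_assoc[OF u(1) pq(2) f] by simp
  next
    assume "x \<in> Hom C W X \<and> y \<in> Hom C W X \<and> f \<cdot> x = f \<cdot> y"
    then show "related C R W x y"
      using pb_pair_props[OF f f, of x W y] by (auto simp: related_def R_def)
  qed
  have "u = v" if "u \<in> Hom C W (RObj R)" "v \<in> Hom C W (RObj R)"
      "r0 R \<cdot> u = r0 R \<cdot> v" "r1 R \<cdot> u = r1 R \<cdot> v" for W u v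
    using pb_ext[OF f f, of u W v] that by (simp add: R_def)
  then have "equivalence_relation C X R"
    using pq unfolding equivalence_relation_def by (auto simp: rel) (auto simp: R_def)
  then show thesis
    using that rel by blast
qed

section \<open>The operation \<alpha>.\<beta>\<inverse>.\<gamma> at a stage and in the slice\<close>

abbreviation gchi :: "('o, 'a) igrpd \<Rightarrow> 'o \<Rightarrow> 'a \<Rightarrow> 'a \<Rightarrow> 'a \<Rightarrow> 'a" where
  "gchi G W \<equiv> elem_groupoid.chi3 (gcomp C G W) (\<lambda>a. ginv G \<cdot> a)"

abbreviation gparallel :: "('o, 'a) igrpd \<Rightarrow> 'o \<Rightarrow> 'a \<Rightarrow> 'a \<Rightarrow> bool" where
  "gparallel G W \<equiv> elem_groupoid.parallel (Hom C W (G1 G)) (\<lambda>a. d0 G \<cdot> a) (\<lambda>a. d1 G \<cdot> a)"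

lemma gparallel_iff:
  assumes "internal_groupoid C G"
  shows "gparallel G W x y \<longleftrightarrow> x \<in> Hom C W (G1 G) \<and> y \<in> Hom C W (G1 G)
    \<and> d0 G \<cdot> x = d0 G \<cdot> y \<and> d1 G \<cdot> x = d1 G \<cdot> y"
  by (rule elem_groupoid.parallel_def[OF elem_groupoid[OF assms]])

lemma gparallel_comp:
  assumes G: "internal_groupoid C G" and "gparallel G W x y" and w: "w \<in> Hom C V W"
  shows "gparallel G V (x \<cdot> w) (y \<cdot> w)"
proof -
  have xy: "x \<in> Hom C W (G1 G)" "y \<in> Hom C W (G1 G)"
      "d0 G \<cdot> x = d0 G \<cdot> y" "d1 G \<cdot> x = d1 G \<cdot> y"
    using assms by (simp_all add: gparallel_iff)
  show ?thesis
    using comp_assoc[OF w xy(1) groupoid_hom(1)[OF G]] comp_assoc[OF w xy(2) groupoid_hom(1)[OF G]]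
      comp_assoc[OF w xy(1) groupoid_hom(2)[OF G]] comp_assoc[OF w xy(2) groupoid_hom(2)[OF G]]
      comp_hom[OF w] xy
    by (simp add: gparallel_iff[OF G])
qed

text \<open>Naturality in the stage: it makes the value at the universal parallel triple represent
  the operation on all parallel triples.\<close>

lemma gchi_comp:
  assumes G: "internal_groupoid C G" and "gparallel G W x y" "gparallel G W y z"
    and w: "w \<in> Hom C V W"
  shows "gchi G W x y z \<cdot> w = gchi G V (x \<cdot> w) (y \<cdot> w) (z \<cdot> w)"
proof -
  interpret A: elem_groupoid "Hom C W (G1 G)" "Hom C W (G0 G)" "\<lambda>a. d0 G \<cdot> a" "\<lambda>a. d1 G \<cdot> a"
    "\<lambda>x. s0 G \<cdot> x" "gcomp C G W" "\<lambda>a. ginv G \<cdot> a" by (rule elem_groupoid[OF G])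
  interpret B: elem_groupoid "Hom C V (G1 G)" "Hom C V (G0 G)" "\<lambda>a. d0 G \<cdot> a" "\<lambda>a. d1 G \<cdot> a"
    "\<lambda>x. s0 G \<cdot> x" "gcomp C G V" "\<lambda>a. ginv G \<cdot> a" by (rule elem_groupoid[OF G])
  have xyz: "x \<in> Hom C W (G1 G)" "y \<in> Hom C W (G1 G)" "z \<in> Hom C W (G1 G)"
      "d0 G \<cdot> x = d0 G \<cdot> y" "d1 G \<cdot> x = d1 G \<cdot> y" "d0 G \<cdot> z = d0 G \<cdot> y" "d1 G \<cdot> z = d1 G \<cdot> y"
    using assms by (simp_all add: A.parallel_def)
  show ?thesis
    unfolding A.chi3_def B.chi3_def
    using xyz comp_assoc[OF w xyz(2) groupoid_hom(4)[OF G]]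
    by (simp add: gcomp_comp[OF G _ _ _ w])
qed

lemma arrow_map_chi:
  assumes f: "arrow_map G H f" and G: "internal_groupoid C G" and H: "internal_groupoid C H"
    and "G0 G = G0 H" and "gparallel G W x y" "gparallel G W y z"
  shows "f \<cdot> gchi G W x y z = gchi H W (f \<cdot> x) (f \<cdot> y) (f \<cdot> z)"
proof -
  interpret A: elem_groupoid "Hom C W (G1 G)" "Hom C W (G0 G)" "\<lambda>a. d0 G \<cdot> a" "\<lambda>a. d1 G \<cdot> a"
    "\<lambda>x. s0 G \<cdot> x" "gcomp C G W" "\<lambda>a. ginv G \<cdot> a" by (rule elem_groupoid[OF G])
  interpret B: elem_groupoid "Hom C W (G1 H)" "Hom C W (G0 H)" "\<lambda>a. d0 H \<cdot> a" "\<lambda>a. d1 H \<cdot> a"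
    "\<lambda>x. s0 H \<cdot> x" "gcomp C H W" "\<lambda>a. ginv H \<cdot> a" by (rule elem_groupoid[OF H])
  show ?thesis
    unfolding A.chi3_def B.chi3_def
    using assms(5,6) arrow_map_elem[OF f G H, where W = W] arrow_map_inv[OF f G H assms(4), where W = W]
    by (simp add: A.parallel_def)
qed

text \<open>Pairing commutes with precomposition, so the structure map of the stage is forced to be
  the pair of end points of \<open>x\<close>.\<close>

lemma arrow_slice_elem:
  assumes G: "internal_groupoid C G"
  shows "x \<in> Hom (arrow_slice C G) (W, w) (arrow_ob C G) \<longleftrightarrow>
    x \<in> Hom C W (G1 G) \<and> w = prod_pair C (G0 G) (G0 G) W (d0 G \<cdot> x) (d1 G \<cdot> x)"
proof -
  note d = groupoid_hom(1,2)[OF G]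
  show ?thesis
    using prod_pair_hom[OF d] prod_pair_comp[OF d, of x W] prod_pair_hom[OF comp_hom[OF _ d(1)] comp_hom[OF _ d(2)], of x W x]
    by (auto simp: arrow_slice_def arrow_ob_def)
qed

text \<open>The end points of an element are the two projections of \<open>w\<close>. Elements at a
  stage of the slice are thus translated into parallel arrows, the language of all
  computations.\<close>

lemma arrow_slice_parallel:
  assumes G: "internal_groupoid C G"
    and x: "x \<in> Hom (arrow_slice C G) (W, w) (arrow_ob C G)"
  shows "gparallel G W x y \<longleftrightarrow> y \<in> Hom (arrow_slice C G) (W, w) (arrow_ob C G)"
proof
  note d = groupoid_hom(1,2)[OF G]
  note x' = x[unfolded arrow_slice_elem[OF G]]
  show "y \<in> Hom (arrow_slice C G) (W, w) (arrow_ob C G)" if "gparallel G W x y"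
    using that x' by (simp add: gparallel_iff[OF G] arrow_slice_elem[OF G])
  assume "y \<in> Hom (arrow_slice C G) (W, w) (arrow_ob C G)"
  then have y': "y \<in> Hom C W (G1 G)" "w = prod_pair C (G0 G) (G0 G) W (d0 G \<cdot> y) (d1 G \<cdot> y)"
    by (simp_all add: arrow_slice_elem[OF G])
  have "d0 G \<cdot> y = prod_fst C (G0 G) (G0 G) \<cdot> w" "d1 G \<cdot> y = prod_snd C (G0 G) (G0 G) \<cdot> w"
    using prod_pair_props[OF comp_hom[OF y'(1) d(1)] comp_hom[OF y'(1) d(2)]] y'(2) by simp_all
  moreover have "x \<in> Hom C W (G1 G)"
      "d0 G \<cdot> x = prod_fst C (G0 G) (G0 G) \<cdot> w" "d1 G \<cdot> x = prod_snd C (G0 G) (G0 G) \<cdot> w"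
    using prod_pair_props[OF comp_hom[OF _ d(1)] comp_hom[OF _ d(2)], of x W x] x' by simp_all
  ultimately show "gparallel G W x y"
    using y'(1) by (simp add: gparallel_iff[OF G])
qed

text \<open>The cube in the slice is the object \<open>U\<close> of parallel triples, with universal
  triple \<open>a\<close>, \<open>b\<close>, \<open>c\<close>. What is obtained here lets later
  arguments work in \<open>C\<close> without unfolding limits of the slice.\<close>

lemma arrow_slice_cube:
  assumes G: "internal_groupoid C G"
  obtains U a b c where "gparallel G U a b" "gparallel G U b c"
    and "chi C G = gchi G U a b c"
    and "chi C G \<in> Hom (arrow_slice C G) (cube (arrow_slice C G) (arrow_ob C G)) (arrow_ob C G)"
    and "\<And>W w x y z. \<lbrakk>gparallel G W x y; gparallel G W y z;
        w = prod_pair C (G0 G) (G0 G) W (d0 G \<cdot> x) (d1 G \<cdot> x)\<rbrakk>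
      \<Longrightarrow> triple (arrow_slice C G) (arrow_ob C G) (W, w) x y z \<in> Hom C W U
        \<and> a \<cdot> triple (arrow_slice C G) (arrow_ob C G) (W, w) x y z = x
        \<and> b \<cdot> triple (arrow_slice C G) (arrow_ob C G) (W, w) x y z = y
        \<and> c \<cdot> triple (arrow_slice C G) (arrow_ob C G) (W, w) x y z = z"
proof -
  interpret S: prodcat "arrow_slice C G"
    unfolding arrow_slice_def by (rule slice_prodcat)
  let ?S = "arrow_slice C G" and ?A = "arrow_ob C G"
  have comp: "Comp ?S = Comp C"
    by (simp add: arrow_slice_def slice_def)
  note d = groupoid_hom(1,2)[OF G]
  have A: "?A \<in> Obj ?S"
    using prod_pair_hom[OF d] by (simp add: arrow_slice_def arrow_ob_def)
  obtain U \<mu> where U: "cube ?S ?A = (U, \<mu>)"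
    by (cases "cube ?S ?A")
  note pr = S.cube_pr1_hom[OF A, unfolded U] S.cube_pr2_hom[OF A, unfolded U]
    S.cube_pr3_hom[OF A, unfolded U]
  let ?a = "cube_pr1 ?S ?A" and ?b = "cube_pr2 ?S ?A" and ?c = "cube_pr3 ?S ?A"
  interpret U: elem_groupoid "Hom C U (G1 G)" "Hom C U (G0 G)" "\<lambda>a. d0 G \<cdot> a" "\<lambda>a. d1 G \<cdot> a"
    "\<lambda>x. s0 G \<cdot> x" "gcomp C G U" "\<lambda>a. ginv G \<cdot> a" by (rule elem_groupoid[OF G])
  have par: "gparallel G U ?a ?b" "gparallel G U ?b ?c"
    using arrow_slice_parallel[OF G] pr by blast+
  have chi: "chi C G = gchi G U ?a ?b ?c"
    by (simp add: chi_def Let_def U U.chi3_def)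
  \<comment> \<open>Being parallel to the first projection is what makes \<open>chi C G\<close> an
    arrow of the slice.\<close>
  have "gparallel G U ?a (chi C G)"
    using U.chi3_parallel[OF par] chi by (simp add: gparallel_iff[OF G])
  then have chi_hom: "chi C G \<in> Hom ?S (cube ?S ?A) ?A"
    using arrow_slice_parallel[OF G pr(1)] U by simp
  have "triple ?S ?A (W, w) x y z \<in> Hom C W U \<and> ?a \<cdot> triple ?S ?A (W, w) x y z = x
      \<and> ?b \<cdot> triple ?S ?A (W, w) x y z = y \<and> ?c \<cdot> triple ?S ?A (W, w) x y z = z"
    if "gparallel G W x y" "gparallel G W y z"
      and w: "w = prod_pair C (G0 G) (G0 G) W (d0 G \<cdot> x) (d1 G \<cdot> x)" for W x y z w
  proof -
    have x: "x \<in> Hom ?S (W, w) ?A"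
      using that by (simp add: arrow_slice_elem[OF G] gparallel_iff[OF G])
    then have y: "y \<in> Hom ?S (W, w) ?A" and z: "z \<in> Hom ?S (W, w) ?A"
      using that(1,2) arrow_slice_parallel[OF G] by blast+
    have "triple ?S ?A (W, w) x y z \<in> Hom C W U"
      using S.triple_hom[OF x y z] unfolding U by (simp add: arrow_slice_def)
    then show ?thesis
      using S.cube_pr_triple[OF x y z] by (simp add: comp)
  qed
  then show thesis
    using that[OF par chi chi_hom] by blast
qed

end

section \<open>Gumm categories: commutativity from the Shifting Lemma\<close>

locale gumm = fincat +
  assumes shifting: "shifting_lemma C"

lemma gumm_iff: "gumm C \<longleftrightarrow> gumm_category C"
  unfolding gumm_def gumm_axioms_def gumm_category_def fincat_iff by blast

context gumm
begin

text \<open>The Shifting Lemma with the kernels of \<open>f\<close>, \<open>g\<close>,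
  \<open>k\<close> in the roles of R, S, T; \<open>incl\<close> is the inclusion of the
  intersection.\<close>

lemma shift_maps:
  assumes f: "f \<in> Hom C X A" and g: "g \<in> Hom C X B" and k: "k \<in> Hom C X D"
    and incl: "\<And>W x y. \<lbrakk>x \<in> Hom C W X; y \<in> Hom C W X; f \<cdot> x = f \<cdot> y; g \<cdot> x = g \<cdot> y\<rbrakk> \<Longrightarrow> k \<cdot> x = k \<cdot> y"
    and xy: "x \<in> Hom C W X" "y \<in> Hom C W X" "x' \<in> Hom C W X" "y' \<in> Hom C W X"
    and eq: "g \<cdot> x = g \<cdot> y" "g \<cdot> x' = g \<cdot> y'" "f \<cdot> x = f \<cdot> x'" "f \<cdot> y = f \<cdot> y'" "k \<cdot> x = k \<cdot> x'"
  shows "k \<cdot> y = k \<cdot> y'"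
proof -
  obtain R where R: "equivalence_relation C X R"
    "\<And>W x y. related C R W x y \<longleftrightarrow> x \<in> Hom C W X \<and> y \<in> Hom C W X \<and> f \<cdot> x = f \<cdot> y"
    using kernel_relation[OF f] by blast
  obtain S where S: "equivalence_relation C X S"
    "\<And>W x y. related C S W x y \<longleftrightarrow> x \<in> Hom C W X \<and> y \<in> Hom C W X \<and> g \<cdot> x = g \<cdot> y"
    using kernel_relation[OF g] by blast
  obtain T where T: "equivalence_relation C X T"
    "\<And>W x y. related C T W x y \<longleftrightarrow> x \<in> Hom C W X \<and> y \<in> Hom C W X \<and> k \<cdot> x = k \<cdot> y"
    using kernel_relation[OF k] by blast
  have X: "X \<in> Obj C"
    using f hom_obj by blast
  have "inter_included C R S T"
    unfolding inter_included_def R(2) S(2) T(2) using incl by blast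
  then have "related C T W y y'"
    using shifting[unfolded shifting_lemma_def, rule_format, OF X R(1) S(1) T(1) _ xy] xy eq
    unfolding R(2) S(2) T(2) by blast
  then show ?thesis
    by (simp add: T(2))
qed

text \<open>
  On the object of parallel triples, the Shifting Lemma applies to the kernels of
  \<open>\<gamma>.\<beta>\<inverse>.\<alpha>\<close>, of \<open>(\<beta>, \<gamma>)\<close> and of \<open>\<alpha>.\<beta>\<inverse>.\<gamma>\<close>, and to the rectangle with vertices
  \<open>(y, y, z)\<close>, \<open>(x, y, z)\<close>, \<open>(z, y, y)\<close>, \<open>(z.y\<inverse>.x, y, y)\<close>.
\<close>

lemma gchi_commute:
  assumes G: "internal_groupoid C G" and xyz: "gparallel G W x y" "gparallel G W y z"
  shows "gchi G W x y z = gchi G W z y x"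
proof -
  obtain U a b c where U: "gparallel G U a b" "gparallel G U b c"
    and tr: "\<And>V p q r. \<lbrakk>gparallel G V p q; gparallel G V q r\<rbrakk>
      \<Longrightarrow> \<exists>t \<in> Hom C V U. a \<cdot> t = p \<and> b \<cdot> t = q \<and> c \<cdot> t = r"
    using arrow_slice_cube[OF G] by metis
  have sym: "gparallel G V p q \<Longrightarrow> gparallel G V q p" for V p q
    by (simp add: gparallel_iff[OF G])
  have h: "a \<in> Hom C U (G1 G)" "b \<in> Hom C U (G1 G)" "c \<in> Hom C U (G1 G)"
    using U by (simp_all add: gparallel_iff[OF G])
  interpret U: elem_groupoid "Hom C U (G1 G)" "Hom C U (G0 G)" "\<lambda>a. d0 G \<cdot> a" "\<lambda>a. d1 G \<cdot> a"
    "\<lambda>x. s0 G \<cdot> x" "gcomp C G U" "\<lambda>a. ginv G \<cdot> a" by (rule elem_groupoid[OF G])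
  interpret W: elem_groupoid "Hom C W (G1 G)" "Hom C W (G0 G)" "\<lambda>a. d0 G \<cdot> a" "\<lambda>a. d1 G \<cdot> a"
    "\<lambda>x. s0 G \<cdot> x" "gcomp C G W" "\<lambda>a. ginv G \<cdot> a" by (rule elem_groupoid[OF G])
  let ?f = "gchi G U c b a" and ?g = "prod_pair C (G1 G) (G1 G) U b c" and ?k = "gchi G U a b c"
  have f_comp: "?f \<cdot> t = gchi G V (c \<cdot> t) (b \<cdot> t) (a \<cdot> t)"
    and k_comp: "?k \<cdot> t = gchi G V (a \<cdot> t) (b \<cdot> t) (c \<cdot> t)"
    and g_comp: "?g \<cdot> t = prod_pair C (G1 G) (G1 G) V (b \<cdot> t) (c \<cdot> t)" if "t \<in> Hom C V U" for V t
    using gchi_comp[OF G U that] gchi_comp[OF G sym[OF U(2)] sym[OF U(1)] that]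
      prod_pair_comp[OF h(2,3) that] by simp_all
  have f: "?f \<in> Hom C U (G1 G)" and k: "?k \<in> Hom C U (G1 G)"
    using U.chi3_parallel[OF sym[OF U(2)] sym[OF U(1)]] U.chi3_parallel[OF U]
    by (simp_all add: U.parallel_def)
  note g = prod_pair_hom[OF h(2,3)]
  \<comment> \<open>Equality under \<open>?g\<close> fixes the components \<open>b\<close> and
    \<open>c\<close>; equality under \<open>?f\<close> then cancels to equality of
    \<open>a\<close>.\<close>
  have incl: "?k \<cdot> t = ?k \<cdot> t'"
    if t: "t \<in> Hom C V U" "t' \<in> Hom C V U" and eq: "?f \<cdot> t = ?f \<cdot> t'" "?g \<cdot> t = ?g \<cdot> t'" for V t t'
  proof -
    have bc: "b \<cdot> t' = b \<cdot> t" "c \<cdot> t' = c \<cdot> t"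
      using eq(2) g_comp t prod_fst_pair[OF comp_hom[OF t(1) h(2)] comp_hom[OF t(1) h(3)]]
        prod_snd_pair[OF comp_hom[OF t(1) h(2)] comp_hom[OF t(1) h(3)]]
        prod_fst_pair[OF comp_hom[OF t(2) h(2)] comp_hom[OF t(2) h(3)]]
        prod_snd_pair[OF comp_hom[OF t(2) h(2)] comp_hom[OF t(2) h(3)]]
      by simp_all
    have "gchi G V (c \<cdot> t) (b \<cdot> t) (a \<cdot> t) = gchi G V (c \<cdot> t) (b \<cdot> t) (a \<cdot> t')"
      using eq(1) f_comp t bc by simp
    then have "a \<cdot> t = a \<cdot> t'"
      using elem_groupoid.chi3_inj[OF elem_groupoid[OF G], of V "a \<cdot> t" "b \<cdot> t" "c \<cdot> t" "a \<cdot> t'"]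
        gparallel_comp[OF G U(1) t(1)] gparallel_comp[OF G U(2) t(1)] gparallel_comp[OF G U(1) t(2)] bc
      by simp
    then show ?thesis
      using k_comp t bc by simp
  qed
  \<comment> \<open>The desired value itself is put into a vertex: (\<open>?q\<close>, y, y) has the
    value \<open>?q\<close> under \<open>?k\<close>.\<close>
  let ?q = "gchi G W z y x"
  have q: "gparallel G W ?q z"
    using W.chi3_parallel[OF sym[OF xyz(2)] sym[OF xyz(1)]] .
  have yy: "gparallel G W y y" "gparallel G W ?q y"
    using xyz q by (simp_all add: gparallel_iff[OF G])
  obtain t1 where t1: "t1 \<in> Hom C W U" "a \<cdot> t1 = y" "b \<cdot> t1 = y" "c \<cdot> t1 = z"
    using tr[OF yy(1) xyz(2)] by blast
  obtain t2 where t2: "t2 \<in> Hom C W U" "a \<cdot> t2 = z" "b \<cdot> t2 = y" "c \<cdot> t2 = y"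
    using tr[OF sym[OF xyz(2)] yy(1)] by blast
  obtain t3 where t3: "t3 \<in> Hom C W U" "a \<cdot> t3 = x" "b \<cdot> t3 = y" "c \<cdot> t3 = z"
    using tr[OF xyz] by blast
  obtain t4 where t4: "t4 \<in> Hom C W U" "a \<cdot> t4 = ?q" "b \<cdot> t4 = y" "c \<cdot> t4 = y"
    using tr[OF yy(2,1)] by blast
  note chi = W.chi3_left[OF sym[OF xyz(2)]] W.chi3_right[OF sym[OF xyz(2)]]
    W.chi3_left[OF yy(2)] W.chi3_right[OF yy(2)]
  \<comment> \<open>By the Mal'tsev identities \<open>?f\<close> is \<open>z\<close> at
    \<open>t1\<close> and \<open>t2\<close>, and \<open>?q\<close> at \<open>t3\<close> and
    \<open>t4\<close>, while \<open>?k\<close> is \<open>z\<close> at \<open>t1\<close> and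
    \<open>t2\<close>. Shifting along \<open>?g\<close> carries the last equality over to
    \<open>t3\<close> and \<open>t4\<close>.\<close>
  have "?k \<cdot> t3 = ?k \<cdot> t4"
    by (rule shift_maps[OF f g k incl t1(1) t3(1) t2(1) t4(1)])
      (use t1 t2 t3 t4 in \<open>simp_all add: f_comp k_comp g_comp chi\<close>)
  then show ?thesis
    using t3 t4 by (simp add: k_comp chi)
qed

text \<open>At each stage of the slice the internal operation is \<open>gchi\<close> on parallel
  arrows; the Mal'tsev and associative laws are those of an ordinary groupoid, and commutativity is
  \<open>gchi_commute\<close>.\<close>

theorem abelian:
  assumes G: "internal_groupoid C G"
  shows "abelian_groupoid C G"
proof -
  let ?S = "arrow_slice C G" and ?A = "arrow_ob C G"
  have comp: "Comp ?S = Comp C"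
    by (simp add: arrow_slice_def slice_def)
  obtain U a b c where U: "gparallel G U a b" "gparallel G U b c"
    and chi: "chi C G = gchi G U a b c" "chi C G \<in> Hom ?S (cube ?S ?A) ?A"
    and tr: "\<And>W w x y z. \<lbrakk>gparallel G W x y; gparallel G W y z;
        w = prod_pair C (G0 G) (G0 G) W (d0 G \<cdot> x) (d1 G \<cdot> x)\<rbrakk>
      \<Longrightarrow> triple ?S ?A (W, w) x y z \<in> Hom C W U \<and> a \<cdot> triple ?S ?A (W, w) x y z = x
        \<and> b \<cdot> triple ?S ?A (W, w) x y z = y \<and> c \<cdot> triple ?S ?A (W, w) x y z = z"
    using arrow_slice_cube[OF G] by metis
  have app3: "app3 ?S ?A (chi C G) (W, w) x y z = gchi G W x y z"
    if "x \<in> Hom ?S (W, w) ?A" "y \<in> Hom ?S (W, w) ?A" "z \<in> Hom ?S (W, w) ?A" for W w x y z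
  proof -
    have p: "gparallel G W x y" "gparallel G W y z"
      using that arrow_slice_parallel[OF G] by blast+
    from that(1) have "w = prod_pair C (G0 G) (G0 G) W (d0 G \<cdot> x) (d1 G \<cdot> x)"
      by (simp add: arrow_slice_elem[OF G])
    note t = tr[OF p this]
    from gchi_comp[OF G U t[THEN conjunct1]] t show ?thesis
      unfolding app3_def comp chi(1) by simp
  qed
  \<comment> \<open>In the associative law values of the operation occur again as arguments, so they
    have to be elements at the same stage.\<close>
  have hom: "gchi G W x y z \<in> Hom ?S (W, w) ?A"
    if "x \<in> Hom ?S (W, w) ?A" "y \<in> Hom ?S (W, w) ?A" "z \<in> Hom ?S (W, w) ?A" for W w x y z
  proof -
    have "gparallel G W (gchi G W x y z) x"
      using elem_groupoid.chi3_parallel[OF elem_groupoid[OF G]] that arrow_slice_parallel[OF G] by blast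
    then show ?thesis
      unfolding arrow_slice_parallel[OF G that(1), symmetric] by (simp add: gparallel_iff[OF G])
  qed
  note elem = elem_groupoid[OF G]
  have "maltsev_op ?S ?A (chi C G)"
    unfolding maltsev_op_def
  proof (intro conjI allI ballI chi(2))
    fix W' x y
    assume xy: "x \<in> Hom ?S W' ?A" "y \<in> Hom ?S W' ?A"
    obtain W w where W: "W' = (W, w)"
      by (cases W')
    note xy = xy[unfolded W]
    have p: "gparallel G W x y"
      using xy arrow_slice_parallel[OF G] by blast
    show "app3 ?S ?A (chi C G) W' x y y = x" "app3 ?S ?A (chi C G) W' y y x = x"
      unfolding W using elem_groupoid.chi3_left[OF elem p] elem_groupoid.chi3_right[OF elem p]
      by (simp_all add: app3 xy)
  qed
  moreover have "associative_op ?S ?A (chi C G)"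
    unfolding associative_op_def
  proof (intro allI ballI)
    fix W' x y z u v
    assume xyz: "x \<in> Hom ?S W' ?A" "y \<in> Hom ?S W' ?A" "z \<in> Hom ?S W' ?A" "u \<in> Hom ?S W' ?A"
      "v \<in> Hom ?S W' ?A"
    obtain W w where W: "W' = (W, w)"
      by (cases W')
    note xyz = xyz[unfolded W]
    have p: "gparallel G W x y" "gparallel G W y z" "gparallel G W z u" "gparallel G W u v"
      using xyz arrow_slice_parallel[OF G] by blast+
    show "app3 ?S ?A (chi C G) W' (app3 ?S ?A (chi C G) W' x y z) u v
        = app3 ?S ?A (chi C G) W' x y (app3 ?S ?A (chi C G) W' z u v)"
      unfolding W using elem_groupoid.chi3_assoc[OF elem p] by (simp add: app3 hom xyz)
  qed
  moreover have "commutative_op ?S ?A (chi C G)"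
    unfolding commutative_op_def
  proof (intro allI ballI)
    fix W' x y z
    assume xyz: "x \<in> Hom ?S W' ?A" "y \<in> Hom ?S W' ?A" "z \<in> Hom ?S W' ?A"
    obtain W w where W: "W' = (W, w)"
      by (cases W')
    note xyz = xyz[unfolded W]
    have p: "gparallel G W x y" "gparallel G W y z"
      using xyz arrow_slice_parallel[OF G] by blast+
    show "app3 ?S ?A (chi C G) W' x y z = app3 ?S ?A (chi C G) W' z y x"
      unfolding W using gchi_commute[OF G p] by (simp add: app3 xyz)
  qed
  ultimately show ?thesis
    unfolding abelian_groupoid_def autonomous_op_def using G by blast
qed

end

section \<open>The fibers of the groupoid fibration\<close>

context fincat
begin

lemma fiber_obj: "G \<in> Obj (Grd_fiber C X) \<longleftrightarrow> internal_groupoid C G \<and> G0 G = X"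
  by (auto simp: Grd_fiber_def fiber_def Grd_def ob_functor_def)

lemma fiber_comp [simp]: "K \<cdot>\<^bsub>Grd_fiber C X\<^esub> F = (fst K \<cdot> fst F, snd K \<cdot> snd F)"
  and fiber_idn [simp]: "Idn (Grd_fiber C X) G = (Idn C (G0 G), Idn C (G1 G))"
  by (simp_all add: Grd_fiber_def fiber_def Grd_def)

text \<open>A morphism of the fiber is carried by its second component. The unit condition of an
  internal functor comes from \<open>arrow_map_unit\<close> at the identity of
  \<open>X\<close>.\<close>

lemma fiber_hom:
  "F \<in> Hom (Grd_fiber C X) G H \<longleftrightarrow>
    G \<in> Obj (Grd_fiber C X) \<and> H \<in> Obj (Grd_fiber C X) \<and> fst F = Idn C X \<and> arrow_map G H (snd F)"
proof -
  have "internal_functor C G H F \<longleftrightarrow> arrow_map G H (snd F)"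
    if G: "internal_groupoid C G" "G0 G = X" and H: "internal_groupoid C H" "G0 H = X"
      and F: "fst F = Idn C X"
  proof -
    note g = groupoid_hom[OF G(1), unfolded G(2)] and h = groupoid_hom[OF H(1), unfolded H(2)]
    have X: "Idn C X \<in> Hom C X X"
      using g hom_obj idn_hom by blast
    have "snd F \<cdot> s0 G = s0 H" if "arrow_map G H (snd F)"
      using arrow_map_unit[OF that G(1) H(1), of "Idn C X" X] G H X
      by (simp add: idn_right[OF g(3)] idn_right[OF h(3)])
    then show ?thesis
      using X by (auto simp: internal_functor_def arrow_map_def F G H idn_left[OF g(1)]
        idn_left[OF g(2)] idn_right[OF h(3)])
  qed
  then show ?thesis
    by (auto simp: Grd_fiber_def fiber_def Grd_def ob_functor_def)
qed

lemma arrow_map_comp: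
  assumes f: "arrow_map G H f" and g: "arrow_map H K g"
    and G: "internal_groupoid C G" and H: "internal_groupoid C H" and K: "internal_groupoid C K"
  shows "arrow_map G K (g \<cdot> f)"
proof -
  have fg: "f \<in> Hom C (G1 G) (G1 H)" "g \<in> Hom C (G1 H) (G1 K)"
    using f g by (simp_all add: arrow_map_def)
  have "(g \<cdot> f) \<cdot> gcomp C G W b a = gcomp C K W ((g \<cdot> f) \<cdot> b) ((g \<cdot> f) \<cdot> a)"
    if ab: "a \<in> Hom C W (G1 G)" "b \<in> Hom C W (G1 G)" "d0 G \<cdot> b = d1 G \<cdot> a" for W a b
    using arrow_map_elem[OF f G H, where W = W] arrow_map_elem[OF g H K, where W = W] ab
      gcomp_hom[OF G ab] comp_assoc[OF _ fg] by metis
  then show ?thesis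
    using f g comp_hom[OF fg] comp_assoc[OF fg] groupoid_hom(1,2)[OF K]
    unfolding arrow_map_def by metis
qed

lemma arrow_map_idn:
  assumes G: "internal_groupoid C G"
  shows "arrow_map G G (Idn C (G1 G))"
  unfolding arrow_map_def
proof (intro conjI ballI allI impI)
  note d = groupoid_hom(1,2)[OF G]
  show "Idn C (G1 G) \<in> Hom C (G1 G) (G1 G)" "d0 G \<cdot> Idn C (G1 G) = d0 G" "d1 G \<cdot> Idn C (G1 G) = d1 G"
    using d hom_obj idn_hom idn_right by blast+
  fix W a b
  assume ab: "a \<in> Hom C W (G1 G)" "b \<in> Hom C W (G1 G)" "d0 G \<cdot> b = d1 G \<cdot> a"
  show "Idn C (G1 G) \<cdot> gcomp C G W b a = gcomp C G W (Idn C (G1 G) \<cdot> b) (Idn C (G1 G) \<cdot> a)"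
    using ab gcomp_hom[OF G ab] by (simp add: idn_left)
qed

lemma fiber_category: "category (Grd_fiber C X)"
proof
  fix G H K L F F' F''
  assume F: "F \<in> Hom (Grd_fiber C X) G H"
  then have X: "Idn C X \<in> Hom C X X"
    using groupoid_hom(1) hom_obj idn_hom by (metis fiber_hom fiber_obj)
  have f: "snd F \<in> Hom C (G1 G) (G1 H)" "fst F = Idn C X" "G0 G = X" "G0 H = X"
    using F by (simp_all add: fiber_hom fiber_obj arrow_map_def)
  show "G \<in> Obj (Grd_fiber C X) \<and> H \<in> Obj (Grd_fiber C X)"
    using F by (simp add: fiber_hom)
  show "Idn (Grd_fiber C X) H \<cdot>\<^bsub>Grd_fiber C X\<^esub> F = F" "F \<cdot>\<^bsub>Grd_fiber C X\<^esub> Idn (Grd_fiber C X) G = F"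
    using f by (simp_all add: idn_left[OF X] idn_left[OF f(1)] idn_right[OF f(1)] prod_eq_iff)
  assume F': "F' \<in> Hom (Grd_fiber C X) H K"
  then show "F' \<cdot>\<^bsub>Grd_fiber C X\<^esub> F \<in> Hom (Grd_fiber C X) G K"
    using F arrow_map_comp[of G H "snd F" K "snd F'"] by (simp add: fiber_hom fiber_obj idn_left[OF X])
  assume F'': "F'' \<in> Hom (Grd_fiber C X) K L"
  have f': "snd F' \<in> Hom C (G1 H) (G1 K)" "fst F' = Idn C X"
      "snd F'' \<in> Hom C (G1 K) (G1 L)" "fst F'' = Idn C X"
    using F' F'' by (simp_all add: fiber_hom fiber_obj arrow_map_def)
  show "(F'' \<cdot>\<^bsub>Grd_fiber C X\<^esub> F') \<cdot>\<^bsub>Grd_fiber C X\<^esub> F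
      = F'' \<cdot>\<^bsub>Grd_fiber C X\<^esub> (F' \<cdot>\<^bsub>Grd_fiber C X\<^esub> F)"
    using comp_assoc[OF f(1) f'(1,3)] by (simp add: f(2) f'(2,4) idn_left[OF X])
next
  fix G
  assume "G \<in> Obj (Grd_fiber C X)"
  then show "Idn (Grd_fiber C X) G \<in> Hom (Grd_fiber C X) G G"
    using arrow_map_idn by (simp add: fiber_hom fiber_obj)
qed

text \<open>The indiscrete groupoid on \<open>X\<close>.\<close>

lemma fiber_terminal:
  assumes X: "X \<in> Obj C"
  shows "\<exists>T. is_terminal (Grd_fiber C X) T"
proof -
  let ?XX = "prod_ob C X X" and ?p = "prod_fst C X X" and ?q = "prod_snd C X X"
  let ?s = "prod_pair C X X X (Idn C X) (Idn C X)" and ?j = "prod_pair C X X (prod_ob C X X) ?q ?p"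
  \<comment> \<open>An arrow is its pair of end points, so a composite takes its source from
    \<open>a\<close> and its target from \<open>b\<close>.\<close>
  let ?M = "\<lambda>W b a. prod_pair C X X W (?p \<cdot> a) (?q \<cdot> b)"
  note p = prod_fst_hom[OF X X] and q = prod_snd_hom[OF X X] and i = idn_hom[OF X]
  note s = prod_pair_hom[OF i i] and j = prod_pair_hom[OF q p]
  have ext: "a = b" if "a \<in> Hom C W ?XX" "b \<in> Hom C W ?XX" "?p \<cdot> a = ?p \<cdot> b" "?q \<cdot> a = ?q \<cdot> b" for W a b
    using prod_ext[OF X X that] .
  have elem: "elem_groupoid (Hom C W ?XX) (Hom C W X) (\<lambda>a. ?p \<cdot> a) (\<lambda>a. ?q \<cdot> a)
    (\<lambda>x. ?s \<cdot> x) (?M W) (\<lambda>a. ?j \<cdot> a)" for W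
  proof -
    have pq_hom: "?p \<cdot> a \<in> Hom C W X" "?q \<cdot> a \<in> Hom C W X" if "a \<in> Hom C W ?XX" for a
      using comp_hom[OF that] p q by blast+
    have eta: "prod_pair C X X W (?p \<cdot> a) (?q \<cdot> a) = a" if "a \<in> Hom C W ?XX" for a
      by (rule prod_ext[OF X X]) (use prod_pair_props[OF pq_hom[OF that]] that in simp_all)
    have s_pair: "?s \<cdot> x = prod_pair C X X W x x" if "x \<in> Hom C W X" for x
      using prod_pair_comp[OF i i that] idn_left[OF that] by simp
    have j_pair: "?j \<cdot> a = prod_pair C X X W (?q \<cdot> a) (?p \<cdot> a)" if "a \<in> Hom C W ?XX" for a
      using prod_pair_comp[OF q p that] .
    show ?thesis
      by unfold_locales
        (simp_all add: pq_hom eta s_pair j_pair prod_pair_hom prod_fst_pair prod_snd_pair)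
  qed
  have nat: "?M W b a \<cdot> w = ?M V (b \<cdot> w) (a \<cdot> w)"
    if "a \<in> Hom C W ?XX" "b \<in> Hom C W ?XX" "w \<in> Hom C V W" for V W a b w
    using prod_pair_comp[OF comp_hom[OF that(1) p] comp_hom[OF that(2) q] that(3)]
      comp_assoc[OF that(3,1) p] comp_assoc[OF that(3,2) q] by simp
  obtain T where T: "internal_groupoid C T" "G0 T = X" "G1 T = ?XX" "d0 T = ?p" "d1 T = ?q"
    and T_comp: "\<And>W a b. \<lbrakk>a \<in> Hom C W ?XX; b \<in> Hom C W ?XX; ?p \<cdot> b = ?q \<cdot> a\<rbrakk>
      \<Longrightarrow> gcomp C T W b a = ?M W b a"
    using internal_groupoidI[OF p q s j elem nat] by blast
  have "\<exists>!F. F \<in> Hom (Grd_fiber C X) G T" if "G \<in> Obj (Grd_fiber C X)" for G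
  proof
    have G: "internal_groupoid C G" "G0 G = X"
      using that by (simp_all add: fiber_obj)
    note d = groupoid_hom(1,2)[OF G(1), unfolded G(2)]
    \<comment> \<open>Preservation of end points forces both components of a morphism into the
      indiscrete groupoid.\<close>
    let ?u = "prod_pair C X X (G1 G) (d0 G) (d1 G)"
    note u = prod_pair_props[OF d]
    have pu: "?p \<cdot> (?u \<cdot> a) = d0 G \<cdot> a" "?q \<cdot> (?u \<cdot> a) = d1 G \<cdot> a" "?u \<cdot> a \<in> Hom C W ?XX"
      if "a \<in> Hom C W (G1 G)" for W a
      using comp_assoc[OF that u[THEN conjunct1] p] comp_assoc[OF that u[THEN conjunct1] q]
        comp_hom[OF that u[THEN conjunct1]] u by simp_all
    have "?u \<cdot> gcomp C G W b a = gcomp C T W (?u \<cdot> b) (?u \<cdot> a)"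
      if ab: "a \<in> Hom C W (G1 G)" "b \<in> Hom C W (G1 G)" "d0 G \<cdot> b = d1 G \<cdot> a" for W a b
    proof -
      interpret W: elem_groupoid "Hom C W (G1 G)" "Hom C W (G0 G)" "\<lambda>a. d0 G \<cdot> a" "\<lambda>a. d1 G \<cdot> a"
        "\<lambda>x. s0 G \<cdot> x" "gcomp C G W" "\<lambda>a. ginv G \<cdot> a" by (rule elem_groupoid[OF G(1)])
      have "gcomp C T W (?u \<cdot> b) (?u \<cdot> a) = ?M W (?u \<cdot> b) (?u \<cdot> a)"
        using ab by (intro T_comp) (simp_all add: pu)
      then show ?thesis
        using ab prod_pair_comp[OF d, of "gcomp C G W b a" W] by (simp add: pu)
    qed
    then have "arrow_map G T ?u"
      using u T by (simp add: arrow_map_def)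
    then show "(Idn C X, ?u) \<in> Hom (Grd_fiber C X) G T"
      using that T by (simp add: fiber_hom fiber_obj)
    fix F
    assume "F \<in> Hom (Grd_fiber C X) G T"
    then show "F = (Idn C X, ?u)"
      using u T ext[of "snd F" "G1 G" ?u] by (auto simp: fiber_hom arrow_map_def prod_eq_iff)
  qed
  then have "is_terminal (Grd_fiber C X) T"
    using T by (simp add: is_terminal_def fiber_obj)
  then show ?thesis
    by blast
qed

text \<open>Objects of arrows are pulled back in \<open>C\<close> and the structure is
  componentwise, its laws coming from \<open>elem_groupoid_subdirect\<close>. The second conclusion
  records that passing to objects of arrows preserves this pullback.\<close>

lemma fiber_pullback:
  assumes "F \<in> Hom (Grd_fiber C X) A Z" "F' \<in> Hom (Grd_fiber C X) B Z"
  obtains P p q where "is_pullback (Grd_fiber C X) A B Z F F' P p q"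
    "is_pullback C (G1 A) (G1 B) (G1 Z) (snd F) (snd F') (G1 P) (snd p) (snd q)"
proof -
  have A: "internal_groupoid C A" "G0 A = X" and B: "internal_groupoid C B" "G0 B = X"
    and Z: "internal_groupoid C Z" "G0 Z = X"
    and F: "fst F = Idn C X" "arrow_map A Z (snd F)" and F': "fst F' = Idn C X" "arrow_map B Z (snd F')"
    using assms by (simp_all add: fiber_hom fiber_obj)
  note a = groupoid_hom[OF A(1), unfolded A(2)] and b = groupoid_hom[OF B(1), unfolded B(2)]
    and z = groupoid_hom[OF Z(1), unfolded Z(2)]
  have X: "Idn C X \<in> Hom C X X"
    using a hom_obj idn_hom by blast
  define f g where "f = snd F" and "g = snd F'"
  have f: "f \<in> Hom C (G1 A) (G1 Z)" and g: "g \<in> Hom C (G1 B) (G1 Z)"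
    using F F' by (simp_all add: f_def g_def arrow_map_def)
  note f_elem = arrow_map_elem[OF F(2) A(1) Z(1), folded f_def]
    and g_elem = arrow_map_elem[OF F'(2) B(1) Z(1), folded g_def]
  have f_unit: "f \<cdot> (s0 A \<cdot> x) = s0 Z \<cdot> x" and g_unit: "g \<cdot> (s0 B \<cdot> x) = s0 Z \<cdot> x"
    if "x \<in> Hom C W X" for W x
    using arrow_map_unit[OF F(2) A(1) Z(1), of x W] arrow_map_unit[OF F'(2) B(1) Z(1), of x W] that
    by (simp_all add: A B Z f_def g_def)
  have f_inv: "x \<in> Hom C W (G1 A) \<Longrightarrow> f \<cdot> (ginv A \<cdot> x) = ginv Z \<cdot> (f \<cdot> x)"
    and g_inv: "x \<in> Hom C W (G1 B) \<Longrightarrow> g \<cdot> (ginv B \<cdot> x) = ginv Z \<cdot> (g \<cdot> x)" for W x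
    using arrow_map_inv[OF F(2) A(1) Z(1), of x W] arrow_map_inv[OF F'(2) B(1) Z(1), of x W]
    by (simp_all add: A B Z f_def g_def)
  let ?P = "pb_ob C (G1 A) (G1 B) (G1 Z) f g"
  let ?p = "pb_fst C (G1 A) (G1 B) (G1 Z) f g" and ?q = "pb_snd C (G1 A) (G1 B) (G1 Z) f g"
  let ?pair = "pb_pair C (G1 A) (G1 B) (G1 Z) f g"
  note p = pb_fst_hom[OF f g] and q = pb_snd_hom[OF f g]
  have sq: "f \<cdot> (?p \<cdot> x) = g \<cdot> (?q \<cdot> x)" "?p \<cdot> x \<in> Hom C W (G1 A)" "?q \<cdot> x \<in> Hom C W (G1 B)"
    if "x \<in> Hom C W ?P" for W x
    using comp_assoc[OF that p f] comp_assoc[OF that q g] pb_square[OF f g]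
      comp_hom[OF that] p q by simp_all
  have ext: "x = y" if "x \<in> Hom C W ?P" "y \<in> Hom C W ?P" "?p \<cdot> x = ?p \<cdot> y" "?q \<cdot> x = ?q \<cdot> y" for W x y
    using pb_ext[OF f g that] .
  note pair = pb_pair_props[OF f g]
  \<comment> \<open>End points are read off the first component; the second has the same ones
    because both components have the same image in \<open>Z\<close>.\<close>
  let ?d = "d0 A \<cdot> ?p" and ?c = "d1 A \<cdot> ?p"
  have d: "?d \<in> Hom C ?P X" "?c \<in> Hom C ?P X"
    using comp_hom[OF p a(1)] comp_hom[OF p a(2)] .
  have d_elem: "?d \<cdot> x = d0 A \<cdot> (?p \<cdot> x)" "?c \<cdot> x = d1 A \<cdot> (?p \<cdot> x)"
      "d0 B \<cdot> (?q \<cdot> x) = d0 A \<cdot> (?p \<cdot> x)" "d1 B \<cdot> (?q \<cdot> x) = d1 A \<cdot> (?p \<cdot> x)"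
    if x: "x \<in> Hom C W ?P" for W x
  proof -
    show "?d \<cdot> x = d0 A \<cdot> (?p \<cdot> x)" "?c \<cdot> x = d1 A \<cdot> (?p \<cdot> x)"
      using comp_assoc[OF x p a(1)] comp_assoc[OF x p a(2)] .
    show "d0 B \<cdot> (?q \<cdot> x) = d0 A \<cdot> (?p \<cdot> x)" "d1 B \<cdot> (?q \<cdot> x) = d1 A \<cdot> (?p \<cdot> x)"
      using f_elem(2,3)[OF sq(2)[OF x]] g_elem(2,3)[OF sq(3)[OF x]] sq(1)[OF x] by simp_all
  qed
  let ?s = "?pair X (s0 A) (s0 B)" and ?j = "?pair ?P (ginv A \<cdot> ?p) (ginv B \<cdot> ?q)"
  let ?M = "\<lambda>W y x. ?pair W (gcomp C A W (?p \<cdot> y) (?p \<cdot> x)) (gcomp C B W (?q \<cdot> y) (?q \<cdot> x))"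
  have s: "?s \<in> Hom C X ?P \<and> ?p \<cdot> ?s = s0 A \<and> ?q \<cdot> ?s = s0 B"
    using f_unit[OF X] g_unit[OF X] pair[OF a(3) b(3)]
    by (simp add: idn_right[OF a(3)] idn_right[OF b(3)])
  have j: "?j \<in> Hom C ?P ?P \<and> ?p \<cdot> ?j = ginv A \<cdot> ?p \<and> ?q \<cdot> ?j = ginv B \<cdot> ?q"
    using f_inv[OF p] g_inv[OF q] pb_square[OF f g] pair[OF comp_hom[OF p a(4)] comp_hom[OF q b(4)]]
    by simp
  have M: "?M W y x \<in> Hom C W ?P" "?p \<cdot> ?M W y x = gcomp C A W (?p \<cdot> y) (?p \<cdot> x)"
      "?q \<cdot> ?M W y x = gcomp C B W (?q \<cdot> y) (?q \<cdot> x)"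
    if xy: "x \<in> Hom C W ?P" "y \<in> Hom C W ?P" "?d \<cdot> y = ?c \<cdot> x" for W x y
  proof -
    have c: "d0 A \<cdot> (?p \<cdot> y) = d1 A \<cdot> (?p \<cdot> x)" "d0 B \<cdot> (?q \<cdot> y) = d1 B \<cdot> (?q \<cdot> x)"
      using xy d_elem by metis+
    \<comment> \<open>Both functors preserve composition, so the componentwise composite is again an
      element of the pullback.\<close>
    have "f \<cdot> gcomp C A W (?p \<cdot> y) (?p \<cdot> x) = g \<cdot> gcomp C B W (?q \<cdot> y) (?q \<cdot> x)"
      using f_elem(4)[OF sq(2)[OF xy(1)] sq(2)[OF xy(2)] c(1)]
        g_elem(4)[OF sq(3)[OF xy(1)] sq(3)[OF xy(2)] c(2)] sq(1)[OF xy(1)] sq(1)[OF xy(2)] by simp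
    from pair[OF gcomp_hom[OF A(1) sq(2)[OF xy(1)] sq(2)[OF xy(2)] c(1)]
        gcomp_hom[OF B(1) sq(3)[OF xy(1)] sq(3)[OF xy(2)] c(2)] this]
    show "?M W y x \<in> Hom C W ?P" "?p \<cdot> ?M W y x = gcomp C A W (?p \<cdot> y) (?p \<cdot> x)"
      "?q \<cdot> ?M W y x = gcomp C B W (?q \<cdot> y) (?q \<cdot> x)"
      by simp_all
  qed
  have elem: "elem_groupoid (Hom C W ?P) (Hom C W X) (\<lambda>x. ?d \<cdot> x) (\<lambda>x. ?c \<cdot> x)
    (\<lambda>x. ?s \<cdot> x) (?M W) (\<lambda>x. ?j \<cdot> x)" for W
  proof (rule elem_groupoid_subdirect[OF elem_groupoid[OF A(1), of W, unfolded A(2)]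
        elem_groupoid[OF B(1), of W, unfolded B(2)], where p = "\<lambda>x. ?p \<cdot> x" and q = "\<lambda>x. ?q \<cdot> x"])
    show "?s \<cdot> x \<in> Hom C W ?P \<and> ?p \<cdot> (?s \<cdot> x) = s0 A \<cdot> x \<and> ?q \<cdot> (?s \<cdot> x) = s0 B \<cdot> x"
      if "x \<in> Hom C W X" for x
      using s comp_hom[OF that s[THEN conjunct1]] comp_assoc[OF that s[THEN conjunct1] p]
        comp_assoc[OF that s[THEN conjunct1] q] by simp
    show "?j \<cdot> x \<in> Hom C W ?P \<and> ?p \<cdot> (?j \<cdot> x) = ginv A \<cdot> (?p \<cdot> x) \<and> ?q \<cdot> (?j \<cdot> x) = ginv B \<cdot> (?q \<cdot> x)"
      if "x \<in> Hom C W ?P" for x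
      using j comp_hom[OF that j[THEN conjunct1]] comp_assoc[OF that j[THEN conjunct1] p]
        comp_assoc[OF that j[THEN conjunct1] q] comp_assoc[OF that p a(4)] comp_assoc[OF that q b(4)]
      by simp
  qed (use sq ext d_elem M in \<open>simp_all\<close>)
  have nat: "?M W y x \<cdot> w = ?M V (y \<cdot> w) (x \<cdot> w)"
    if xy: "x \<in> Hom C W ?P" "y \<in> Hom C W ?P" "?d \<cdot> y = ?c \<cdot> x" and w: "w \<in> Hom C V W" for V W x y w
  proof -
    have xyw: "x \<cdot> w \<in> Hom C V ?P" "y \<cdot> w \<in> Hom C V ?P" "?d \<cdot> (y \<cdot> w) = ?c \<cdot> (x \<cdot> w)"
      using comp_hom[OF w] xy comp_assoc[OF w xy(2) d(1)] comp_assoc[OF w xy(1) d(2)] by simp_all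
    have c: "d0 A \<cdot> (?p \<cdot> y) = d1 A \<cdot> (?p \<cdot> x)" "d0 B \<cdot> (?q \<cdot> y) = d1 B \<cdot> (?q \<cdot> x)"
      using xy d_elem by metis+
    show ?thesis
    proof (rule ext[OF comp_hom[OF w M(1)[OF xy]] M(1)[OF xyw]])
      show "?p \<cdot> (?M W y x \<cdot> w) = ?p \<cdot> ?M V (y \<cdot> w) (x \<cdot> w)"
        using comp_assoc[OF w M(1)[OF xy] p] M(2)[OF xy] M(2)[OF xyw]
          gcomp_comp[OF A(1) sq(2)[OF xy(1)] sq(2)[OF xy(2)] c(1) w]
          comp_assoc[OF w xy(1) p] comp_assoc[OF w xy(2) p] by simp
      show "?q \<cdot> (?M W y x \<cdot> w) = ?q \<cdot> ?M V (y \<cdot> w) (x \<cdot> w)"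
        using comp_assoc[OF w M(1)[OF xy] q] M(3)[OF xy] M(3)[OF xyw]
          gcomp_comp[OF B(1) sq(3)[OF xy(1)] sq(3)[OF xy(2)] c(2) w]
          comp_assoc[OF w xy(1) q] comp_assoc[OF w xy(2) q] by simp
    qed
  qed
  obtain P where P: "internal_groupoid C P" "G0 P = X" "G1 P = ?P" "d0 P = ?d" "d1 P = ?c"
    and P_comp: "\<And>W x y. \<lbrakk>x \<in> Hom C W ?P; y \<in> Hom C W ?P; ?d \<cdot> y = ?c \<cdot> x\<rbrakk>
      \<Longrightarrow> gcomp C P W y x = ?M W y x"
    using internal_groupoidI[OF d s[THEN conjunct1] j[THEN conjunct1] elem nat] by blast
  have d_B: "d0 B \<cdot> ?q = ?d" "d1 B \<cdot> ?q = ?c"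
  proof -
    have i: "Idn C ?P \<in> Hom C ?P ?P"
      using p hom_obj idn_hom by blast
    show "d0 B \<cdot> ?q = ?d" "d1 B \<cdot> ?q = ?c"
      using d_elem[OF i] by (simp_all add: idn_right[OF p] idn_right[OF q])
  qed
  have p_map: "arrow_map P A ?p" "arrow_map P B ?q"
    unfolding arrow_map_def using p q by (simp_all add: P d_B P_comp M)
  have obj: "A \<in> Obj (Grd_fiber C X)" "B \<in> Obj (Grd_fiber C X)" "P \<in> Obj (Grd_fiber C X)"
    using A B P by (simp_all add: fiber_obj)
  have "is_pullback (Grd_fiber C X) A B Z F F' P (Idn C X, ?p) (Idn C X, ?q)"
    unfolding is_pullback_def
  proof (intro conjI allI impI assms)
    show "(Idn C X, ?p) \<in> Hom (Grd_fiber C X) P A" "(Idn C X, ?q) \<in> Hom (Grd_fiber C X) P B"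
      using p_map obj by (simp_all add: fiber_hom)
    show "F \<cdot>\<^bsub>Grd_fiber C X\<^esub> (Idn C X, ?p) = F' \<cdot>\<^bsub>Grd_fiber C X\<^esub> (Idn C X, ?q)"
      using pb_square[OF f g] F(1) F'(1) by (simp add: f_def g_def)
    fix W k l
    assume k: "k \<in> Hom (Grd_fiber C X) W A" and l: "l \<in> Hom (Grd_fiber C X) W B"
      and "F \<cdot>\<^bsub>Grd_fiber C X\<^esub> k = F' \<cdot>\<^bsub>Grd_fiber C X\<^esub> l"
    then have eq: "f \<cdot> snd k = g \<cdot> snd l"
      by (simp add: f_def g_def)
    have W: "internal_groupoid C W" "W \<in> Obj (Grd_fiber C X)"
      and kl: "arrow_map W A (snd k)" "arrow_map W B (snd l)" "fst k = Idn C X" "fst l = Idn C X"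
      using k l by (simp_all add: fiber_hom fiber_obj)
    have kl_hom: "snd k \<in> Hom C (G1 W) (G1 A)" "snd l \<in> Hom C (G1 W) (G1 B)"
      using kl by (simp_all add: arrow_map_def)
    note k_elem = arrow_map_elem[OF kl(1) W(1) A(1)] and l_elem = arrow_map_elem[OF kl(2) W(1) B(1)]
    let ?u = "?pair (G1 W) (snd k) (snd l)"
    note u = pair[OF kl_hom eq, THEN conjunct1] pair[OF kl_hom eq, THEN conjunct2, THEN conjunct1]
      pair[OF kl_hom eq, THEN conjunct2, THEN conjunct2]
    have pu: "?p \<cdot> (?u \<cdot> x) = snd k \<cdot> x" "?q \<cdot> (?u \<cdot> x) = snd l \<cdot> x" "?u \<cdot> x \<in> Hom C V ?P"
      if "x \<in> Hom C V (G1 W)" for V x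
      using comp_assoc[OF that u(1) p] comp_assoc[OF that u(1) q] u(2,3) comp_hom[OF that u(1)]
      by simp_all
    \<comment> \<open>The mediating arrow of \<open>C\<close> is a morphism of the fiber:
      preservation of composition is tested on the two projections.\<close>
    have "?u \<cdot> gcomp C W V y x = gcomp C P V (?u \<cdot> y) (?u \<cdot> x)"
      if xy: "x \<in> Hom C V (G1 W)" "y \<in> Hom C V (G1 W)" "d0 W \<cdot> y = d1 W \<cdot> x" for V x y
    proof -
      have c: "?d \<cdot> (?u \<cdot> y) = ?c \<cdot> (?u \<cdot> x)"
        using xy by (simp add: d_elem[OF pu(3)[OF xy(1)]] d_elem[OF pu(3)[OF xy(2)]] pu
          k_elem(2)[OF xy(2)] k_elem(3)[OF xy(1)])
      note m = pu(3)[OF xy(1)] pu(3)[OF xy(2)] c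
      show ?thesis
        unfolding P_comp[OF m]
        by (rule ext[OF pu(3)[OF gcomp_hom[OF W(1) xy]] M(1)[OF m]])
          (simp_all add: M(2,3)[OF m, unfolded pu(1,2)[OF xy(1)] pu(1,2)[OF xy(2)]] pu(1,2)[OF gcomp_hom[OF W(1) xy]] pu(1,2)[OF xy(1)]
            pu(1,2)[OF xy(2)] k_elem(4)[OF xy] l_elem(4)[OF xy])
    qed
    moreover have "?d \<cdot> ?u = d0 W" "?c \<cdot> ?u = d1 W"
      using comp_assoc[OF u(1) p a(1)] comp_assoc[OF u(1) p a(2)] u(2) kl(1)
      by (simp_all add: arrow_map_def)
    ultimately have "arrow_map W P ?u"
      using u(1) by (simp add: arrow_map_def P)
    then have "(Idn C X, ?u) \<in> Hom (Grd_fiber C X) W P"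
      using W obj by (simp add: fiber_hom)
    then show "\<exists>!v. v \<in> Hom (Grd_fiber C X) W P
        \<and> (Idn C X, ?p) \<cdot>\<^bsub>Grd_fiber C X\<^esub> v = k \<and> (Idn C X, ?q) \<cdot>\<^bsub>Grd_fiber C X\<^esub> v = l"
    proof (intro ex1I[of _ "(Idn C X, ?u)"] conjI)
      show "(Idn C X, ?p) \<cdot>\<^bsub>Grd_fiber C X\<^esub> (Idn C X, ?u) = k"
        "(Idn C X, ?q) \<cdot>\<^bsub>Grd_fiber C X\<^esub> (Idn C X, ?u) = l"
        using u(2,3) kl(3,4) idn_left[OF X] by (simp_all add: prod_eq_iff)
      fix v
      assume v: "v \<in> Hom (Grd_fiber C X) W P
        \<and> (Idn C X, ?p) \<cdot>\<^bsub>Grd_fiber C X\<^esub> v = k \<and> (Idn C X, ?q) \<cdot>\<^bsub>Grd_fiber C X\<^esub> v = l"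
      then have "?p \<cdot> snd v = snd k" "?q \<cdot> snd v = snd l"
        by auto
      moreover have "snd v \<in> Hom C (G1 W) ?P" "fst v = Idn C X"
        using v by (simp_all add: fiber_hom arrow_map_def P)
      ultimately show "v = (Idn C X, ?u)"
        using ext[of "snd v" "G1 W" ?u] u by (simp add: prod_eq_iff)
    qed
  qed
  moreover have "is_pullback C (G1 A) (G1 B) (G1 Z) (snd F) (snd F') (G1 P) ?p ?q"
    using pb_is_pullback[OF f g] by (simp add: P f_def g_def)
  ultimately show thesis
    using that by simp
qed

lemma fiber_finitely_complete:
  assumes "X \<in> Obj C"
  shows "finitely_complete (Grd_fiber C X)"
  unfolding finitely_complete_def
  using fiber_category fiber_terminal[OF assms] fiber_pullback by metis

text \<open>
  The pullbacks in the fiber are unspecified, so the property of the one constructed above is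
  transported along an isomorphism.
\<close>

lemma fiber_is_pullback:
  assumes P: "is_pullback (Grd_fiber C X) A B Z F F' P p q"
  shows "is_pullback C (G1 A) (G1 B) (G1 Z) (snd F) (snd F') (G1 P) (snd p) (snd q)"
proof -
  let ?D = "Grd_fiber C X"
  interpret D: category ?D
    by (rule fiber_category)
  have F: "F \<in> Hom ?D A Z" "F' \<in> Hom ?D B Z" and pq: "p \<in> Hom ?D P A" "q \<in> Hom ?D P B"
      "F \<cdot>\<^bsub>?D\<^esub> p = F' \<cdot>\<^bsub>?D\<^esub> q"
    and P_ex: "\<And>W a b. \<lbrakk>a \<in> Hom ?D W A; b \<in> Hom ?D W B; F \<cdot>\<^bsub>?D\<^esub> a = F' \<cdot>\<^bsub>?D\<^esub> b\<rbrakk>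
      \<Longrightarrow> \<exists>!u. u \<in> Hom ?D W P \<and> p \<cdot>\<^bsub>?D\<^esub> u = a \<and> q \<cdot>\<^bsub>?D\<^esub> u = b"
    using P unfolding is_pullback_def by blast+
  obtain Q r t where Q: "is_pullback ?D A B Z F F' Q r t"
    and QC: "is_pullback C (G1 A) (G1 B) (G1 Z) (snd F) (snd F') (G1 Q) (snd r) (snd t)"
    using fiber_pullback[OF F] .
  have rt: "r \<in> Hom ?D Q A" "t \<in> Hom ?D Q B" "F \<cdot>\<^bsub>?D\<^esub> r = F' \<cdot>\<^bsub>?D\<^esub> t"
    using Q unfolding is_pullback_def by blast+
  obtain u where u: "u \<in> Hom ?D Q P" "p \<cdot>\<^bsub>?D\<^esub> u = r" "q \<cdot>\<^bsub>?D\<^esub> u = t"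
    using P_ex[OF rt] by blast
  obtain v where v: "v \<in> Hom ?D P Q" "r \<cdot>\<^bsub>?D\<^esub> v = p" "t \<cdot>\<^bsub>?D\<^esub> v = q"
    using Q pq unfolding is_pullback_def by blast
  have P_obj: "P \<in> Obj ?D"
    using pq(1) D.hom_obj by blast
  have "p \<cdot>\<^bsub>?D\<^esub> (u \<cdot>\<^bsub>?D\<^esub> v) = p" "q \<cdot>\<^bsub>?D\<^esub> (u \<cdot>\<^bsub>?D\<^esub> v) = q"
    using D.comp_assoc[OF v(1) u(1) pq(1)] D.comp_assoc[OF v(1) u(1) pq(2)] u v by metis+
  then have "u \<cdot>\<^bsub>?D\<^esub> v = Idn ?D P"
    using P_ex[OF pq] D.comp_hom[OF v(1) u(1)] D.idn_hom[OF P_obj] D.idn_right pq(1,2) by metis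
  then have uv: "snd u \<cdot> snd v = Idn C (G1 P)"
    by simp
  have eqs: "snd p \<cdot> snd u = snd r" "snd q \<cdot> snd u = snd t" "snd r \<cdot> snd v = snd p"
      "snd t \<cdot> snd v = snd q" "snd F \<cdot> snd p = snd F' \<cdot> snd q"
    using arg_cong[OF u(2), of snd] arg_cong[OF u(3), of snd] arg_cong[OF v(2), of snd]
      arg_cong[OF v(3), of snd] arg_cong[OF pq(3), of snd] by simp_all
  have h: "snd u \<in> Hom C (G1 Q) (G1 P)" "snd v \<in> Hom C (G1 P) (G1 Q)"
      "snd p \<in> Hom C (G1 P) (G1 A)" "snd q \<in> Hom C (G1 P) (G1 B)"
      "snd r \<in> Hom C (G1 Q) (G1 A)" "snd t \<in> Hom C (G1 Q) (G1 B)"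
      "snd F \<in> Hom C (G1 A) (G1 Z)" "snd F' \<in> Hom C (G1 B) (G1 Z)"
    using u v pq rt F by (auto simp: fiber_hom arrow_map_def)
  show ?thesis
    unfolding is_pullback_def
  proof (intro conjI allI impI h eqs(5))
    fix W a b
    assume ab: "a \<in> Hom C W (G1 A)" "b \<in> Hom C W (G1 B)" "snd F \<cdot> a = snd F' \<cdot> b"
    then have ex1: "\<exists>!w. w \<in> Hom C W (G1 Q) \<and> snd r \<cdot> w = a \<and> snd t \<cdot> w = b"
      using QC unfolding is_pullback_def by blast
    then obtain w where w: "w \<in> Hom C W (G1 Q)" "snd r \<cdot> w = a" "snd t \<cdot> w = b"
      by blast
    show "\<exists>!w. w \<in> Hom C W (G1 P) \<and> snd p \<cdot> w = a \<and> snd q \<cdot> w = b"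
    \<comment> \<open>Mediating arrows into \<open>Q\<close> are carried to \<open>P\<close> by
      \<open>u\<close>; uniqueness is tested in \<open>Q\<close> after composing with
      \<open>v\<close> and brought back by \<open>uv\<close>.\<close>
    proof (rule ex1I[of _ "snd u \<cdot> w"])
      show "snd u \<cdot> w \<in> Hom C W (G1 P) \<and> snd p \<cdot> (snd u \<cdot> w) = a \<and> snd q \<cdot> (snd u \<cdot> w) = b"
        using w comp_hom[OF w(1) h(1)] comp_assoc[OF w(1) h(1,3)] comp_assoc[OF w(1) h(1,4)] eqs
        by simp
      fix w'
      assume w': "w' \<in> Hom C W (G1 P) \<and> snd p \<cdot> w' = a \<and> snd q \<cdot> w' = b"
      then have w'_hom: "w' \<in> Hom C W (G1 P)"
        by blast
      have "snd r \<cdot> (snd v \<cdot> w') = a" "snd t \<cdot> (snd v \<cdot> w') = b"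
        using comp_assoc[OF w'_hom h(2,5)] comp_assoc[OF w'_hom h(2,6)] eqs w' by simp_all
      then have "snd v \<cdot> w' = w"
        using ex1 w comp_hom[OF w'_hom h(2)] by blast
      then show "w' = snd u \<cdot> w"
        using comp_assoc[OF w'_hom h(2,1)] uv idn_left[OF w'_hom] by simp
    qed
  qed
qed

end

section \<open>The natural Mal'tsev operation on the fiber\<close>

context gumm
begin

text \<open>Preservation of composition is the interchange law \<open>chi3_m\<close>, which rests on
  commutativity; this is where the Shifting Lemma enters the naturally Mal'tsev structure.\<close>

lemma arrow_map_gchi:
  assumes G: "internal_groupoid C G" and H: "internal_groupoid C H"
    and maps: "arrow_map G H x" "arrow_map G H y" "arrow_map G H z"
  shows "arrow_map G H (gchi H (G1 G) x y z)"
    and "gparallel H (G1 G) x y" "gparallel H (G1 G) y z"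
proof -
  show par: "gparallel H (G1 G) x y" "gparallel H (G1 G) y z"
    using maps by (simp_all add: gparallel_iff[OF H] arrow_map_def)
  have "gparallel H (G1 G) (gchi H (G1 G) x y z) x"
    using elem_groupoid.chi3_parallel[OF elem_groupoid[OF H] par] .
  then have hom: "gchi H (G1 G) x y z \<in> Hom C (G1 G) (G1 H)" "d0 H \<cdot> gchi H (G1 G) x y z = d0 G"
      "d1 H \<cdot> gchi H (G1 G) x y z = d1 G"
    using maps(1) by (simp_all add: gparallel_iff[OF H] arrow_map_def)
  have "gchi H (G1 G) x y z \<cdot> gcomp C G W b a
      = gcomp C H W (gchi H (G1 G) x y z \<cdot> b) (gchi H (G1 G) x y z \<cdot> a)"
    if ab: "a \<in> Hom C W (G1 G)" "b \<in> Hom C W (G1 G)" "d0 G \<cdot> b = d1 G \<cdot> a" for W a b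
  proof -
    note x = arrow_map_elem[OF maps(1) G H, where W = W]
      and y = arrow_map_elem[OF maps(2) G H, where W = W]
      and z = arrow_map_elem[OF maps(3) G H, where W = W]
    note chi = gchi_comp[OF H par]
    have "d0 H \<cdot> (x \<cdot> b) = d1 H \<cdot> (x \<cdot> a)"
      using ab by (simp add: x)
    from elem_groupoid.chi3_m[OF elem_groupoid[OF H] gchi_commute[OF H]
        gparallel_comp[OF H par(1) ab(1)] gparallel_comp[OF H par(2) ab(1)]
        gparallel_comp[OF H par(1) ab(2)] gparallel_comp[OF H par(2) ab(2)] this]
    show ?thesis
      using ab by (simp add: chi[OF gcomp_hom[OF G ab]] chi[OF ab(1)] chi[OF ab(2)] x y z)
  qed
  then show "arrow_map G H (gchi H (G1 G) x y z)"
    using hom by (simp add: arrow_map_def)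
qed

text \<open>Naturality in the stage is \<open>gchi_comp\<close>; naturality in the groupoid is
  \<open>arrow_map_chi\<close>, as functors preserve composition and inverses.\<close>

theorem fiber_naturally_maltsev:
  assumes X: "X \<in> Obj C"
  shows "naturally_maltsev (Grd_fiber C X)"
proof (rule naturally_maltsevI[OF fiber_finitely_complete[OF X]])
  let ?D = "Grd_fiber C X"
  let ?m = "\<lambda>W A x y z. (Idn C X, gchi A (G1 W) (snd x) (snd y) (snd z))"
  note i = idn_hom[OF X]
  fix W A x y z
  assume x: "x \<in> Hom ?D W A" and y: "y \<in> Hom ?D W A"
  then have A: "internal_groupoid C A" "G0 A = X" and W: "internal_groupoid C W" "G0 W = X"
    and xy: "arrow_map W A (snd x)" "arrow_map W A (snd y)" "fst x = Idn C X" "fst y = Idn C X"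
    by (simp_all add: fiber_hom fiber_obj)
  have p: "gparallel A (G1 W) (snd x) (snd y)"
    using arrow_map_gchi(2)[OF W(1) A(1) xy(1,2,2)] .
  show "?m W A x y y = x" "?m W A y y x = x"
    using elem_groupoid.chi3_left[OF elem_groupoid[OF A(1)] p] xy
      elem_groupoid.chi3_right[OF elem_groupoid[OF A(1)] p] by (simp_all add: prod_eq_iff)
  assume z: "z \<in> Hom ?D W A"
  then have z': "arrow_map W A (snd z)" "fst z = Idn C X"
    by (simp_all add: fiber_hom)
  note g = arrow_map_gchi[OF W(1) A(1) xy(1,2) z'(1)]
  show "?m W A x y z \<in> Hom ?D W A"
    using g(1) A W by (simp add: fiber_hom fiber_obj)
  show "?m W A x y z \<cdot>\<^bsub>?D\<^esub> w = ?m V A (x \<cdot>\<^bsub>?D\<^esub> w) (y \<cdot>\<^bsub>?D\<^esub> w) (z \<cdot>\<^bsub>?D\<^esub> w)"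
    if "w \<in> Hom ?D V W" for V w
    using that gchi_comp[OF A(1) g(2,3)] by (simp add: fiber_hom arrow_map_def idn_left[OF i])
  show "f \<cdot>\<^bsub>?D\<^esub> ?m W A x y z = ?m W B (f \<cdot>\<^bsub>?D\<^esub> x) (f \<cdot>\<^bsub>?D\<^esub> y) (f \<cdot>\<^bsub>?D\<^esub> z)"
    if "f \<in> Hom ?D A B" for B f
    using that arrow_map_chi[OF _ A(1) _ _ g(2,3)] A by (simp add: fiber_hom fiber_obj idn_left[OF i])
qed

end

section \<open>Extending morphisms of points\<close>

text \<open>
  The situation of the fullness proof: \<open>P\<close> and \<open>Q\<close> are points over \<open>Y\<close>, and \<open>R\<close> is the pullback
  of \<open>P\<close> along \<open>h : Z \<rightarrow> Y\<close>, with induced section \<open>r\<close>. The map \<open>w\<close> is a morphism from \<open>R\<close> to the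
  pullback of \<open>Q\<close>, followed by the projection to \<open>Q\<close>.
\<close>

locale point_extension = gumm C for C :: "('o, 'a) cat" (structure) +
  fixes X :: 'o and P Q Y Z R :: "('o, 'a) igrpd" and f s f' s' h p q w r :: 'a
  assumes groupoids: "internal_groupoid C P" "internal_groupoid C Q" "internal_groupoid C Y"
      "internal_groupoid C Z" "internal_groupoid C R"
    and objects [simp]: "G0 P = X" "G0 Q = X" "G0 Y = X" "G0 Z = X" "G0 R = X"
    and maps: "arrow_map P Y f" "arrow_map Y P s" "arrow_map Q Y f'" "arrow_map Y Q s'"
      "arrow_map Z Y h" "arrow_map R Z p" "arrow_map R P q" "arrow_map R Q w" "arrow_map Z R r"
    and eqs: "f \<cdot> s = Idn C (G1 Y)" "f' \<cdot> s' = Idn C (G1 Y)" "f' \<cdot> w = h \<cdot> p"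
      "p \<cdot> r = Idn C (G1 Z)" "q \<cdot> r = s \<cdot> h" "w \<cdot> r = s' \<cdot> h"
    and pullback: "is_pullback C (G1 Z) (G1 P) (G1 Y) h f (G1 R) p q"
begin

lemma map_homs: "f \<in> Hom C (G1 P) (G1 Y)" "s \<in> Hom C (G1 Y) (G1 P)" "f' \<in> Hom C (G1 Q) (G1 Y)"
    "s' \<in> Hom C (G1 Y) (G1 Q)" "h \<in> Hom C (G1 Z) (G1 Y)" "p \<in> Hom C (G1 R) (G1 Z)"
    "q \<in> Hom C (G1 R) (G1 P)" "w \<in> Hom C (G1 R) (G1 Q)" "r \<in> Hom C (G1 Z) (G1 R)"
  using maps by (simp_all add: arrow_map_def)

end

text \<open>Fixing a stage turns all five internal groupoids into ordinary ones. With the rules for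
  the nine maps below, simplification normalizes words in them; two instances are opened when stages
  are compared.\<close>

locale point_extension_at = point_extension C X P Q Y Z R f s f' s' h p q w r
  for C :: "('o, 'a) cat" (structure) and X P Q Y Z R f s f' s' h p q w r +
  fixes W :: 'o
begin

sublocale P: elem_groupoid "Hom C W (G1 P)" "Hom C W X" "\<lambda>a. d0 P \<cdot> a" "\<lambda>a. d1 P \<cdot> a"
    "\<lambda>x. s0 P \<cdot> x" "gcomp C P W" "\<lambda>a. ginv P \<cdot> a"
  using elem_groupoid[OF groupoids(1)] by simp

sublocale Q: elem_groupoid "Hom C W (G1 Q)" "Hom C W X" "\<lambda>a. d0 Q \<cdot> a" "\<lambda>a. d1 Q \<cdot> a"
    "\<lambda>x. s0 Q \<cdot> x" "gcomp C Q W" "\<lambda>a. ginv Q \<cdot> a"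
  using elem_groupoid[OF groupoids(2)] by simp

sublocale Y: elem_groupoid "Hom C W (G1 Y)" "Hom C W X" "\<lambda>a. d0 Y \<cdot> a" "\<lambda>a. d1 Y \<cdot> a"
    "\<lambda>x. s0 Y \<cdot> x" "gcomp C Y W" "\<lambda>a. ginv Y \<cdot> a"
  using elem_groupoid[OF groupoids(3)] by simp

sublocale Z: elem_groupoid "Hom C W (G1 Z)" "Hom C W X" "\<lambda>a. d0 Z \<cdot> a" "\<lambda>a. d1 Z \<cdot> a"
    "\<lambda>x. s0 Z \<cdot> x" "gcomp C Z W" "\<lambda>a. ginv Z \<cdot> a"
  using elem_groupoid[OF groupoids(4)] by simp

sublocale R: elem_groupoid "Hom C W (G1 R)" "Hom C W X" "\<lambda>a. d0 R \<cdot> a" "\<lambda>a. d1 R \<cdot> a"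
    "\<lambda>x. s0 R \<cdot> x" "gcomp C R W" "\<lambda>a. ginv R \<cdot> a"
  using elem_groupoid[OF groupoids(5)] by simp

lemmas map_elem [simp] =
  arrow_map_elem[OF maps(1) groupoids(1,3), where W = W]
  arrow_map_elem[OF maps(2) groupoids(3,1), where W = W]
  arrow_map_elem[OF maps(3) groupoids(2,3), where W = W]
  arrow_map_elem[OF maps(4) groupoids(3,2), where W = W]
  arrow_map_elem[OF maps(5) groupoids(4,3), where W = W]
  arrow_map_elem[OF maps(6) groupoids(5,4), where W = W]
  arrow_map_elem[OF maps(7) groupoids(5,1), where W = W]
  arrow_map_elem[OF maps(8) groupoids(5,2), where W = W]
  arrow_map_elem[OF maps(9) groupoids(4,5), where W = W]

lemmas map_unit [simp] =
  arrow_map_unit[OF maps(1) groupoids(1,3), simplified, where W = W]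
  arrow_map_unit[OF maps(2) groupoids(3,1), simplified, where W = W]
  arrow_map_unit[OF maps(3) groupoids(2,3), simplified, where W = W]
  arrow_map_unit[OF maps(4) groupoids(3,2), simplified, where W = W]
  arrow_map_unit[OF maps(5) groupoids(4,3), simplified, where W = W]
  arrow_map_unit[OF maps(6) groupoids(5,4), simplified, where W = W]
  arrow_map_unit[OF maps(7) groupoids(5,1), simplified, where W = W]
  arrow_map_unit[OF maps(8) groupoids(5,2), simplified, where W = W]
  arrow_map_unit[OF maps(9) groupoids(4,5), simplified, where W = W]

lemmas map_inv [simp] =
  arrow_map_inv[OF maps(1) groupoids(1,3), simplified, where W = W]
  arrow_map_inv[OF maps(2) groupoids(3,1), simplified, where W = W]
  arrow_map_inv[OF maps(3) groupoids(2,3), simplified, where W = W]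
  arrow_map_inv[OF maps(4) groupoids(3,2), simplified, where W = W]
  arrow_map_inv[OF maps(5) groupoids(4,3), simplified, where W = W]
  arrow_map_inv[OF maps(6) groupoids(5,4), simplified, where W = W]
  arrow_map_inv[OF maps(7) groupoids(5,1), simplified, where W = W]
  arrow_map_inv[OF maps(8) groupoids(5,2), simplified, where W = W]
  arrow_map_inv[OF maps(9) groupoids(4,5), simplified, where W = W]

lemma eqs_elem [simp]:
  "b \<in> Hom C W (G1 Y) \<Longrightarrow> f \<cdot> (s \<cdot> b) = b"
  "b \<in> Hom C W (G1 Y) \<Longrightarrow> f' \<cdot> (s' \<cdot> b) = b"
  "c \<in> Hom C W (G1 R) \<Longrightarrow> f' \<cdot> (w \<cdot> c) = h \<cdot> (p \<cdot> c)"
  "c \<in> Hom C W (G1 R) \<Longrightarrow> f \<cdot> (q \<cdot> c) = h \<cdot> (p \<cdot> c)"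
  "z \<in> Hom C W (G1 Z) \<Longrightarrow> p \<cdot> (r \<cdot> z) = z"
  "z \<in> Hom C W (G1 Z) \<Longrightarrow> q \<cdot> (r \<cdot> z) = s \<cdot> (h \<cdot> z)"
  "z \<in> Hom C W (G1 Z) \<Longrightarrow> w \<cdot> (r \<cdot> z) = s' \<cdot> (h \<cdot> z)"
proof -
  note m = map_homs
  show "f \<cdot> (s \<cdot> b) = b" "f' \<cdot> (s' \<cdot> b) = b" if "b \<in> Hom C W (G1 Y)"
    using comp_assoc[OF that m(2,1)] comp_assoc[OF that m(4,3)] eqs idn_left[OF that] by simp_all
  show "f' \<cdot> (w \<cdot> c) = h \<cdot> (p \<cdot> c)" "f \<cdot> (q \<cdot> c) = h \<cdot> (p \<cdot> c)" if "c \<in> Hom C W (G1 R)"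
    using comp_assoc[OF that m(8,3)] comp_assoc[OF that m(6,5)] comp_assoc[OF that m(7,1)] eqs
      pullback by (simp_all add: is_pullback_def)
  show "p \<cdot> (r \<cdot> z) = z" "q \<cdot> (r \<cdot> z) = s \<cdot> (h \<cdot> z)" "w \<cdot> (r \<cdot> z) = s' \<cdot> (h \<cdot> z)"
    if "z \<in> Hom C W (G1 Z)"
    using comp_assoc[OF that m(9,6)] comp_assoc[OF that m(9,7)] comp_assoc[OF that m(9,8)]
      comp_assoc[OF that m(5,2)] comp_assoc[OF that m(5,4)] eqs idn_left[OF that] by simp_all
qed

section \<open>The kernel of the split epimorphism and the candidate extension\<close>

definition in_kernel :: "'a \<Rightarrow> bool" where
  "in_kernel k \<longleftrightarrow> k \<in> Hom C W (G1 P) \<and> f \<cdot> k = s0 Y \<cdot> (d0 P \<cdot> k)"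

definition lift :: "'a \<Rightarrow> 'a" where
  "lift k = (THE c. c \<in> Hom C W (G1 R) \<and> p \<cdot> c = s0 Z \<cdot> (d0 P \<cdot> k) \<and> q \<cdot> c = k)"

text \<open>The map from the kernel of \<open>f\<close> to the kernel of \<open>f'\<close> that is
  induced by \<open>w\<close>.\<close>

definition \<theta> :: "'a \<Rightarrow> 'a" where
  "\<theta> k = w \<cdot> lift k"

lemma in_kernelI: "\<lbrakk>k \<in> Hom C W (G1 P); f \<cdot> k = s0 Y \<cdot> (d0 P \<cdot> k)\<rbrakk> \<Longrightarrow> in_kernel k"
  by (simp add: in_kernel_def)

lemma in_kernel_hom [simp]: "in_kernel k \<Longrightarrow> k \<in> Hom C W (G1 P)"
  and in_kernel_f [simp]: "in_kernel k \<Longrightarrow> f \<cdot> k = s0 Y \<cdot> (d0 P \<cdot> k)"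
  by (simp_all add: in_kernel_def)

lemma in_kernel_loop [simp]:
  assumes "in_kernel k"
  shows "d1 P \<cdot> k = d0 P \<cdot> k"
proof -
  have "d1 P \<cdot> k = d1 Y \<cdot> (f \<cdot> k)"
    using in_kernel_hom[OF assms] by simp
  then show ?thesis
    unfolding in_kernel_f[OF assms] using assms by simp
qed

lemma R_ex1:
  assumes "a \<in> Hom C W (G1 Z)" "b \<in> Hom C W (G1 P)" "h \<cdot> a = f \<cdot> b"
  shows "\<exists>!c. c \<in> Hom C W (G1 R) \<and> p \<cdot> c = a \<and> q \<cdot> c = b"
  using pullback assms unfolding is_pullback_def by blast

lemma lift_ex1:
  assumes "in_kernel k"
  shows "\<exists>!c. c \<in> Hom C W (G1 R) \<and> p \<cdot> c = s0 Z \<cdot> (d0 P \<cdot> k) \<and> q \<cdot> c = k"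
  using assms by (intro R_ex1) simp_all

lemma lift [simp]:
  assumes "in_kernel k"
  shows "lift k \<in> Hom C W (G1 R)" "p \<cdot> lift k = s0 Z \<cdot> (d0 P \<cdot> k)" "q \<cdot> lift k = k"
  using theI'[OF lift_ex1[OF assms]] unfolding lift_def by blast+

lemma lift_eqI:
  assumes "in_kernel k" "c \<in> Hom C W (G1 R)" "p \<cdot> c = s0 Z \<cdot> (d0 P \<cdot> k)" "q \<cdot> c = k"
  shows "lift k = c"
  using lift_ex1[OF assms(1)] assms lift[OF assms(1)] by blast

lemma lift_d [simp]:
  assumes "in_kernel k"
  shows "d0 R \<cdot> lift k = d0 P \<cdot> k" "d1 R \<cdot> lift k = d0 P \<cdot> k"
proof -
  have "d0 R \<cdot> lift k = d0 P \<cdot> (q \<cdot> lift k)" "d1 R \<cdot> lift k = d1 P \<cdot> (q \<cdot> lift k)"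
    using lift(1)[OF assms] by simp_all
  then show "d0 R \<cdot> lift k = d0 P \<cdot> k" "d1 R \<cdot> lift k = d0 P \<cdot> k"
    using assms by simp_all
qed

lemma \<theta> [simp]:
  assumes "in_kernel k"
  shows "\<theta> k \<in> Hom C W (G1 Q)" "d0 Q \<cdot> \<theta> k = d0 P \<cdot> k" "d1 Q \<cdot> \<theta> k = d0 P \<cdot> k"
    "f' \<cdot> \<theta> k = s0 Y \<cdot> (d0 P \<cdot> k)"
  using assms by (simp_all add: \<theta>_def)

lemma in_kernel_unit [simp]: "x \<in> Hom C W X \<Longrightarrow> in_kernel (s0 P \<cdot> x)"
  by (rule in_kernelI) simp_all

lemma \<theta>_unit [simp]:
  assumes "x \<in> Hom C W X"
  shows "\<theta> (s0 P \<cdot> x) = s0 Q \<cdot> x"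
proof -
  have "lift (s0 P \<cdot> x) = s0 R \<cdot> x"
    by (rule lift_eqI) (use assms in simp_all)
  then show ?thesis
    using assms by (simp add: \<theta>_def)
qed

lemma in_kernel_m [simp]:
  assumes "in_kernel k" "in_kernel l" "d0 P \<cdot> k = d0 P \<cdot> l"
  shows "in_kernel (gcomp C P W k l)"
  by (rule in_kernelI) (use assms in simp_all)

lemma \<theta>_m [simp]:
  assumes "in_kernel k" "in_kernel l" "d0 P \<cdot> k = d0 P \<cdot> l"
  shows "\<theta> (gcomp C P W k l) = gcomp C Q W (\<theta> k) (\<theta> l)"
proof -
  have "lift (gcomp C P W k l) = gcomp C R W (lift k) (lift l)"
    by (rule lift_eqI) (use assms in simp_all)
  then show ?thesis
    using assms by (simp add: \<theta>_def)
qed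

definition conjugate :: "'a \<Rightarrow> 'a \<Rightarrow> 'a" where
  "conjugate b k = gcomp C P W (s \<cdot> b) (gcomp C P W k (ginv P \<cdot> (s \<cdot> b)))"

lemma in_kernel_conjugate [simp]:
  assumes "in_kernel k" "b \<in> Hom C W (G1 Y)" "d0 Y \<cdot> b = d0 P \<cdot> k"
  shows "in_kernel (conjugate b k)" "d0 P \<cdot> conjugate b k = d1 Y \<cdot> b"
  using assms by (auto intro!: in_kernelI simp: conjugate_def)

text \<open>Conjugate by \<open>s \<cdot> b\<close>, apply \<open>\<theta>\<close>, conjugate back
  by \<open>s' \<cdot> b\<close>. Compatibility of \<open>\<theta>\<close> with conjugation means
  that the result does not depend on \<open>b\<close>, a form which the Shifting Lemma can
  reach.\<close>

definition \<rho> :: "'a \<Rightarrow> 'a \<Rightarrow> 'a" where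
  "\<rho> k b = gcomp C Q W (ginv Q \<cdot> (s' \<cdot> b)) (gcomp C Q W (\<theta> (conjugate b k)) (s' \<cdot> b))"

lemma \<rho>_hom:
  assumes "in_kernel k" "b \<in> Hom C W (G1 Y)" "d0 Y \<cdot> b = d0 P \<cdot> k"
  shows "\<rho> k b \<in> Hom C W (G1 Q)"
  using assms by (simp add: \<rho>_def)

text \<open>Conjugating a unit gives a unit, and \<open>\<theta>\<close> preserves it. Together with
  \<open>\<rho>_unit_right\<close> this evaluates the degenerate vertices of the rectangle.\<close>

lemma \<rho>_unit_left:
  assumes "b \<in> Hom C W (G1 Y)"
  shows "\<rho> (s0 P \<cdot> (d0 Y \<cdot> b)) b = s0 Q \<cdot> (d0 Y \<cdot> b)"
  using assms by (simp add: \<rho>_def conjugate_def)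

lemma \<rho>_unit_right:
  assumes "in_kernel k"
  shows "\<rho> k (s0 Y \<cdot> (d0 P \<cdot> k)) = \<theta> k"
  using assms by (simp add: \<rho>_def conjugate_def)

definition kpart :: "'a \<Rightarrow> 'a" where
  "kpart a = gcomp C P W a (ginv P \<cdot> (s \<cdot> (f \<cdot> a)))"

lemma in_kernel_kpart [simp]:
  assumes "a \<in> Hom C W (G1 P)"
  shows "in_kernel (kpart a)" "d0 P \<cdot> kpart a = d1 P \<cdot> a"
  using assms by (auto intro!: in_kernelI simp: kpart_def)

text \<open>The rule of a semidirect product: moving the section value
  \<open>s \<cdot> (f \<cdot> b)\<close> to the right past the loop of \<open>a\<close> conjugates
  that loop.\<close>

lemma kpart_m:
  assumes "a \<in> Hom C W (G1 P)" "b \<in> Hom C W (G1 P)" "d0 P \<cdot> b = d1 P \<cdot> a"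
  shows "kpart (gcomp C P W b a) = gcomp C P W (kpart b) (conjugate (f \<cdot> b) (kpart a))"
  using assms by (simp add: kpart_def conjugate_def)

definition extension :: "'a \<Rightarrow> 'a" where
  "extension a = gcomp C Q W (\<theta> (kpart a)) (s' \<cdot> (f \<cdot> a))"

lemma extension_elem:
  assumes "a \<in> Hom C W (G1 P)"
  shows "extension a \<in> Hom C W (G1 Q)" "d0 Q \<cdot> extension a = d0 P \<cdot> a" "d1 Q \<cdot> extension a = d1 P \<cdot> a"
    "f' \<cdot> extension a = f \<cdot> a"
  using assms by (simp_all add: extension_def)

text \<open>The loop of a value of the section is a unit, and \<open>\<theta>\<close> preserves
  units.\<close>

lemma extension_s:
  assumes "b \<in> Hom C W (G1 Y)"
  shows "extension (s \<cdot> b) = s' \<cdot> b"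
  using assms by (simp add: extension_def kpart_def)

text \<open>In \<open>R\<close> the section \<open>r\<close> splits \<open>c\<close> into the loop
  c.r(p(c))\<inverse> and r(p(c)). This loop is the lift of the loop of \<open>q \<cdot> c\<close>,
  and \<open>w\<close> preserves the splitting.\<close>

lemma extension_q:
  assumes "c \<in> Hom C W (G1 R)"
  shows "extension (q \<cdot> c) = w \<cdot> c"
proof -
  have "lift (kpart (q \<cdot> c)) = gcomp C R W c (ginv R \<cdot> (r \<cdot> (p \<cdot> c)))"
    by (rule lift_eqI[OF in_kernel_kpart(1)]) (use assms in \<open>simp_all add: kpart_def\<close>)
  then show ?thesis
    using assms by (simp add: extension_def \<theta>_def)
qed

text \<open>The loop of \<open>a\<close> comes from \<open>R\<close>, where
  \<open>v \<cdot> q = w\<close> prescribes the value; on the other factor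
  \<open>v \<cdot> s = s'\<close> does.\<close>

lemma extension_unique:
  assumes v: "arrow_map P Q v" "v \<cdot> s = s'" "v \<cdot> q = w" and a: "a \<in> Hom C W (G1 P)"
  shows "v \<cdot> a = extension a"
proof -
  have v_hom: "v \<in> Hom C (G1 P) (G1 Q)"
    using v by (simp add: arrow_map_def)
  note v_elem = arrow_map_elem[OF v(1) groupoids(1,2), where W = W]
  have "v \<cdot> kpart a = (v \<cdot> q) \<cdot> lift (kpart a)"
    using comp_assoc[OF _ map_homs(7) v_hom, of "lift (kpart a)" W] a by simp
  moreover have "v \<cdot> (s \<cdot> (f \<cdot> a)) = s' \<cdot> (f \<cdot> a)"
    using comp_assoc[OF _ map_homs(2) v_hom, of "f \<cdot> a" W] a v by simp
  moreover have "gcomp C P W (kpart a) (s \<cdot> (f \<cdot> a)) = a"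
    using a by (simp add: kpart_def)
  ultimately show ?thesis
    using v_elem(4)[of "s \<cdot> (f \<cdot> a)" "kpart a"] a v by (simp add: extension_def \<theta>_def)
qed

end

section \<open>Change of stage, compatibility with conjugation, and the extension\<close>

context point_extension
begin

lemma at: "point_extension_at C X P Q Y Z R f s f' s' h p q w r"
  by (rule point_extension_at.intro) (rule point_extension_axioms)

abbreviation "in_kernel \<equiv> point_extension_at.in_kernel C P Y f"
abbreviation "\<theta> \<equiv> point_extension_at.\<theta> C P Z R p q w"
abbreviation "\<rho> \<equiv> point_extension_at.\<rho> C P Q Z R s s' p q w"
abbreviation "extension \<equiv> point_extension_at.extension C P Q Z R f s s' p q w"

lemmas comp_rules =
  comp_hom
  comp_assoc[OF _ _ map_homs(1)] comp_assoc[OF _ _ map_homs(2)] comp_assoc[OF _ _ map_homs(4)]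
  comp_assoc[OF _ _ map_homs(6)] comp_assoc[OF _ _ map_homs(7)] comp_assoc[OF _ _ map_homs(8)]
  comp_assoc[OF _ _ groupoid_hom(1)[OF groupoids(1)]]
  comp_assoc[OF _ _ groupoid_hom(2)[OF groupoids(1)]]
  comp_assoc[OF _ _ groupoid_hom(4)[OF groupoids(1)]]
  comp_assoc[OF _ _ groupoid_hom(4)[OF groupoids(2)]]
  comp_assoc[OF _ _ groupoid_hom(1)[OF groupoids(3)]]
  comp_assoc[OF _ _ groupoid_hom(3)[OF groupoids(3), simplified]]
  comp_assoc[OF _ _ groupoid_hom(3)[OF groupoids(4), simplified]]

text \<open>A lift precomposed with \<open>t\<close> satisfies the equations that characterize the
  lift of \<open>k \<cdot> t\<close>. Naturality of \<open>\<theta>\<close> is the basis for that of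
  \<open>\<rho>\<close> and \<open>extension\<close>.\<close>

lemma in_kernel_comp:
  assumes k: "in_kernel W k" and t: "t \<in> Hom C V W"
  shows "in_kernel V (k \<cdot> t)" "\<theta> W k \<cdot> t = \<theta> V (k \<cdot> t)"
proof -
  interpret V: point_extension_at C X P Q Y Z R f s f' s' h p q w r V by (rule at)
  interpret W: point_extension_at C X P Q Y Z R f s f' s' h p q w r W by (rule at)
  note c = comp_rules[OF t]
  have k': "f \<cdot> (k \<cdot> t) = s0 Y \<cdot> (d0 P \<cdot> (k \<cdot> t))"
    unfolding comp_assoc[OF t W.in_kernel_hom[OF k] map_homs(1), symmetric] using k by (simp add: c)
  show k_t: "in_kernel V (k \<cdot> t)"
    by (rule V.in_kernelI) (use k k' in \<open>simp_all add: c\<close>)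
  have "V.lift (k \<cdot> t) = W.lift k \<cdot> t"
  proof (rule V.lift_eqI[OF k_t])
    show "W.lift k \<cdot> t \<in> Hom C V (G1 R)"
      using k by (simp add: c)
    show "p \<cdot> (W.lift k \<cdot> t) = s0 Z \<cdot> (d0 P \<cdot> (k \<cdot> t))" "q \<cdot> (W.lift k \<cdot> t) = k \<cdot> t"
      unfolding comp_assoc[OF t W.lift(1)[OF k] map_homs(6), symmetric]
        comp_assoc[OF t W.lift(1)[OF k] map_homs(7), symmetric] using k by (simp_all add: c)
  qed
  then show "\<theta> W k \<cdot> t = \<theta> V (k \<cdot> t)"
    unfolding V.\<theta>_def W.\<theta>_def using W.lift(1)[OF k] by (simp add: c)
qed

lemma \<rho>_comp:
  assumes k: "in_kernel W k" "b \<in> Hom C W (G1 Y)" "d0 Y \<cdot> b = d0 P \<cdot> k" and t: "t \<in> Hom C V W"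
  shows "\<rho> W k b \<cdot> t = \<rho> V (k \<cdot> t) (b \<cdot> t)"
proof -
  interpret V: point_extension_at C X P Q Y Z R f s f' s' h p q w r V by (rule at)
  interpret W: point_extension_at C X P Q Y Z R f s f' s' h p q w r W by (rule at)
  note c = comp_rules[OF t] and g = gcomp_comp[OF groupoids(1) _ _ _ t] gcomp_comp[OF groupoids(2) _ _ _ t]
  have conjugate: "W.conjugate b k \<cdot> t = V.conjugate (b \<cdot> t) (k \<cdot> t)"
    unfolding V.conjugate_def W.conjugate_def using k by (simp add: c g)
  show ?thesis
    unfolding V.\<rho>_def W.\<rho>_def using k by (simp add: c g in_kernel_comp(2)[OF _ t] conjugate)
qed

lemma extension_comp:
  assumes a: "a \<in> Hom C W (G1 P)" and t: "t \<in> Hom C V W"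
  shows "extension W a \<cdot> t = extension V (a \<cdot> t)"
proof -
  interpret V: point_extension_at C X P Q Y Z R f s f' s' h p q w r V by (rule at)
  interpret W: point_extension_at C X P Q Y Z R f s f' s' h p q w r W by (rule at)
  note c = comp_rules[OF t] and g = gcomp_comp[OF groupoids(1) _ _ _ t] gcomp_comp[OF groupoids(2) _ _ _ t]
  have kpart: "W.kpart a \<cdot> t = V.kpart (a \<cdot> t)"
    unfolding V.kpart_def W.kpart_def using a by (simp add: c g)
  show ?thesis
    unfolding V.extension_def W.extension_def using a
    by (simp add: c g in_kernel_comp(2)[OF _ t] kpart)
qed

text \<open>
  The Shifting Lemma on the object of pairs \<open>(k, \<beta>)\<close>, for the kernels of the two projections and
  of \<open>\<rho>\<close>, and the rectangle with vertices \<open>(1, \<beta>)\<close>, \<open>(k, \<beta>)\<close>, \<open>(1, 1)\<close>, \<open>(k, 1)\<close>.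
\<close>

lemma \<rho>_eq_\<theta>:
  assumes k: "in_kernel W k" and b: "b \<in> Hom C W (G1 Y)" "d0 Y \<cdot> b = d0 P \<cdot> k"
  shows "\<rho> W k b = \<theta> W k"
proof -
  interpret W: point_extension_at C X P Q Y Z R f s f' s' h p q w r W by (rule at)
  note d = groupoid_hom(1)[OF groupoids(3), simplified] and s0 = groupoid_hom(3)[OF groupoids(3), simplified]
  \<comment> \<open>\<open>K\<close> represents the kernel: \<open>k0\<close> is the universal loop
    over a unit of \<open>Y\<close>, and \<open>x0\<close> is its base point.\<close>
  obtain K k0 x0 where K: "is_pullback C (G1 P) X (G1 Y) f (s0 Y) K k0 x0"
    using pullback_ex[OF map_homs(1) s0] by blast
  then have k0: "k0 \<in> Hom C K (G1 P)" "x0 \<in> Hom C K X" "f \<cdot> k0 = s0 Y \<cdot> x0"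
    by (simp_all add: is_pullback_def)
  \<comment> \<open>\<open>N\<close> represents the pairs of a kernel loop and an arrow of
    \<open>Y\<close> starting at its base point, the domain on which \<open>\<rho>\<close> is
    defined.\<close>
  obtain N n b1 where N: "is_pullback C K (G1 Y) X x0 (d0 Y) N n b1"
    using pullback_ex[OF k0(2) d] by blast
  then have n: "n \<in> Hom C N K" "b1 \<in> Hom C N (G1 Y)" "x0 \<cdot> n = d0 Y \<cdot> b1"
    by (simp_all add: is_pullback_def)
  interpret N: point_extension_at C X P Q Y Z R f s f' s' h p q w r N by (rule at)
  define k1 where "k1 = k0 \<cdot> n"
  have k1_hom: "k1 \<in> Hom C N (G1 P)"
    using comp_hom[OF n(1) k0(1)] by (simp add: k1_def)
  have f_k1: "f \<cdot> k1 = s0 Y \<cdot> (d0 Y \<cdot> b1)"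
    using comp_assoc[OF n(1) k0(1) map_homs(1)] comp_assoc[OF n(1) k0(2) s0] k0(3) n(3)
    by (simp add: k1_def)
  have "d0 P \<cdot> k1 = d0 Y \<cdot> (f \<cdot> k1)"
    using k1_hom by simp
  then have d_k1: "d0 Y \<cdot> b1 = d0 P \<cdot> k1"
    unfolding f_k1 using n by simp
  have k1: "in_kernel N k1"
    by (rule N.in_kernelI) (use k1_hom f_k1 d_k1 in simp_all)
  have elem: "\<exists>t \<in> Hom C W N. k1 \<cdot> t = l \<and> b1 \<cdot> t = c"
    if l: "in_kernel W l" and c: "c \<in> Hom C W (G1 Y)" "d0 Y \<cdot> c = d0 P \<cdot> l" for l c
  proof -
    have "f \<cdot> l = s0 Y \<cdot> (d0 P \<cdot> l)" "l \<in> Hom C W (G1 P)" "d0 P \<cdot> l \<in> Hom C W X"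
      using l by simp_all
    then obtain m where m: "m \<in> Hom C W K" "k0 \<cdot> m = l" "x0 \<cdot> m = d0 P \<cdot> l"
      using K unfolding is_pullback_def by metis
    then obtain t where t: "t \<in> Hom C W N" "n \<cdot> t = m" "b1 \<cdot> t = c"
      using N c unfolding is_pullback_def by metis
    then show ?thesis
      using comp_assoc[OF t(1) n(1) k0(1)] m by (auto simp: k1_def)
  qed
  let ?r = "\<rho> N k1 b1"
  have r_comp: "?r \<cdot> t = \<rho> V (k1 \<cdot> t) (b1 \<cdot> t)" if "t \<in> Hom C V N" for V t
    using \<rho>_comp[OF k1 n(2) d_k1 that] .
  have x: "d0 P \<cdot> k \<in> Hom C W X"
    using k by simp
  obtain t1 where t1: "t1 \<in> Hom C W N" "k1 \<cdot> t1 = s0 P \<cdot> (d0 P \<cdot> k)" "b1 \<cdot> t1 = b"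
    using elem[of "s0 P \<cdot> (d0 P \<cdot> k)" b] b x by auto
  obtain t2 where t2: "t2 \<in> Hom C W N" "k1 \<cdot> t2 = k" "b1 \<cdot> t2 = b"
    using elem[OF k b] by blast
  obtain t3 where t3: "t3 \<in> Hom C W N" "k1 \<cdot> t3 = s0 P \<cdot> (d0 P \<cdot> k)" "b1 \<cdot> t3 = s0 Y \<cdot> (d0 P \<cdot> k)"
    using elem[of "s0 P \<cdot> (d0 P \<cdot> k)" "s0 Y \<cdot> (d0 P \<cdot> k)"] x by auto
  obtain t4 where t4: "t4 \<in> Hom C W N" "k1 \<cdot> t4 = k" "b1 \<cdot> t4 = s0 Y \<cdot> (d0 P \<cdot> k)"
    using elem[of k "s0 Y \<cdot> (d0 P \<cdot> k)"] k x by auto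
  \<comment> \<open>Both sides are the unit of \<open>Q\<close>: this is the known side of the
    rectangle.\<close>
  have "?r \<cdot> t1 = ?r \<cdot> t3"
    using r_comp[OF t1(1)] r_comp[OF t3(1)] t1 t3 W.\<rho>_unit_left[OF b(1)] b
      W.\<rho>_unit_right[OF W.in_kernel_unit[OF x]] x by simp
  \<comment> \<open>The inclusion of kernels holds because, by \<open>r_comp\<close>, the value of
    \<open>?r\<close> at \<open>t\<close> is an expression in \<open>k1 \<cdot> t\<close> and
    \<open>b1 \<cdot> t\<close>.\<close>
  then have "?r \<cdot> t2 = ?r \<cdot> t4"
    using t1 t2 t3 t4 r_comp
    by (intro shift_maps[OF k1_hom n(2) N.\<rho>_hom[OF k1 n(2) d_k1] _ t1(1) t2(1) t3(1) t4(1)]) simp_all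
  then show ?thesis
    using r_comp[OF t2(1)] r_comp[OF t4(1)] t2 t4 W.\<rho>_unit_right[OF k] by simp
qed

text \<open>Composing \<open>\<rho>\<close> on the left with \<open>s' \<cdot> b\<close> undoes the
  outer inverse, so independence of \<open>b\<close> becomes an exchange law without inverses in
  \<open>Q\<close>.\<close>

lemma \<theta>_conjugate:
  assumes k: "in_kernel W k" and b: "b \<in> Hom C W (G1 Y)" "d0 Y \<cdot> b = d0 P \<cdot> k"
  shows "gcomp C Q W (\<theta> W (point_extension_at.conjugate C P s W b k)) (s' \<cdot> b)
    = gcomp C Q W (s' \<cdot> b) (\<theta> W k)"
proof -
  interpret W: point_extension_at C X P Q Y Z R f s f' s' h p q w r W by (rule at)
  have "gcomp C Q W (s' \<cdot> b) (\<rho> W k b) = gcomp C Q W (\<theta> W (W.conjugate b k)) (s' \<cdot> b)"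
    using k b by (simp add: W.\<rho>_def)
  then show ?thesis
    using \<rho>_eq_\<theta>[OF assms] by simp
qed

text \<open>After \<open>kpart_m\<close>, the loop of \<open>a\<close> occurs conjugated in front of
  \<open>s' \<cdot> (f \<cdot> b)\<close>; \<open>\<theta>_conjugate\<close> moves it behind that
  factor, next to \<open>s' \<cdot> (f \<cdot> a)\<close>.\<close>

lemma extension_m:
  assumes a: "a \<in> Hom C W (G1 P)" and b: "b \<in> Hom C W (G1 P)" and ab: "d0 P \<cdot> b = d1 P \<cdot> a"
  shows "extension W (gcomp C P W b a) = gcomp C Q W (extension W b) (extension W a)"
proof -
  interpret W: point_extension_at C X P Q Y Z R f s f' s' h p q w r W by (rule at)
  let ?c = "W.conjugate (f \<cdot> b) (W.kpart a)"
  have "gcomp C Q W (\<theta> W ?c) (s' \<cdot> (f \<cdot> b)) = gcomp C Q W (s' \<cdot> (f \<cdot> b)) (\<theta> W (W.kpart a))"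
    using a b ab by (intro \<theta>_conjugate) simp_all
  then have "gcomp C Q W (gcomp C Q W (\<theta> W ?c) (s' \<cdot> (f \<cdot> b))) (s' \<cdot> (f \<cdot> a))
      = gcomp C Q W (gcomp C Q W (s' \<cdot> (f \<cdot> b)) (\<theta> W (W.kpart a))) (s' \<cdot> (f \<cdot> a))"
    by simp
  then show ?thesis
    using a b ab by (simp add: W.extension_def W.kpart_m)
qed

theorem unique_extension:
  "\<exists>!v. arrow_map P Q v \<and> f' \<cdot> v = f \<and> v \<cdot> s = s' \<and> v \<cdot> q = w"
proof (rule ex1I)
  \<comment> \<open>The extension is evaluated at the universal element of \<open>P\<close>; by
    naturality in the stage, composing with \<open>?v\<close> gives the extension of every
    element.\<close>
  let ?v = "extension (G1 P) (Idn C (G1 P))"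
  note m = map_homs
  have i: "Idn C (G1 P) \<in> Hom C (G1 P) (G1 P)"
    using m(1) hom_obj idn_hom by blast
  interpret i: point_extension_at C X P Q Y Z R f s f' s' h p q w r "G1 P" by (rule at)
  have v_elem: "?v \<cdot> a = extension W a" if "a \<in> Hom C W (G1 P)" for W a
    using extension_comp[OF i that] idn_left[OF that] by simp
  note v = i.extension_elem[OF i]
  have "?v \<cdot> gcomp C P W b a = gcomp C Q W (?v \<cdot> b) (?v \<cdot> a)"
    if "a \<in> Hom C W (G1 P)" "b \<in> Hom C W (G1 P)" "d0 P \<cdot> b = d1 P \<cdot> a" for W a b
    using that extension_m[OF that] gcomp_hom[OF groupoids(1) that] by (simp add: v_elem)
  moreover have "d0 P \<cdot> Idn C (G1 P) = d0 P" "d1 P \<cdot> Idn C (G1 P) = d1 P" "f \<cdot> Idn C (G1 P) = f"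
    using idn_right groupoid_hom(1,2)[OF groupoids(1)] m(1) by blast+
  ultimately have "arrow_map P Q ?v \<and> f' \<cdot> ?v = f"
    using v by (simp add: arrow_map_def)
  moreover have "?v \<cdot> s = s'"
  proof -
    interpret y: point_extension_at C X P Q Y Z R f s f' s' h p q w r "G1 Y" by (rule at)
    have "Idn C (G1 Y) \<in> Hom C (G1 Y) (G1 Y)"
      using m(1) hom_obj idn_hom by blast
    then show ?thesis
      using y.extension_s v_elem[OF m(2)] idn_right[OF m(2)] idn_right[OF m(4)] by metis
  qed
  moreover have "?v \<cdot> q = w"
  proof -
    interpret c: point_extension_at C X P Q Y Z R f s f' s' h p q w r "G1 R" by (rule at)
    have "Idn C (G1 R) \<in> Hom C (G1 R) (G1 R)"
      using m(7) hom_obj idn_hom by blast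
    then show ?thesis
      using c.extension_q v_elem[OF m(7)] idn_right[OF m(7)] idn_right[OF m(8)] by metis
  qed
  ultimately show "arrow_map P Q ?v \<and> f' \<cdot> ?v = f \<and> ?v \<cdot> s = s' \<and> ?v \<cdot> q = w"
    by blast
  fix u
  assume u: "arrow_map P Q u \<and> f' \<cdot> u = f \<and> u \<cdot> s = s' \<and> u \<cdot> q = w"
  then have "u \<cdot> Idn C (G1 P) = ?v"
    using i.extension_unique[OF _ _ _ i] by blast
  moreover have "u \<in> Hom C (G1 P) (G1 Q)"
    using u by (simp add: arrow_map_def)
  ultimately show "u = ?v"
    using idn_right by metis
qed

end

section \<open>Full faithfulness of base change\<close>

theorem (in gumm) fiber_base_change:
  assumes X: "X \<in> Obj C" and h: "h \<in> Hom (Grd_fiber C X) Y' Y"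
  shows "fully_faithful (Pt (Grd_fiber C X) Y) (Pt (Grd_fiber C X) Y')
    (base_change (Grd_fiber C X) Y' Y h)"
proof -
  let ?D = "Grd_fiber C X"
  let ?B = "base_change ?D Y' Y h"
  interpret D: fincat ?D
    using fiber_finitely_complete[OF X] by (simp add: fincat_iff)
  have is_func: "is_functor (Pt ?D Y) (Pt ?D Y') ?B"
    by (rule D.base_change_functor[OF h])
  \<comment> \<open>Injectivity and surjectivity on hom-sets at once: each morphism between base
    changes has exactly one preimage.\<close>
  have ex1: "\<exists>!v. v \<in> Hom (Pt ?D Y) P Q \<and> FArr ?B P Q v = u"
    if P: "P \<in> Obj (Pt ?D Y)" and Q: "Q \<in> Obj (Pt ?D Y)"
      and u: "u \<in> Hom (Pt ?D Y') (FObj ?B P) (FObj ?B Q)" for P Q u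
  proof -
    let ?R = "PTot (FObj ?B P)" and ?r = "sect (FObj ?B P)"
    let ?p = "pb_fst ?D Y' (PTot P) Y h (proj P)" and ?q = "pb_snd ?D Y' (PTot P) Y h (proj P)"
    let ?p' = "pb_fst ?D Y' (PTot Q) Y h (proj Q)" and ?q' = "pb_snd ?D Y' (PTot Q) Y h (proj Q)"
    have pt: "is_point ?D Y P" "is_point ?D Y Q"
      using P Q by (simp_all add: Pt_def)
    then have P': "proj P \<in> Hom ?D (PTot P) Y" "sect P \<in> Hom ?D Y (PTot P)"
        "proj P \<cdot>\<^bsub>?D\<^esub> sect P = Idn ?D Y"
      and Q': "proj Q \<in> Hom ?D (PTot Q) Y" "sect Q \<in> Hom ?D Y (PTot Q)"
        "proj Q \<cdot>\<^bsub>?D\<^esub> sect Q = Idn ?D Y"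
      by (simp_all add: is_point_def)
    note BP = D.base_change_point[OF h pt(1)] and BQ = D.base_change_point[OF h pt(2)]
    have u': "u \<in> Hom ?D ?R (PTot (FObj ?B Q))" "?p' \<cdot>\<^bsub>?D\<^esub> u = ?p" "u \<cdot>\<^bsub>?D\<^esub> ?r = sect (FObj ?B Q)"
      using u by (simp_all add: Pt_def D.base_change_proj[OF h])
    \<comment> \<open>The other projection of \<open>u\<close> is prescribed by
      \<open>u'(2)\<close>, so \<open>w\<close> carries all the information in
      \<open>u\<close>.\<close>
    define w where "w = ?q' \<cdot>\<^bsub>?D\<^esub> u"
    have w: "w \<in> Hom ?D ?R (PTot Q)"
      unfolding w_def by (rule D.comp_hom[OF u'(1) BQ(3)])
    have "proj Q \<cdot>\<^bsub>?D\<^esub> w = h \<cdot>\<^bsub>?D\<^esub> ?p"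
      using D.comp_assoc[OF u'(1) BQ(3) Q'(1)] D.comp_assoc[OF u'(1) BQ(2) h] BQ(4) u'(2)
      by (simp only: w_def)
    moreover have "w \<cdot>\<^bsub>?D\<^esub> ?r = sect Q \<cdot>\<^bsub>?D\<^esub> h"
      using D.comp_assoc[OF BP(5) u'(1) BQ(3)] BQ(7) u'(3) by (simp only: w_def)
    ultimately have eqs: "snd (proj Q) \<cdot> snd w = snd h \<cdot> snd ?p" "snd w \<cdot> snd ?r = snd (sect Q) \<cdot> snd h"
      by simp_all
    have "is_pullback ?D Y' (PTot P) Y h (proj P) ?R ?p ?q"
      using D.pb_is_pullback[OF h P'(1)] by (simp add: D.base_change_PTot[OF h])
    \<comment> \<open>The pullback chosen in the fiber is arbitrary, but on objects of arrows it is
      a pullback in \<open>C\<close>, as \<open>point_extension\<close> requires.\<close>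
    note pullback = fiber_is_pullback[OF this]
    note homs = P'(1,2) Q'(1,2) h BP(2,3,5) w
    have objs: "internal_groupoid C (PTot P)" "internal_groupoid C (PTot Q)" "internal_groupoid C Y"
        "internal_groupoid C Y'" "internal_groupoid C ?R"
        "G0 (PTot P) = X" "G0 (PTot Q) = X" "G0 Y = X" "G0 Y' = X" "G0 ?R = X"
      using homs by (simp_all add: fiber_hom fiber_obj)
    interpret point_extension C X "PTot P" "PTot Q" Y Y' ?R "snd (proj P)" "snd (sect P)"
      "snd (proj Q)" "snd (sect Q)" "snd h" "snd ?p" "snd ?q" "snd w" "snd ?r"
    proof
      show "snd (proj P) \<cdot> snd (sect P) = Idn C (G1 Y)" "snd (proj Q) \<cdot> snd (sect Q) = Idn C (G1 Y)"
        "snd ?p \<cdot> snd ?r = Idn C (G1 Y')" "snd ?q \<cdot> snd ?r = snd (sect P) \<cdot> snd h"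
        using P'(3) Q'(3) BP(6,7) by simp_all
    qed (use homs objs eqs pullback in \<open>simp_all add: fiber_hom\<close>)
    \<comment> \<open>The first projections of both sides agree already, and object parts are
      identities, so equality is tested on the arrow part of the second projection.\<close>
    have FArr_iff: "FArr ?B P Q v = u \<longleftrightarrow> snd v \<cdot> snd ?q = snd w" if v: "v \<in> Hom (Pt ?D Y) P Q" for v
    proof -
      note a = D.base_change_arrow[OF h v]
      have v': "v \<in> Hom ?D (PTot P) (PTot Q)"
        using v by (simp add: Pt_def)
      have "FArr ?B P Q v = u \<longleftrightarrow> v \<cdot>\<^bsub>?D\<^esub> ?q = w"
        using D.base_change_ext[OF h pt(2) a(1) u'(1)] a u'(2) by (metis w_def)
      moreover have "fst (v \<cdot>\<^bsub>?D\<^esub> ?q) = fst w"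
        using D.comp_hom[OF BP(3) v'] w unfolding fiber_hom by metis
      ultimately show ?thesis
        by (simp add: prod_eq_iff)
    qed
    have Pt_hom: "v \<in> Hom (Pt ?D Y) P Q \<longleftrightarrow> fst v = Idn C X \<and> arrow_map (PTot P) (PTot Q) (snd v)
        \<and> snd (proj Q) \<cdot> snd v = snd (proj P) \<and> snd v \<cdot> snd (sect P) = snd (sect Q)" for v
    proof -
      have "fst (proj P) = Idn C X" "fst (proj Q) = Idn C X" "fst (sect P) = Idn C X"
          "fst (sect Q) = Idn C X" "PTot P \<in> Obj ?D" "PTot Q \<in> Obj ?D"
        using homs by (simp_all add: fiber_hom)
      then show ?thesis
        using pt idn_left[OF idn_hom[OF X]] by (auto simp: Pt_def fiber_hom prod_eq_iff)
    qed
    have "\<exists>!v. arrow_map (PTot P) (PTot Q) v \<and> snd (proj Q) \<cdot> v = snd (proj P)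
        \<and> v \<cdot> snd (sect P) = snd (sect Q) \<and> v \<cdot> snd ?q = snd w"
      by (rule unique_extension)
    then obtain v where v: "arrow_map (PTot P) (PTot Q) v" "snd (proj Q) \<cdot> v = snd (proj P)"
        "v \<cdot> snd (sect P) = snd (sect Q)" "v \<cdot> snd ?q = snd w"
      and v_eq: "\<And>v'. \<lbrakk>arrow_map (PTot P) (PTot Q) v'; snd (proj Q) \<cdot> v' = snd (proj P);
        v' \<cdot> snd (sect P) = snd (sect Q); v' \<cdot> snd ?q = snd w\<rbrakk> \<Longrightarrow> v' = v"
      by blast
    show ?thesis
    proof (rule ex1I[of _ "(Idn C X, v)"])
      have "(Idn C X, v) \<in> Hom (Pt ?D Y) P Q"
        using v by (simp add: Pt_hom)
      then show "(Idn C X, v) \<in> Hom (Pt ?D Y) P Q \<and> FArr ?B P Q (Idn C X, v) = u"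
        using v by (simp add: FArr_iff)
      fix v'
      assume v': "v' \<in> Hom (Pt ?D Y) P Q \<and> FArr ?B P Q v' = u"
      then have "snd v' \<cdot> snd ?q = snd w"
        using FArr_iff by blast
      then show "v' = (Idn C X, v)"
        using v' v_eq[of "snd v'"] by (simp add: Pt_hom prod_eq_iff)
    qed
  qed
  have "bij_betw (FArr ?B P Q) (Hom (Pt ?D Y) P Q) (Hom (Pt ?D Y') (FObj ?B P) (FObj ?B Q))"
    if "P \<in> Obj (Pt ?D Y)" "Q \<in> Obj (Pt ?D Y)" for P Q
  proof -
    have into: "FArr ?B P Q v \<in> Hom (Pt ?D Y') (FObj ?B P) (FObj ?B Q)" if "v \<in> Hom (Pt ?D Y) P Q" for v
      using is_func that unfolding is_functor_def by blast
    have "inj_on (FArr ?B P Q) (Hom (Pt ?D Y) P Q)"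
    proof (rule inj_onI)
      fix v v'
      assume "v \<in> Hom (Pt ?D Y) P Q" "v' \<in> Hom (Pt ?D Y) P Q" "FArr ?B P Q v = FArr ?B P Q v'"
      then show "v = v'"
        using ex1[OF that into[of v']] by metis
    qed
    moreover have "FArr ?B P Q ` Hom (Pt ?D Y) P Q = Hom (Pt ?D Y') (FObj ?B P) (FObj ?B Q)"
    proof (intro subset_antisym subsetI)
      fix u
      assume "u \<in> Hom (Pt ?D Y') (FObj ?B P) (FObj ?B Q)"
      from ex1[OF that this] show "u \<in> FArr ?B P Q ` Hom (Pt ?D Y) P Q"
        by blast
    qed (use into in blast)
    ultimately show ?thesis
      by (simp add: bij_betw_def)
  qed
  then show ?thesis
    using is_func by (simp add: fully_faithful_def)
qed

theorem proposition4p6: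
  fixes E :: "('o, 'a) cat"
  assumes "gumm_category E"
  shows "(\<forall>G. internal_groupoid E G \<longrightarrow> abelian_groupoid E G) \<and>
         (\<forall>X \<in> Obj E. naturally_maltsev (Grd_fiber E X)) \<and>
         (\<forall>X \<in> Obj E. \<forall>Y' Y h. h \<in> Hom (Grd_fiber E X) Y' Y \<longrightarrow>
            fully_faithful (Pt (Grd_fiber E X) Y) (Pt (Grd_fiber E X) Y')
              (base_change (Grd_fiber E X) Y' Y h))"
proof -
  interpret gumm E
    using assms by (simp add: gumm_iff)
  show ?thesis
    using abelian fiber_naturally_maltsev fiber_base_change by blast
qed

end
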